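(* Suppose $\eta_{\mathbf y},\eta_p,\eta_{\mathbf w},\eta_q$ are real numbers such that $$\|\hat{\mathbf y}-\bar{\mathbf y}_{\mathscr T}\|_{\mathbf V,\Omega}\le \eta_{\mathbf y},\quad \|\hat p-\bar p_{\mathscr T}\|_{Q,\Omega}\le\eta_p,\quad \|\hat{\mathbf w}-\bar{\mathbf w}_{\mathscr T}\|_{\mathbf V,\Omega}\le \eta_{\mathbf w},\quad \|\hat q-\bar q_{\mathscr T}\|_{Q,\Omega}\le\eta_q .$$ Then $$E_\Omega^2\le \Upsilon^2:=\mathfrak C_{\mathbf y}\eta_{\mathbf y}^2+2\varrho\,\eta_p^2+\mathfrak C_{\mathbf w}\eta_{\mathbf w}^2+2\varrho\,\eta_q^2+\mathfrak C_{\mathbf u}\eta_{\mathbf u}^2 ,$$ where $E_\Omega$ is the total error, $\eta_{\mathbf u}$ the control indicator and, with $\mu=4\vartheta^{-2}$ and $\omega=C_{is}^2(1+C_{ct})^2$, $$\mathfrak C_{\mathbf y}=2+2\mu C_\Omega^6+4(1+\varrho\omega)(C_\Omega^4+\mu C_\Omega^8+2\mu C_\Omega^{12}),$$ $$\mathfrak C_{\mathbf w}=2+\mu C_\Omega^2+2\mu(1+\varrho\omega)(C_\Omega^4+2C_\Omega^8),$$ $$\mathfrak C_{\mathbf u}=2+2\mu C_\Omega^8+4(1+\varrho\omega)(C_\Omega^2+2C_\Omega^6+\mu C_\Omega^{10}+2\mu C_\Omega^{14}).$$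
   Context: Setting. $d\in\{2,3\}$; $\Omega\subset\mathbb R^d$ is an open bounded polytopal domain with Lipschitz boundary; $\mathbf f,\mathbf y_\Omega\in L^2(\Omega)^d$; $\varepsilon>0$, $\kappa\ge0$, $\vartheta>0$, $\varrho\ge 0$ are real; $\mathbf c\in W^{1,\infty}(\Omega)^d$ with $\nabla\cdot\mathbf c=0$; $\mathbf a,\mathbf b\in\mathbb R^d$ with $\mathbf a<\mathbf b$ (vector inequalities are componentwise). $\mathbf V=H^1_0(\Omega)^d$, $Q=L^2_0(\Omega)$ (zero-mean $L^2$ functions), $\mathbf U_{ad}=\{\mathbf v\in L^2(\Omega)^d:\mathbf a\le\mathbf v\le\mathbf b\text{ a.e. in }\Omega\}$. $\mathscr T$ is a conforming partition of $\bar\Omega$ into simplices $K$, a member of a shape-regular family. Norms: $\|\boldsymbol\xi\|_{\mathbf V,K}^2=\varepsilon\|\nabla\boldsymbol\xi\|_{L^2(K)}^2+\kappa\|\boldsymbol\xi\|_{L^2(K)}^2$, $\|\phi\|_{Q,K}=\|\phi\|_{L^2(K)}$, and $\|\cdot\|^2_{\mathbf V,\Omega}=\sum_{K\in\mathscr T}\|\cdot\|^2_{\mathbf V,K}$, $\|\cdot\|^2_{Q,\Omega}=\sum_{K\in\mathscr T}\|\cdot\|_{Q,K}^2$. Forms: $\mathcal A(\boldsymbol\xi,\boldsymbol\zeta)=\varepsilon(\nabla\boldsymbol\xi,\nabla\boldsymbol\zeta)_\Omega+(\kappa\boldsymbol\xi+(\mathbf c\cdot\nabla)\boldsymbol\xi,\boldsymbol\zeta)_\Omega$,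 $\mathcal B(\boldsymbol\zeta,\phi)=(\phi,\nabla\cdot\boldsymbol\zeta)_\Omega$, $\mathcal C(\boldsymbol\xi,\boldsymbol\zeta)=\varepsilon(\nabla\boldsymbol\xi,\nabla\boldsymbol\zeta)_\Omega+(\kappa\boldsymbol\xi-(\mathbf c\cdot\nabla)\boldsymbol\xi,\boldsymbol\zeta)_\Omega$, with $(\cdot,\cdot)_\Omega$ the $L^2(\Omega)$ inner product. Constants: $C_{P,\Omega}=\frac1\pi\big(\sum_{i=1}^d |l_i|^{-2}\big)^{-1/2}$, where $|l_1|,\dots,|l_d|$ are the side lengths of a $d$-dimensional box containing $\Omega$; $C_\Omega=C_{P,\Omega}/\sqrt\varepsilon$ if $\kappa=0$ and $C_\Omega=\min\{C_{P,\Omega}/\sqrt\varepsilon,1/\sqrt\kappa\}$ if $\kappa\ne0$; $C_{ct}=1+\frac{C_\Omega}{\sqrt\varepsilon}\||\mathbf c|\|_{L^\infty(\Omega)}$; $\beta>0$ is a constant with $\beta\|\phi\|_{L^2(\Omega)}\le\sup_{\boldsymbol\xi\in\mathbf V\setminus\{0\}}\mathcal B(\boldsymbol\xi,\phi)/\|\nabla\boldsymbol\xi\|_{L^2(\Omega)}$ for all $\phi\in Q$; $C_{is}=\sqrt{\varepsilon+\kappa C_{P,\Omega}^2}/\beta$. Continuous optimality system: $(\bar{\mathbf y},\bar p,\bar{\mathbf w},\bar q,\bar{\mathbf u})\in\mathbf V\times Q\times\mathbf V\times Q\times\mathbf U_{ad}$ is the unique solution of: $\mathcal A(\bar{\mathbf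 y},\boldsymbol\xi)-\mathcal B(\boldsymbol\xi,\bar p)=(\mathbf f+\bar{\mathbf u},\boldsymbol\xi)_\Omega$, $\mathcal B(\bar{\mathbf y},\phi)=0$, $\mathcal C(\bar{\mathbf w},\boldsymbol\zeta)+\mathcal B(\boldsymbol\zeta,\bar q)=(\bar{\mathbf y}-\mathbf y_\Omega,\boldsymbol\zeta)_\Omega$, $\mathcal B(\bar{\mathbf w},\psi)=0$, $(\bar{\mathbf w}+\vartheta\bar{\mathbf u},\mathbf u-\bar{\mathbf u})_\Omega\ge0$ for all $\boldsymbol\xi,\boldsymbol\zeta\in\mathbf V$, $\phi,\psi\in Q$, $\mathbf u\in\mathbf U_{ad}$. (It characterizes the minimizer of $\frac12\|\mathbf y-\mathbf y_\Omega\|^2_{L^2}+\frac\vartheta2\|\mathbf u\|_{L^2}^2$ subject to the generalized Oseen equations and $\mathbf u\in\mathbf U_{ad}$.) Discrete system: $\mathbf V(\mathscr T)\subset\mathbf V$ and $Q(\mathscr T)\subset Q$ are (discrete) subspaces and $\mathbf U_{ad}(\mathscr T)\subset\mathbf U_{ad}$ is a (discrete) subset. $\mathcal S,\mathcal H,\mathcal Q,\mathcal K$ are real-valued stabilization terms (possibly zero, with no relation between them assumed). $(\bar{\mathbf y}_{\mathscr T},\bar p_{\mathscr T},\bar{\mathbf w}_{\mathscr T},\bar q_{\mathscr T},\bar{\mathbf u}_{\mathscr T})\in\mathbf V(\mathscr T)\times Q(\mathscr T)\times\mathbf V(\mathscr T)\times Q(\mathscr T)\times\mathbf U_{ad}(\mathscr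 T)$ is a solution (at least one is assumed to exist) of: $\mathcal A(\bar{\mathbf y}_{\mathscr T},\boldsymbol\xi)-\mathcal B(\boldsymbol\xi,\bar p_{\mathscr T})+\mathcal S(\bar{\mathbf y}_{\mathscr T},\bar p_{\mathscr T},\mathbf f+\bar{\mathbf u}_{\mathscr T};\boldsymbol\xi)=(\mathbf f+\bar{\mathbf u}_{\mathscr T},\boldsymbol\xi)_\Omega$, $\mathcal B(\bar{\mathbf y}_{\mathscr T},\phi)+\mathcal H(\bar{\mathbf y}_{\mathscr T},\bar p_{\mathscr T},\mathbf f+\bar{\mathbf u}_{\mathscr T};\phi)=0$, $\mathcal C(\bar{\mathbf w}_{\mathscr T},\boldsymbol\zeta)+\mathcal B(\boldsymbol\zeta,\bar q_{\mathscr T})+\mathcal Q(\bar{\mathbf w}_{\mathscr T},\bar q_{\mathscr T},\bar{\mathbf y}_{\mathscr T}-\mathbf y_\Omega;\boldsymbol\zeta)=(\bar{\mathbf y}_{\mathscr T}-\mathbf y_\Omega,\boldsymbol\zeta)_\Omega$, $\mathcal B(\bar{\mathbf w}_{\mathscr T},\psi)+\mathcal K(\bar{\mathbf w}_{\mathscr T},\bar q_{\mathscr T},\bar{\mathbf y}_{\mathscr T}-\mathbf y_\Omega;\psi)=0$, $(\bar{\mathbf w}_{\mathscr T}+\vartheta\bar{\mathbf u}_{\mathscr T},\mathbf u-\bar{\mathbf u}_{\mathscr T})_\Omega\ge0$ for all $\boldsymbol\xi,\boldsymbol\zeta\in\mathbf V(\mathscr T)$, $\phi,\psi\in Q(\mathscr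 T)$, $\mathbf u\in\mathbf U_{ad}(\mathscr T)$. Auxiliary solutions: $(\hat{\mathbf y},\hat p)\in\mathbf V\times Q$ solves $\mathcal A(\hat{\mathbf y},\boldsymbol\xi)-\mathcal B(\boldsymbol\xi,\hat p)=(\mathbf f+\bar{\mathbf u}_{\mathscr T},\boldsymbol\xi)_\Omega$, $\mathcal B(\hat{\mathbf y},\phi)=0$ for all $(\boldsymbol\xi,\phi)\in\mathbf V\times Q$; $(\hat{\mathbf w},\hat q)\in\mathbf V\times Q$ solves $\mathcal C(\hat{\mathbf w},\boldsymbol\zeta)+\mathcal B(\boldsymbol\zeta,\hat q)=(\bar{\mathbf y}_{\mathscr T}-\mathbf y_\Omega,\boldsymbol\zeta)_\Omega$, $\mathcal B(\hat{\mathbf w},\psi)=0$ for all $(\boldsymbol\zeta,\psi)\in\mathbf V\times Q$. Control indicator: $\tilde{\mathbf u}=\Pi_{[\mathbf a,\mathbf b]}(-\frac1\vartheta\bar{\mathbf w}_{\mathscr T})$ with $\Pi_{[\mathbf a,\mathbf b]}(\boldsymbol\zeta)(x)=\min\{\mathbf b,\max\{\mathbf a,\boldsymbol\zeta(x)\}\}$ componentwise; $\eta_{\mathbf u,K}=\|\tilde{\mathbf u}-\bar{\mathbf u}_{\mathscr T}\|_{L^2(K)}$, $\eta_{\mathbf u}=(\sum_{K\in\mathscr T}\eta_{\mathbf u,K}^2)^{1/2}$. Errors: $\mathbf e_{\mathbf y}=\bar{\mathbf y}-\bar{\mathbf y}_{\mathscr T}$, $e_p=\bar p-\bar p_{\mathscr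 T}$, $\mathbf e_{\mathbf w}=\bar{\mathbf w}-\bar{\mathbf w}_{\mathscr T}$, $e_q=\bar q-\bar q_{\mathscr T}$, $\mathbf e_{\mathbf u}=\bar{\mathbf u}-\bar{\mathbf u}_{\mathscr T}$; $E_K^2=\|\mathbf e_{\mathbf y}\|_{\mathbf V,K}^2+\varrho\|e_p\|_{Q,K}^2+\|\mathbf e_{\mathbf w}\|_{\mathbf V,K}^2+\varrho\|e_q\|_{Q,K}^2+\|\mathbf e_{\mathbf u}\|_{L^2(K)}^2$ and $E_\Omega^2=\sum_{K\in\mathscr T}E_K^2$. *)

theory Defs
  imports "HOL-Analysis.Analysis" "HOL-Probability.Essential_Supremum"
begin

text \<open>
  Functions on a domain \<open>\<Omega>\<close> are total functions on \<open>real^'d\<close> of which only the values on \<open>\<Omega>\<close>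
  matter (up to null sets), so the Lebesgue and Sobolev spaces below are sets of representatives
  and ``zero'' always means ``zero almost everywhere''.
\<close>

type_synonym 'd scalar_field = "(real, 'd) vec \<Rightarrow> real"
type_synonym 'd vector_field = "(real, 'd) vec \<Rightarrow> (real, 'd) vec"


section \<open>Domains and meshes\<close>

definition lipschitz_boundary :: "(real ^ 'd) set \<Rightarrow> bool" where
  "lipschitz_boundary \<Omega> \<longleftrightarrow>
     (\<forall>x\<in>frontier \<Omega>. \<exists>U n L \<gamma>.
        open U \<and> x \<in> U \<and> norm n = 1 \<and> L-lipschitz_on {z. z \<bullet> n = 0} \<gamma> \<and>
        \<Omega> \<inter> U = {y \<in> U. y \<bullet> n < \<gamma> (y - (y \<bullet> n) *\<^sub>R n)})"

text \<open>The polytopes of the library are convex; a polytopal domain need not be.\<close>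

definition lipschitz_polytopal_domain :: "(real ^ 'd) set \<Rightarrow> bool" where
  "lipschitz_polytopal_domain \<Omega> \<longleftrightarrow>
     open \<Omega> \<and> connected \<Omega> \<and> \<Omega> \<noteq> {} \<and> bounded \<Omega> \<and>
     (\<exists>\<P>. finite \<P> \<and> (\<forall>P\<in>\<P>. polytope P) \<and> closure \<Omega> = \<Union>\<P>) \<and>
     lipschitz_boundary \<Omega>"

text \<open>
  Conformity (two elements meet in a common, possibly empty, face) is part of the library's
  notion of a triangulation, whose simplices may have any dimension.
\<close>

definition conforming_mesh :: "(real ^ 'd) set \<Rightarrow> (real ^ 'd) set set \<Rightarrow> bool" where
  "conforming_mesh \<Omega> \<T> \<longleftrightarrow>
     triangulation \<T> \<and> (\<forall>K\<in>\<T>. int CARD('d) simplex K) \<and> \<Union>\<T> = closure \<Omega>"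

definition shape_regular_family :: "(real ^ 'd) set \<Rightarrow> (real ^ 'd) set set set \<Rightarrow> bool" where
  "shape_regular_family \<Omega> \<TT> \<longleftrightarrow>
     (\<forall>\<T>\<in>\<TT>. conforming_mesh \<Omega> \<T>) \<and>
     (\<exists>\<sigma>>0. \<forall>\<T>\<in>\<TT>. \<forall>K\<in>\<T>. \<exists>x. cball x (\<sigma> * diameter K) \<subseteq> K)"


section \<open>Lebesgue spaces\<close>

definition L2_space :: "(real ^ 'd) set \<Rightarrow> (real ^ 'd \<Rightarrow> 'b::euclidean_space) set" where
  "L2_space \<Omega> =
     {u. u \<in> borel_measurable (lebesgue_on \<Omega>) \<and> integrable (lebesgue_on \<Omega>) (\<lambda>x. (norm (u x))\<^sup>2)}"

definition L2_inner ::
  "(real ^ 'd) set \<Rightarrow> (real ^ 'd \<Rightarrow> 'b::euclidean_space) \<Rightarrow> (real ^ 'd \<Rightarrow> 'b) \<Rightarrow> real" where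
  "L2_inner \<Omega> u v = (LINT x|lebesgue_on \<Omega>. u x \<bullet> v x)"

definition L2_norm :: "(real ^ 'd) set \<Rightarrow> (real ^ 'd \<Rightarrow> 'b::euclidean_space) \<Rightarrow> real" where
  "L2_norm \<Omega> u = sqrt (LINT x|lebesgue_on \<Omega>. (norm (u x))\<^sup>2)"

definition L2_zero_mean :: "(real ^ 'd) set \<Rightarrow> 'd scalar_field set" where
  "L2_zero_mean \<Omega> = {\<phi> \<in> L2_space \<Omega>. (LINT x|lebesgue_on \<Omega>. \<phi> x) = 0}"

text \<open>Essential supremum of the pointwise Euclidean (for matrices: Frobenius) norm.\<close>

definition Linf_norm :: "(real ^ 'd) set \<Rightarrow> (real ^ 'd \<Rightarrow> 'b::euclidean_space) \<Rightarrow> ereal" where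
  "Linf_norm \<Omega> u = esssup (lebesgue_on \<Omega>) (\<lambda>x. ereal (norm (u x)))"

definition Linf_space :: "(real ^ 'd) set \<Rightarrow> (real ^ 'd \<Rightarrow> 'b::euclidean_space) set" where
  "Linf_space \<Omega> = {u. u \<in> borel_measurable (lebesgue_on \<Omega>) \<and> Linf_norm \<Omega> u < \<infinity>}"


section \<open>Test functions, weak gradients and Sobolev spaces\<close>

definition partial_deriv :: "'d \<Rightarrow> 'd scalar_field \<Rightarrow> 'd::finite scalar_field" where
  "partial_deriv j \<phi> x = frechet_derivative \<phi> (at x) (axis j 1)"

fun Ck :: "nat \<Rightarrow> 'd::finite scalar_field \<Rightarrow> bool" where
  "Ck 0 \<phi> \<longleftrightarrow> continuous_on UNIV \<phi>"
| "Ck (Suc k) \<phi> \<longleftrightarrow> (\<forall>x. \<phi> differentiable (at x)) \<and> (\<forall>j. Ck k (partial_deriv j \<phi>))"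

definition test_functions :: "(real ^ 'd) set \<Rightarrow> 'd scalar_field set" where
  "test_functions \<Omega> =
     {\<phi>. (\<forall>k. Ck k \<phi>) \<and> compact (closure {x. \<phi> x \<noteq> 0}) \<and> closure {x. \<phi> x \<noteq> 0} \<subseteq> \<Omega>}"

definition locally_integrable :: "(real ^ 'd) set \<Rightarrow> (real ^ 'd \<Rightarrow> 'b::euclidean_space) \<Rightarrow> bool" where
  "locally_integrable \<Omega> u \<longleftrightarrow> (\<forall>K. compact K \<and> K \<subseteq> \<Omega> \<longrightarrow> u absolutely_integrable_on K)"

text \<open>
  The gradient is matrix valued, with entry \<open>(i, j)\<close> the weak derivative of the \<open>i\<close>-th component
  in direction \<open>j\<close>.  The inner product on matrices is the Frobenius one.
\<close>

definition has_weak_grad ::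
  "(real ^ 'd) set \<Rightarrow> 'd vector_field \<Rightarrow> (real ^ 'd \<Rightarrow> real ^ 'd ^ 'd) \<Rightarrow> bool" where
  "has_weak_grad \<Omega> u G \<longleftrightarrow>
     locally_integrable \<Omega> u \<and> locally_integrable \<Omega> G \<and>
     (\<forall>\<phi>\<in>test_functions \<Omega>. \<forall>i j.
        (LINT x|lebesgue_on \<Omega>. u x $ i * partial_deriv j \<phi> x) =
        - (LINT x|lebesgue_on \<Omega>. G x $ i $ j * \<phi> x))"

text \<open>Weak gradients are unique only up to null sets; \<open>wgrad\<close> picks one representative.\<close>

definition wgrad :: "(real ^ 'd) set \<Rightarrow> 'd vector_field \<Rightarrow> real ^ 'd \<Rightarrow> real ^ 'd ^ 'd" where
  "wgrad \<Omega> u = (SOME G. has_weak_grad \<Omega> u G)"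

definition wdiv :: "(real ^ 'd) set \<Rightarrow> 'd vector_field \<Rightarrow> real ^ 'd \<Rightarrow> real" where
  "wdiv \<Omega> u x = trace (wgrad \<Omega> u x)"

definition W1inf :: "(real ^ 'd) set \<Rightarrow> 'd vector_field set" where
  "W1inf \<Omega> = {u \<in> Linf_space \<Omega>. \<exists>G\<in>Linf_space \<Omega>. has_weak_grad \<Omega> u G}"

definition H1 :: "(real ^ 'd) set \<Rightarrow> 'd vector_field set" where
  "H1 \<Omega> = {u \<in> L2_space \<Omega>. \<exists>G\<in>L2_space \<Omega>. has_weak_grad \<Omega> u G}"

definition H1_norm :: "(real ^ 'd) set \<Rightarrow> 'd vector_field \<Rightarrow> real" where
  "H1_norm \<Omega> u = sqrt ((L2_norm \<Omega> u)\<^sup>2 + (L2_norm \<Omega> (wgrad \<Omega> u))\<^sup>2)"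

definition H10 :: "(real ^ 'd) set \<Rightarrow> 'd vector_field set" where
  "H10 \<Omega> = {u \<in> H1 \<Omega>. \<exists>\<Phi> :: nat \<Rightarrow> 'd vector_field.
       (\<forall>n i. (\<lambda>x. \<Phi> n x $ i) \<in> test_functions \<Omega>) \<and>
       (\<lambda>n. H1_norm \<Omega> (\<lambda>x. u x - \<Phi> n x)) \<longlonglongrightarrow> 0}"


section \<open>Elementwise norms\<close>

text \<open>\<open>\<nabla>\<xi>\<close> is the weak gradient on all of \<open>\<Omega>\<close>, restricted to the element \<open>K\<close>.\<close>

definition normV_elem ::
  "(real ^ 'd) set \<Rightarrow> real \<Rightarrow> real \<Rightarrow> (real ^ 'd) set \<Rightarrow> 'd vector_field \<Rightarrow> real" where
  "normV_elem \<Omega> \<epsilon> \<kappa> K \<xi> = sqrt (\<epsilon> * (L2_norm K (wgrad \<Omega> \<xi>))\<^sup>2 + \<kappa> * (L2_norm K \<xi>)\<^sup>2)"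

definition normV ::
  "(real ^ 'd) set \<Rightarrow> real \<Rightarrow> real \<Rightarrow> (real ^ 'd) set set \<Rightarrow> 'd vector_field \<Rightarrow> real" where
  "normV \<Omega> \<epsilon> \<kappa> \<T> \<xi> = sqrt (\<Sum>K\<in>\<T>. (normV_elem \<Omega> \<epsilon> \<kappa> K \<xi>)\<^sup>2)"

definition normQ :: "(real ^ 'd) set set \<Rightarrow> 'd scalar_field \<Rightarrow> real" where
  "normQ \<T> \<phi> = sqrt (\<Sum>K\<in>\<T>. (L2_norm K \<phi>)\<^sup>2)"


section \<open>Forms and optimality systems\<close>

definition formA ::
  "(real ^ 'd) set \<Rightarrow> real \<Rightarrow> real \<Rightarrow> 'd vector_field \<Rightarrow> 'd vector_field \<Rightarrow> 'd vector_field \<Rightarrow> real" where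
  "formA \<Omega> \<epsilon> \<kappa> c \<xi> \<zeta> =
     \<epsilon> * L2_inner \<Omega> (wgrad \<Omega> \<xi>) (wgrad \<Omega> \<zeta>) +
     L2_inner \<Omega> (\<lambda>x. \<kappa> *\<^sub>R \<xi> x + wgrad \<Omega> \<xi> x *v c x) \<zeta>"

definition formB :: "(real ^ 'd) set \<Rightarrow> 'd vector_field \<Rightarrow> 'd scalar_field \<Rightarrow> real" where
  "formB \<Omega> \<zeta> \<phi> = L2_inner \<Omega> \<phi> (wdiv \<Omega> \<zeta>)"

definition formC ::
  "(real ^ 'd) set \<Rightarrow> real \<Rightarrow> real \<Rightarrow> 'd vector_field \<Rightarrow> 'd vector_field \<Rightarrow> 'd vector_field \<Rightarrow> real" where
  "formC \<Omega> \<epsilon> \<kappa> c \<xi> \<zeta> =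
     \<epsilon> * L2_inner \<Omega> (wgrad \<Omega> \<xi>) (wgrad \<Omega> \<zeta>) +
     L2_inner \<Omega> (\<lambda>x. \<kappa> *\<^sub>R \<xi> x - wgrad \<Omega> \<xi> x *v c x) \<zeta>"

definition state_solution ::
  "(real ^ 'd) set \<Rightarrow> real \<Rightarrow> real \<Rightarrow> 'd vector_field \<Rightarrow> 'd vector_field \<Rightarrow>
   'd vector_field \<Rightarrow> 'd scalar_field \<Rightarrow> bool" where
  "state_solution \<Omega> \<epsilon> \<kappa> c g y p \<longleftrightarrow>
     y \<in> H10 \<Omega> \<and> p \<in> L2_zero_mean \<Omega> \<and>
     (\<forall>\<xi>\<in>H10 \<Omega>. formA \<Omega> \<epsilon> \<kappa> c y \<xi> - formB \<Omega> \<xi> p = L2_inner \<Omega> g \<xi>) \<and>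
     (\<forall>\<phi>\<in>L2_zero_mean \<Omega>. formB \<Omega> y \<phi> = 0)"

definition adjoint_solution ::
  "(real ^ 'd) set \<Rightarrow> real \<Rightarrow> real \<Rightarrow> 'd vector_field \<Rightarrow> 'd vector_field \<Rightarrow>
   'd vector_field \<Rightarrow> 'd scalar_field \<Rightarrow> bool" where
  "adjoint_solution \<Omega> \<epsilon> \<kappa> c g w q \<longleftrightarrow>
     w \<in> H10 \<Omega> \<and> q \<in> L2_zero_mean \<Omega> \<and>
     (\<forall>\<zeta>\<in>H10 \<Omega>. formC \<Omega> \<epsilon> \<kappa> c w \<zeta> + formB \<Omega> \<zeta> q = L2_inner \<Omega> g \<zeta>) \<and>
     (\<forall>\<psi>\<in>L2_zero_mean \<Omega>. formB \<Omega> w \<psi> = 0)"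

text \<open>The strict order on \<open>real^'d\<close> is not componentwise, hence the explicit indices.\<close>

definition admissible_controls ::
  "(real ^ 'd) set \<Rightarrow> real ^ 'd \<Rightarrow> real ^ 'd \<Rightarrow> 'd vector_field set" where
  "admissible_controls \<Omega> a b =
     {v \<in> L2_space \<Omega>. AE x in lebesgue_on \<Omega>. \<forall>i. a $ i \<le> v x $ i \<and> v x $ i \<le> b $ i}"

definition optimality_system ::
  "(real ^ 'd) set \<Rightarrow> real \<Rightarrow> real \<Rightarrow> real \<Rightarrow> 'd vector_field \<Rightarrow> real ^ 'd \<Rightarrow> real ^ 'd \<Rightarrow>
   'd vector_field \<Rightarrow> 'd vector_field \<Rightarrow>
   'd vector_field \<Rightarrow> 'd scalar_field \<Rightarrow> 'd vector_field \<Rightarrow> 'd scalar_field \<Rightarrow> 'd vector_field \<Rightarrow> bool" where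
  "optimality_system \<Omega> \<epsilon> \<kappa> \<theta> c a b f y\<^sub>\<Omega> y p w q u \<longleftrightarrow>
     state_solution \<Omega> \<epsilon> \<kappa> c (\<lambda>x. f x + u x) y p \<and>
     adjoint_solution \<Omega> \<epsilon> \<kappa> c (\<lambda>x. y x - y\<^sub>\<Omega> x) w q \<and>
     u \<in> admissible_controls \<Omega> a b \<and>
     (\<forall>v\<in>admissible_controls \<Omega> a b.
        L2_inner \<Omega> (\<lambda>x. w x + \<theta> *\<^sub>R u x) (\<lambda>x. v x - u x) \<ge> 0)"

definition function_subspace :: "('a \<Rightarrow> 'b::real_vector) set \<Rightarrow> bool" where
  "function_subspace S \<longleftrightarrow>
     (\<lambda>x. 0) \<in> S \<and> (\<forall>u\<in>S. \<forall>v\<in>S. (\<lambda>x. u x + v x) \<in> S) \<and>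
     (\<forall>r. \<forall>u\<in>S. (\<lambda>x. r *\<^sub>R u x) \<in> S)"

text \<open>
  \<open>VT\<close>, \<open>QT\<close>, \<open>UT\<close> are the discrete velocity, pressure and control sets and \<open>\<S>\<close>, \<open>\<H>\<close>, \<open>\<Q>\<close>, \<open>\<K>\<close>
  the stabilization terms, about which nothing is assumed.
\<close>

definition discrete_optimality_system ::
  "(real ^ 'd) set \<Rightarrow> real \<Rightarrow> real \<Rightarrow> real \<Rightarrow> 'd vector_field \<Rightarrow>
   'd vector_field set \<Rightarrow> 'd scalar_field set \<Rightarrow> 'd vector_field set \<Rightarrow>
   ('d vector_field \<Rightarrow> 'd scalar_field \<Rightarrow> 'd vector_field \<Rightarrow> 'd vector_field \<Rightarrow> real) \<Rightarrow>
   ('d vector_field \<Rightarrow> 'd scalar_field \<Rightarrow> 'd vector_field \<Rightarrow> 'd scalar_field \<Rightarrow> real) \<Rightarrow>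
   ('d vector_field \<Rightarrow> 'd scalar_field \<Rightarrow> 'd vector_field \<Rightarrow> 'd vector_field \<Rightarrow> real) \<Rightarrow>
   ('d vector_field \<Rightarrow> 'd scalar_field \<Rightarrow> 'd vector_field \<Rightarrow> 'd scalar_field \<Rightarrow> real) \<Rightarrow>
   'd vector_field \<Rightarrow> 'd vector_field \<Rightarrow>
   'd vector_field \<Rightarrow> 'd scalar_field \<Rightarrow> 'd vector_field \<Rightarrow> 'd scalar_field \<Rightarrow> 'd vector_field \<Rightarrow> bool" where
  "discrete_optimality_system \<Omega> \<epsilon> \<kappa> \<theta> c VT QT UT \<S> \<H> \<Q> \<K> f y\<^sub>\<Omega> y p w q u \<longleftrightarrow>
     y \<in> VT \<and> p \<in> QT \<and> w \<in> VT \<and> q \<in> QT \<and> u \<in> UT \<and>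
     (\<forall>\<xi>\<in>VT. formA \<Omega> \<epsilon> \<kappa> c y \<xi> - formB \<Omega> \<xi> p + \<S> y p (\<lambda>x. f x + u x) \<xi>
               = L2_inner \<Omega> (\<lambda>x. f x + u x) \<xi>) \<and>
     (\<forall>\<phi>\<in>QT. formB \<Omega> y \<phi> + \<H> y p (\<lambda>x. f x + u x) \<phi> = 0) \<and>
     (\<forall>\<zeta>\<in>VT. formC \<Omega> \<epsilon> \<kappa> c w \<zeta> + formB \<Omega> \<zeta> q + \<Q> w q (\<lambda>x. y x - y\<^sub>\<Omega> x) \<zeta>
               = L2_inner \<Omega> (\<lambda>x. y x - y\<^sub>\<Omega> x) \<zeta>) \<and>
     (\<forall>\<psi>\<in>QT. formB \<Omega> w \<psi> + \<K> w q (\<lambda>x. y x - y\<^sub>\<Omega> x) \<psi> = 0) \<and>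
     (\<forall>v\<in>UT. L2_inner \<Omega> (\<lambda>x. w x + \<theta> *\<^sub>R u x) (\<lambda>x. v x - u x) \<ge> 0)"


section \<open>Constants\<close>

text \<open>
  A box with side lengths \<open>l\<close> is any congruent copy (not necessarily axis-parallel) of the product
  of the intervals \<open>[0, l $ i]\<close>.
\<close>

definition in_box_with_sides :: "(real ^ 'd) set \<Rightarrow> real ^ 'd \<Rightarrow> bool" where
  "in_box_with_sides \<Omega> l \<longleftrightarrow>
     (\<forall>i. l $ i > 0) \<and>
     (\<exists>x\<^sub>0 R. orthogonal_transformation R \<and> \<Omega> \<subseteq> (\<lambda>x. x\<^sub>0 + R x) ` cbox 0 l)"

definition poincare_const :: "real ^ 'd \<Rightarrow> real" where
  "poincare_const l = 1 / pi * (\<Sum>i\<in>UNIV. 1 / \<bar>l $ i\<bar>\<^sup>2) powr (- 1 / 2)"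

definition energy_const :: "real \<Rightarrow> real \<Rightarrow> real \<Rightarrow> real" where
  "energy_const \<epsilon> \<kappa> C\<^sub>P =
     (if \<kappa> = 0 then C\<^sub>P / sqrt \<epsilon> else min (C\<^sub>P / sqrt \<epsilon>) (1 / sqrt \<kappa>))"

definition continuity_const :: "(real ^ 'd) set \<Rightarrow> real \<Rightarrow> 'd vector_field \<Rightarrow> real \<Rightarrow> real" where
  "continuity_const \<Omega> \<epsilon> c C\<^sub>\<Omega> = 1 + C\<^sub>\<Omega> / sqrt \<epsilon> * real_of_ereal (Linf_norm \<Omega> c)"

text \<open>The supremum is taken in the extended reals, so that no boundedness is presupposed.\<close>

definition inf_sup_condition :: "(real ^ 'd) set \<Rightarrow> real \<Rightarrow> bool" where
  "inf_sup_condition \<Omega> \<beta> \<longleftrightarrow>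
     (\<forall>\<phi>\<in>L2_zero_mean \<Omega>. ereal (\<beta> * L2_norm \<Omega> \<phi>) \<le>
        (SUP \<xi>\<in>{\<xi> \<in> H10 \<Omega>. \<not> (AE x in lebesgue_on \<Omega>. \<xi> x = 0)}.
           ereal (formB \<Omega> \<xi> \<phi> / L2_norm \<Omega> (wgrad \<Omega> \<xi>))))"

definition inf_sup_const :: "real \<Rightarrow> real \<Rightarrow> real \<Rightarrow> real \<Rightarrow> real" where
  "inf_sup_const \<epsilon> \<kappa> C\<^sub>P \<beta> = sqrt (\<epsilon> + \<kappa> * C\<^sub>P\<^sup>2) / \<beta>"


section \<open>Control indicator and total error\<close>

definition box_projection :: "real ^ 'd \<Rightarrow> real ^ 'd \<Rightarrow> 'd vector_field \<Rightarrow> 'd vector_field" where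
  "box_projection a b \<zeta> x = (\<chi> i. min (b $ i) (max (a $ i) (\<zeta> x $ i)))"

definition control_indicator_elem ::
  "real \<Rightarrow> real ^ 'd \<Rightarrow> real ^ 'd \<Rightarrow> 'd vector_field \<Rightarrow> 'd vector_field \<Rightarrow> (real ^ 'd) set \<Rightarrow> real" where
  "control_indicator_elem \<theta> a b w\<^sub>T u\<^sub>T K =
     L2_norm K (\<lambda>x. box_projection a b (\<lambda>x. (- 1 / \<theta>) *\<^sub>R w\<^sub>T x) x - u\<^sub>T x)"

definition control_indicator ::
  "real \<Rightarrow> real ^ 'd \<Rightarrow> real ^ 'd \<Rightarrow> 'd vector_field \<Rightarrow> 'd vector_field \<Rightarrow> (real ^ 'd) set set \<Rightarrow> real" where
  "control_indicator \<theta> a b w\<^sub>T u\<^sub>T \<T> = sqrt (\<Sum>K\<in>\<T>. (control_indicator_elem \<theta> a b w\<^sub>T u\<^sub>T K)\<^sup>2)"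

text \<open>The last five arguments are the errors in \<open>y\<close>, \<open>p\<close>, \<open>w\<close>, \<open>q\<close> and \<open>u\<close>.\<close>

definition local_error ::
  "(real ^ 'd) set \<Rightarrow> real \<Rightarrow> real \<Rightarrow> real \<Rightarrow> (real ^ 'd) set \<Rightarrow>
   'd vector_field \<Rightarrow> 'd scalar_field \<Rightarrow> 'd vector_field \<Rightarrow> 'd scalar_field \<Rightarrow> 'd vector_field \<Rightarrow> real" where
  "local_error \<Omega> \<epsilon> \<kappa> \<rho> K e\<^sub>y e\<^sub>p e\<^sub>w e\<^sub>q e\<^sub>u = sqrt
     ((normV_elem \<Omega> \<epsilon> \<kappa> K e\<^sub>y)\<^sup>2 + \<rho> * (L2_norm K e\<^sub>p)\<^sup>2 +
      (normV_elem \<Omega> \<epsilon> \<kappa> K e\<^sub>w)\<^sup>2 + \<rho> * (L2_norm K e\<^sub>q)\<^sup>2 + (L2_norm K e\<^sub>u)\<^sup>2)"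

definition total_error ::
  "(real ^ 'd) set \<Rightarrow> real \<Rightarrow> real \<Rightarrow> real \<Rightarrow> (real ^ 'd) set set \<Rightarrow>
   'd vector_field \<Rightarrow> 'd scalar_field \<Rightarrow> 'd vector_field \<Rightarrow> 'd scalar_field \<Rightarrow> 'd vector_field \<Rightarrow> real" where
  "total_error \<Omega> \<epsilon> \<kappa> \<rho> \<T> e\<^sub>y e\<^sub>p e\<^sub>w e\<^sub>q e\<^sub>u =
     sqrt (\<Sum>K\<in>\<T>. (local_error \<Omega> \<epsilon> \<kappa> \<rho> K e\<^sub>y e\<^sub>p e\<^sub>w e\<^sub>q e\<^sub>u)\<^sup>2)"

end

theory Submission
  imports Defs
begin

text \<open>
  Let \<open>D\<close> be the difference of the optimal control and the projected control \<open>box_projection a b (- wT / \<theta>)\<close>.  The two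
  variational inequalities bound \<open>\<theta> \<parallel>D\<parallel>\<^sup>2\<close> by the pairing of \<open>D\<close> with the adjoint error, which splits
  into the given indicator and the response of the adjoint equation to the state error.  By duality
  the part of that response caused by \<open>D\<close> itself is a square with the good sign, so only the
  contributions of \<open>\<eta>\<^sub>u\<close> and \<open>\<eta>\<^sub>y\<close> remain.  All other errors follow from the energy estimate and the
  inf-sup condition.

  The analysis underneath consists of the Friedrichs inequality on a box with its sharp constant and
  the skew symmetry of the advection form.  Both are proved for test fields and extended to \<open>H10\<close> by
  density, which requires that weak gradients are unique up to null sets.
\<close>

section \<open>Smooth functions\<close>

text \<open>The discrete control satisfies its inequality only against discrete controls, so in
  general it cannot be tested with the optimal one. The projected control can: it satisfies the
  inequality with the discrete adjoint \<open>wT\<close> pointwise against all admissible controls,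
  and its distance to the discrete control is the indicator. The price is that no state belonging to
  the projected control is given; only the part of it that the duality argument tests is
  constructed, in a space of dimension at most two. Powers of the energy constant count passages:
  one factor from L2 data to an energy norm, one more from an energy norm back to L2. Dividing by
  theta and splitting the control error twice with (s + t)^2 <= 2 s^2 + 2 t^2 produces mu = 4 /
  theta^2. The weight 1 + rho * omega appears because velocity and pressure respond to the same
  data, the pressure with an additional factor whose square is omega.\<close>

lemma partial_deriv_eq:
  "(\<phi> has_derivative D) (at x) \<Longrightarrow> partial_deriv j \<phi> x = D (axis j 1)"
  by (metis frechet_derivative_at partial_deriv_def)

lemma Ck_continuous: "Ck k \<phi> \<Longrightarrow> continuous_on UNIV \<phi>"
  for \<phi> :: "real ^ 'd::finite \<Rightarrow> real"
  by (cases k) (auto simp: continuous_at_imp_continuous_on differentiable_imp_continuous_within)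

text \<open>The definition speaks of continuity only at order zero, so lowering the order reaches
  down through all partial derivatives to the implication from differentiability to
  continuity.\<close>

lemma Ck_Suc_imp: "Ck (Suc k) \<phi> \<Longrightarrow> Ck k \<phi>"
proof (induction k arbitrary: \<phi>)
  case 0
  then show ?case using Ck_continuous[of "Suc 0" \<phi>] by simp
next
  case (Suc k)
  then have "Ck (Suc k) (partial_deriv j \<phi>)" for j
    using Ck.simps(2)[of "Suc k" \<phi>] by blast
  then have "Ck k (partial_deriv j \<phi>)" for j
    using Suc.IH by blast
  with Suc.prems show ?case by simp
qed

lemma Ck_const: "Ck k (\<lambda>x. c)"
proof (induction k arbitrary: c)
  case (Suc k)
  have "partial_deriv j (\<lambda>x. c) = (\<lambda>x. 0)" for j :: 'a
    by (rule ext, subst partial_deriv_eq[of _ "\<lambda>_. 0"]) auto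
  with Suc show ?case by simp
qed simp

lemma Ck_component: "Ck k (\<lambda>x. x $ i)"
proof (cases k)
  case (Suc m)
  have D: "((\<lambda>x. x $ i) has_derivative (\<lambda>h. h $ i)) (at x)" for x :: "real ^ 'a"
    by (rule bounded_linear_imp_has_derivative) (rule bounded_linear_vec_nth)
  then have "partial_deriv j (\<lambda>x. x $ i) = (\<lambda>x. axis j 1 $ i)" and "(\<lambda>x::real^'a. x $ i) differentiable at x"
    for j x using D by (auto simp: partial_deriv_eq[OF D] fun_eq_iff differentiable_def)
  then show ?thesis by (simp add: Suc Ck_const)
qed (simp add: continuous_on_component continuous_on_id)

lemma partial_deriv_add:
  assumes "\<phi> differentiable at x" "\<psi> differentiable at x"
  shows "partial_deriv j (\<lambda>x. \<phi> x + \<psi> x) x = partial_deriv j \<phi> x + partial_deriv j \<psi> x"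
proof -
  have "((\<lambda>x. \<phi> x + \<psi> x) has_derivative
      (\<lambda>h. frechet_derivative \<phi> (at x) h + frechet_derivative \<psi> (at x) h)) (at x)"
    using assms by (auto intro!: has_derivative_add simp flip: frechet_derivative_works)
  then show ?thesis
    by (subst partial_deriv_eq) (auto simp: partial_deriv_def)
qed

lemma Ck_add: "Ck k \<phi> \<Longrightarrow> Ck k \<psi> \<Longrightarrow> Ck k (\<lambda>x. \<phi> x + \<psi> x)"
proof (induction k arbitrary: \<phi> \<psi>)
  case (Suc k)
  have "partial_deriv j (\<lambda>x. \<phi> x + \<psi> x) = (\<lambda>x. partial_deriv j \<phi> x + partial_deriv j \<psi> x)" for j
    using Suc.prems by (auto simp: partial_deriv_add)
  with Suc show ?case by simp
qed (simp add: continuous_on_add)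

lemma partial_deriv_mult:
  assumes "\<phi> differentiable at x" "\<psi> differentiable at x"
  shows "partial_deriv j (\<lambda>x. \<phi> x * \<psi> x) x = \<phi> x * partial_deriv j \<psi> x + partial_deriv j \<phi> x * \<psi> x"
proof -
  have "((\<lambda>x. \<phi> x * \<psi> x) has_derivative
      (\<lambda>h. \<phi> x * frechet_derivative \<psi> (at x) h + frechet_derivative \<phi> (at x) h * \<psi> x)) (at x)"
    using assms by (auto intro!: has_derivative_mult simp flip: frechet_derivative_works)
  then show ?thesis
    by (subst partial_deriv_eq) (auto simp: partial_deriv_def)
qed

lemma Ck_mult: "Ck k \<phi> \<Longrightarrow> Ck k \<psi> \<Longrightarrow> Ck k (\<lambda>x. \<phi> x * \<psi> x)"
proof (induction k arbitrary: \<phi> \<psi>)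
  case (Suc k)
  have "partial_deriv j (\<lambda>x. \<phi> x * \<psi> x)
      = (\<lambda>x. \<phi> x * partial_deriv j \<psi> x + partial_deriv j \<phi> x * \<psi> x)" for j
    using Suc.prems by (auto simp: partial_deriv_mult)
  \<comment> \<open>The product rule leaves one factor undifferentiated in each summand, so that
    factor enters with its order lowered.\<close>
  moreover have "Ck k \<phi>" "Ck k \<psi>"
    using Suc.prems Ck_Suc_imp by blast+
  ultimately show ?case
    using Suc by (auto intro!: Ck_add differentiable_mult)
qed (simp add: continuous_on_mult)

lemma Ck_prod: "(\<And>i. i \<in> I \<Longrightarrow> Ck k (f i)) \<Longrightarrow> Ck k (\<lambda>x. \<Prod>i\<in>I. f i x)"
  by (induction I rule: infinite_finite_induct) (auto simp: Ck_const Ck_mult)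

text \<open>Smoothness of the outer function is encoded by the sequence \<open>F\<close> of its
  successive derivatives. A partial derivative of the composition contains \<open>F (Suc n)\<close>,
  so the induction has to leave \<open>n\<close> free.\<close>

lemma Ck_compose:
  fixes F :: "nat \<Rightarrow> real \<Rightarrow> real"
  assumes F: "\<And>n t. (F n has_real_derivative F (Suc n) t) (at t)" and "Ck k \<phi>"
  shows "Ck k (\<lambda>x. F n (\<phi> x))"
  using \<open>Ck k \<phi>\<close>
proof (induction k arbitrary: \<phi> n)
  case 0
  have "continuous_on UNIV (F n)"
    using F by (meson DERIV_isCont continuous_at_imp_continuous_on)
  with 0 show ?case by (auto intro: continuous_on_compose2)
next
  case (Suc k)
  have D: "((\<lambda>x. F n (\<phi> x)) has_derivative
      (\<lambda>h. F (Suc n) (\<phi> x) * frechet_derivative \<phi> (at x) h)) (at x)" for x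
  proof -
    have "(F n has_derivative (*) (F (Suc n) (\<phi> x))) (at (\<phi> x))"
      using F by (simp add: has_field_derivative_def)
    moreover have "(\<phi> has_derivative frechet_derivative \<phi> (at x)) (at x)"
      using Suc.prems by (simp flip: frechet_derivative_works)
    ultimately show ?thesis
      using has_derivative_compose[of \<phi> _ x UNIV "F n"] by blast
  qed
  then have "partial_deriv j (\<lambda>x. F n (\<phi> x)) = (\<lambda>x. F (Suc n) (\<phi> x) * partial_deriv j \<phi> x)" for j
    by (auto simp: partial_deriv_eq[OF D] partial_deriv_def)
  moreover have "Ck k (\<lambda>x. F (Suc n) (\<phi> x))"
    using Suc Ck_Suc_imp by blast
  ultimately show ?case
    using Suc.prems D by (auto intro!: Ck_mult simp: differentiable_def)
qed

lemma Ck_exp: "Ck k \<phi> \<Longrightarrow> Ck k (\<lambda>x. exp (\<phi> x))"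
  using Ck_compose[of "\<lambda>_. exp"] DERIV_exp by blast

lemma Ck_minus: "Ck k \<phi> \<Longrightarrow> Ck k (\<lambda>x. - \<phi> x)"
  using Ck_mult[OF Ck_const[of k "-1"]] by force

lemma Ck_diff: "Ck k \<phi> \<Longrightarrow> Ck k \<psi> \<Longrightarrow> Ck k (\<lambda>x. \<phi> x - \<psi> x)"
  using Ck_add[OF _ Ck_minus] by force

text \<open>\<open>flat 1\<close> is the classical exp(-1/t), extended by zero. The polynomial in
  1/t is carried along to obtain a family closed under differentiation.\<close>

definition flat :: "real poly \<Rightarrow> real \<Rightarrow> real" where
  "flat P t = (if t > 0 then poly P (1 / t) * exp (- (1 / t)) else 0)"

lemma poly_times_exp_tendsto_0: "((\<lambda>s. poly P s * exp (- s)) \<longlongrightarrow> (0::real)) at_top"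
proof -
  have "((\<lambda>s. \<Sum>i\<le>degree P. coeff P i * (s ^ i / exp s)) \<longlongrightarrow> (\<Sum>i\<le>degree P. coeff P i * 0)) at_top"
    by (intro tendsto_intros tendsto_power_div_exp_0)
  then show ?thesis
    by (simp add: poly_altdef sum_distrib_right exp_minus divide_inverse mult.assoc)
qed

text \<open>In the variable s = 1/t the derivative d/dt acts as -s^2 d/ds, which sends P(s) exp(-s)
  to s^2 (P - P')(s) exp(-s); \<open>[:0, 0, 1:]\<close> is s^2. Only the origin needs a
  limit.\<close>

lemma DERIV_flat: "(flat P has_real_derivative flat ([:0, 0, 1:] * (P - pderiv P)) t) (at t)"
proof (cases "t = 0")
  case False
  show ?thesis
  proof (cases "t > 0")
    case True
    have "((\<lambda>t. poly P (1 / t) * exp (- (1 / t))) has_real_derivative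
        flat ([:0, 0, 1:] * (P - pderiv P)) t) (at t)"
    proof -
      have D: "((\<lambda>t. 1 / t) has_real_derivative - (1 / t\<^sup>2)) (at t)"
        using True by (auto intro!: derivative_eq_intros simp: power2_eq_square)
      have "((\<lambda>t. poly P (1 / t) * exp (- (1 / t))) has_real_derivative
          poly (pderiv P) (1 / t) * (- (1 / t\<^sup>2)) * exp (- (1 / t))
          + exp (- (1 / t)) * (- (- (1 / t\<^sup>2))) * poly P (1 / t)) (at t)"
        by (intro DERIV_mult DERIV_chain2[OF poly_DERIV D] DERIV_chain2[OF DERIV_exp DERIV_minus[OF D]])
      then show ?thesis
        using True by (simp add: flat_def algebra_simps power2_eq_square)
    qed
    moreover have "eventually (\<lambda>s. s > 0) (nhds t)"
      using True eventually_nhds_in_open[of "{0<..}" t] by auto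
    ultimately show ?thesis
      by (subst DERIV_cong_ev[OF refl _ refl]) (auto simp: flat_def elim: eventually_mono)
  next
    case neg: False
    then have "eventually (\<lambda>s. s < 0) (nhds t)"
      using False eventually_nhds_in_open[of "{..<0}" t] by auto
    then have "eventually (\<lambda>s. flat P s = 0) (nhds t)"
      by eventually_elim (auto simp: flat_def)
    then have "(flat P has_real_derivative 0) (at t)"
      by (subst DERIV_cong_ev[OF refl _ refl]) auto
    then show ?thesis using neg by (simp add: flat_def)
  qed
next
  case True
  have "((\<lambda>h. flat P h / h) \<longlongrightarrow> 0) (at_right 0)"
  proof -
    \<comment> \<open>Division by \<open>h\<close> multiplies the polynomial by its variable, so the
      difference quotient is again a polynomial in 1/h times a decaying exponential.\<close>
    have "((\<lambda>h. poly ([:0, 1:] * P) (1 / h) * exp (- (1 / h))) \<longlongrightarrow> 0) (at_right 0)"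
      using filterlim_compose[OF poly_times_exp_tendsto_0[of "[:0, 1:] * P"] filterlim_inverse_at_top_right]
      by (simp add: inverse_eq_divide)
    moreover have "eventually (\<lambda>h. h > 0) (at_right (0::real))"
      by (simp add: eventually_at_right_less)
    then have "eventually (\<lambda>h. poly ([:0, 1:] * P) (1 / h) * exp (- (1 / h)) = flat P h / h) (at_right 0)"
      by eventually_elim (simp add: flat_def)
    ultimately show ?thesis
      by (rule Lim_transform_eventually)
  qed
  moreover have "((\<lambda>h. flat P h / h) \<longlongrightarrow> 0) (at_left 0)"
  proof -
    have "eventually (\<lambda>h. h < 0) (at_left (0::real))"
      unfolding eventually_at_left_field by (auto intro: exI[of _ "-1"])
    then have "eventually (\<lambda>h. flat P h / h = 0) (at_left 0)"
      by eventually_elim (simp add: flat_def)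
    then show ?thesis by (simp add: tendsto_eventually)
  qed
  ultimately have "((\<lambda>h. flat P h / h) \<longlongrightarrow> 0) (at 0)"
    by (simp add: filterlim_at_split)
  then show ?thesis
    using True by (simp add: DERIV_def flat_def)
qed

lemma Ck_flat: "Ck k \<phi> \<Longrightarrow> Ck k (\<lambda>x. flat P (\<phi> x))"
  using Ck_compose[of "\<lambda>n. flat (((\<lambda>P. [:0, 0, 1:] * (P - pderiv P)) ^^ n) P)" k \<phi> 0] DERIV_flat
  by simp

text \<open>For any \<open>g \<ge> 0\<close>, the functions \<open>1 - exp (- n g)\<close> increase to the indicator of \<open>{g > 0}\<close>.\<close>

definition bump :: "real ^ 'd \<Rightarrow> real ^ 'd \<Rightarrow> nat \<Rightarrow> 'd::finite scalar_field" where
  "bump a b n x = 1 - exp (- real n * (\<Prod>i\<in>UNIV. flat 1 (x $ i - a $ i) * flat 1 (b $ i - x $ i)))"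

lemma flat_1_nonneg: "flat 1 t \<ge> 0" and flat_1_pos: "flat 1 t > 0 \<longleftrightarrow> t > 0"
  by (auto simp: flat_def)

lemma Ck_bump: "Ck k (bump a b n)"
  unfolding bump_def[abs_def]
  by (intro Ck_diff Ck_const Ck_exp Ck_mult Ck_prod Ck_flat Ck_component)

lemma bump_outside: "x \<notin> box a b \<Longrightarrow> bump a b n x = 0"
proof -
  assume "x \<notin> box a b"
  then obtain i where "\<not> (a $ i < x $ i \<and> x $ i < b $ i)" by (auto simp: mem_box_cart)
  then have "flat 1 (x $ i - a $ i) * flat 1 (b $ i - x $ i) = 0"
    by (auto simp: flat_def)
  then have "(\<Prod>i\<in>UNIV. flat 1 (x $ i - a $ i) * flat 1 (b $ i - x $ i)) = 0"
    by (intro prod_zero finite bexI[of _ i] UNIV_I)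
  then show ?thesis by (simp add: bump_def)
qed

lemma bump_bounds: "0 \<le> bump a b n x" "bump a b n x \<le> 1"
  by (auto simp: bump_def flat_1_nonneg prod_nonneg)

lemma bump_tendsto: "(\<lambda>n. bump a b n x) \<longlonglongrightarrow> indicator (box a b) x"
proof (cases "x \<in> box a b")
  case True
  define g where "g = (\<Prod>i\<in>UNIV. flat 1 (x $ i - a $ i) * flat 1 (b $ i - x $ i))"
  have "g > 0"
    unfolding g_def using True by (auto intro!: prod_pos simp: flat_1_pos mem_box_cart)
  have "(\<lambda>n. 1 - exp (- g) ^ n) \<longlonglongrightarrow> 1 - 0"
    using \<open>g > 0\<close> by (intro tendsto_intros LIMSEQ_power_zero) auto
  moreover have "exp (- g) ^ n = exp (- real n * g)" for n
    by (simp flip: exp_of_nat_mult)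
  ultimately show ?thesis
    using True by (simp add: bump_def flip: g_def)
qed (simp add: bump_outside)

lemma bump_test_function:
  assumes "cbox a b \<subseteq> \<Omega>"
  shows "bump a b n \<in> test_functions \<Omega>"
proof -
  have "closure {x. bump a b n x \<noteq> 0} \<subseteq> cbox a b"
    using bump_outside[of _ a b n] box_subset_cbox[of a b] by (intro closure_minimal) auto
  with assms show ?thesis
    unfolding test_functions_def
    by (auto simp: Ck_bump compact_eq_bounded_closed intro: bounded_subset[OF bounded_cbox])
qed

section \<open>The space of square integrable functions\<close>

text \<open>Completeness of Lebesgue measure: whatever \<open>g\<close> does on the exceptional null
  set, the preimages there are subsets of a null set and hence measurable.\<close>

lemma borel_measurable_lebesgue_on_cong_AE:
  fixes f g :: "'a::euclidean_space \<Rightarrow> 'b::topological_space"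
  assumes S: "S \<in> sets lebesgue" and f: "f \<in> borel_measurable (lebesgue_on S)"
    and ae: "AE x in lebesgue_on S. f x = g x"
  shows "g \<in> borel_measurable (lebesgue_on S)"
proof (rule measurableI)
  from ae obtain N where N: "N \<in> null_sets (lebesgue_on S)" "{x \<in> S. f x \<noteq> g x} \<subseteq> N"
    by (auto elim!: AE_E simp: null_sets_def)
  then have N0: "N \<in> null_sets lebesgue"
    using S by (simp add: null_sets_restrict_space)
  fix A :: "'b set" assume "A \<in> sets borel"
  then have "f -` A \<inter> S \<in> sets (lebesgue_on S)"
    using measurable_sets[OF f] by simp
  then have "f -` A \<inter> S - N \<in> sets lebesgue"
    using N0 S by (auto simp: sets_restrict_space_iff)
  moreover have "g -` A \<inter> S \<inter> N \<in> sets lebesgue"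
    using N0 null_sets_completion_subset[of _ N lborel] by blast
  moreover have "g -` A \<inter> S = (f -` A \<inter> S - N) \<union> (g -` A \<inter> S \<inter> N)"
    using N(2) by auto
  ultimately have "g -` A \<inter> S \<in> sets lebesgue"
    by (metis sets.Un)
  then show "g -` A \<inter> space (lebesgue_on S) \<in> sets (lebesgue_on S)"
    using S by (simp add: sets_restrict_space_iff)
qed simp

lemma L2_measurable: "u \<in> L2_space S \<Longrightarrow> u \<in> borel_measurable (lebesgue_on S)"
  and L2_integrable: "u \<in> L2_space S \<Longrightarrow> integrable (lebesgue_on S) (\<lambda>x. (norm (u x))\<^sup>2)"
  by (auto simp: L2_space_def)

lemma L2_integrable_inner:
  assumes "u \<in> L2_space S" "v \<in> L2_space S"
  shows "integrable (lebesgue_on S) (\<lambda>x. u x \<bullet> v x)"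
proof (rule Bochner_Integration.integrable_bound)
  show "integrable (lebesgue_on S) (\<lambda>x. (norm (u x))\<^sup>2 + (norm (v x))\<^sup>2)"
    using assms by (intro Bochner_Integration.integrable_add L2_integrable)
  show "(\<lambda>x. u x \<bullet> v x) \<in> borel_measurable (lebesgue_on S)"
    using assms by (intro borel_measurable_inner L2_measurable)
  have "\<bar>u x \<bullet> v x\<bar> \<le> (norm (u x))\<^sup>2 + (norm (v x))\<^sup>2" for x
    using Cauchy_Schwarz_ineq2[of "u x" "v x"] sum_squares_bound[of "norm (u x)" "norm (v x)"]
      mult_nonneg_nonneg[of "norm (u x)" "norm (v x)"] by simp
  then show "AE x in lebesgue_on S. norm (u x \<bullet> v x) \<le> norm ((norm (u x))\<^sup>2 + (norm (v x))\<^sup>2)"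
    by (auto intro!: AE_I2 order.trans[OF _ abs_ge_self])
qed

lemma L2_space_iff_inner:
  "u \<in> L2_space S \<longleftrightarrow> u \<in> borel_measurable (lebesgue_on S) \<and> integrable (lebesgue_on S) (\<lambda>x. u x \<bullet> u x)"
  by (simp add: L2_space_def power2_norm_eq_inner)

lemma L2_add:
  assumes "u \<in> L2_space S" "v \<in> L2_space S"
  shows "(\<lambda>x. u x + v x) \<in> L2_space S"
proof -
  have "integrable (lebesgue_on S) (\<lambda>x. (u x \<bullet> u x + u x \<bullet> v x) + (v x \<bullet> u x + v x \<bullet> v x))"
    by (intro Bochner_Integration.integrable_add L2_integrable_inner assms)
  moreover have "(u x + v x) \<bullet> (u x + v x) = (u x \<bullet> u x + u x \<bullet> v x) + (v x \<bullet> u x + v x \<bullet> v x)" for x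
    by (simp add: inner_add_left inner_add_right)
  ultimately show ?thesis
    using assms unfolding L2_space_iff_inner[of "\<lambda>x. u x + v x"]
    by (simp add: L2_measurable borel_measurable_add)
qed

lemma L2_scaleR:
  assumes "u \<in> L2_space S"
  shows "(\<lambda>x. r *\<^sub>R u x) \<in> L2_space S"
  using assms L2_integrable_inner[OF assms assms] unfolding L2_space_iff_inner[of "\<lambda>x. r *\<^sub>R u x"]
  by (simp add: L2_measurable borel_measurable_scaleR)

lemma L2_diff: "u \<in> L2_space S \<Longrightarrow> v \<in> L2_space S \<Longrightarrow> (\<lambda>x. u x - v x) \<in> L2_space S"
  using L2_add[OF _ L2_scaleR[of v S "-1"], of u] by simp

lemma L2_inner_commute: "L2_inner S u v = L2_inner S v u"
  by (simp add: L2_inner_def inner_commute)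

lemma L2_inner_add_left:
  "u \<in> L2_space S \<Longrightarrow> v \<in> L2_space S \<Longrightarrow> z \<in> L2_space S \<Longrightarrow>
    L2_inner S (\<lambda>x. u x + v x) z = L2_inner S u z + L2_inner S v z"
  by (simp add: L2_inner_def inner_add_left L2_integrable_inner)

lemma L2_inner_diff_left:
  "u \<in> L2_space S \<Longrightarrow> v \<in> L2_space S \<Longrightarrow> z \<in> L2_space S \<Longrightarrow>
    L2_inner S (\<lambda>x. u x - v x) z = L2_inner S u z - L2_inner S v z"
  by (simp add: L2_inner_def inner_diff_left L2_integrable_inner)

lemma L2_inner_scaleR_left: "L2_inner S (\<lambda>x. r *\<^sub>R u x) v = r * L2_inner S u v"
  by (simp add: L2_inner_def)

lemma L2_inner_add_right:
  "u \<in> L2_space S \<Longrightarrow> v \<in> L2_space S \<Longrightarrow> z \<in> L2_space S \<Longrightarrow>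
    L2_inner S z (\<lambda>x. u x + v x) = L2_inner S z u + L2_inner S z v"
  by (simp add: L2_inner_def inner_add_right L2_integrable_inner)

lemma L2_inner_diff_right:
  "u \<in> L2_space S \<Longrightarrow> v \<in> L2_space S \<Longrightarrow> z \<in> L2_space S \<Longrightarrow>
    L2_inner S z (\<lambda>x. u x - v x) = L2_inner S z u - L2_inner S z v"
  by (simp add: L2_inner_def inner_diff_right L2_integrable_inner)

lemma L2_inner_scaleR_right: "L2_inner S v (\<lambda>x. r *\<^sub>R u x) = r * L2_inner S v u"
  by (simp add: L2_inner_def)

lemma L2_norm_nonneg: "0 \<le> L2_norm S u"
  by (simp add: L2_norm_def)

lemma L2_inner_self: "L2_inner S u u = (L2_norm S u)\<^sup>2"
  by (simp add: L2_inner_def L2_norm_def power2_norm_eq_inner)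

lemma L2_norm_scaleR: "L2_norm S (\<lambda>x. r *\<^sub>R u x) = \<bar>r\<bar> * L2_norm S u"
  by (simp add: L2_norm_def power_mult_distrib real_sqrt_mult)

lemma L2_norm_minus_commute: "L2_norm S (\<lambda>x. u x - v x) = L2_norm S (\<lambda>x. v x - u x)"
  by (simp add: L2_norm_def norm_minus_commute)

text \<open>Meant for the Cauchy-Schwarz inequality in L2. On representatives the inner product is
  only semidefinite, so the leading coefficient may vanish and the usual minimiser -b/c is not
  always available.\<close>

lemma discriminant_nonpos:
  fixes a b c :: real
  assumes "\<And>t. 0 \<le> a + 2 * t * b + t\<^sup>2 * c"
  shows "b\<^sup>2 \<le> a * c"
proof (cases "c = 0")
  case True
  show ?thesis
  proof (rule ccontr)
    assume "\<not> ?thesis"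
    then have "b \<noteq> 0" using True by auto
    \<comment> \<open>At this point the polynomial, here affine, takes the value -1.\<close>
    with assms[of "- (a + 1) / (2 * b)"] True show False by (simp add: field_simps)
  qed
next
  case False
  have "0 \<le> c"
  proof (rule ccontr)
    assume c: "\<not> 0 \<le> c"
    \<comment> \<open>Large enough for the quadratic term to outweigh both others:
      \<open>t * \<bar>c\<bar>\<close> exceeds the sum of their absolute coefficients, and
      \<open>t\<close> is at least 1.\<close>
    define t where "t = (\<bar>a\<bar> + 2 * \<bar>b\<bar>) / \<bar>c\<bar> + 1"
    have "t \<ge> 1" "t * \<bar>c\<bar> = \<bar>a\<bar> + 2 * \<bar>b\<bar> + \<bar>c\<bar>"
      using c by (auto simp: t_def field_simps)
    have "t\<^sup>2 * \<bar>c\<bar> = t * \<bar>a\<bar> + 2 * t * \<bar>b\<bar> + t * \<bar>c\<bar>"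
      using \<open>t * \<bar>c\<bar> = _\<close> by (simp add: power2_eq_square algebra_simps)
    moreover have "t * \<bar>a\<bar> \<ge> \<bar>a\<bar>" "t * \<bar>b\<bar> \<ge> t * b" "t * \<bar>c\<bar> > 0"
      using \<open>t \<ge> 1\<close> c by (auto simp: mult_le_cancel_right1 mult_le_cancel_left intro: mult_pos_neg)
    moreover have "t\<^sup>2 * c = - (t\<^sup>2 * \<bar>c\<bar>)" using c by simp
    ultimately show False using assms[of t] by linarith
  qed
  with False have "0 < c" by simp
  with assms[of "- b / c"] show ?thesis
    by (simp add: field_simps power2_eq_square)
qed

lemma L2_Cauchy_Schwarz:
  assumes u: "u \<in> L2_space S" and v: "v \<in> L2_space S"
  shows "\<bar>L2_inner S u v\<bar> \<le> L2_norm S u * L2_norm S v"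
proof -
  have "0 \<le> (L2_norm S u)\<^sup>2 + 2 * t * L2_inner S u v + t\<^sup>2 * (L2_norm S v)\<^sup>2" for t
  proof -
    have "0 \<le> L2_inner S (\<lambda>x. u x + t *\<^sub>R v x) (\<lambda>x. u x + t *\<^sub>R v x)"
      by (simp add: L2_inner_self)
    also have "\<dots> = (L2_norm S u)\<^sup>2 + 2 * t * L2_inner S u v + t\<^sup>2 * (L2_norm S v)\<^sup>2"
      using assms by (simp add: L2_inner_add_left L2_inner_add_right L2_add L2_scaleR
          L2_inner_scaleR_left L2_inner_scaleR_right L2_inner_commute[of S v u] algebra_simps power2_eq_square[of t]
          flip: L2_inner_self)
    finally show ?thesis .
  qed
  then have "(L2_inner S u v)\<^sup>2 \<le> (L2_norm S u * L2_norm S v)\<^sup>2"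
    unfolding power_mult_distrib by (rule discriminant_nonpos)
  then show ?thesis
    by (metis L2_norm_nonneg abs_le_square_iff abs_of_nonneg mult_nonneg_nonneg)
qed

lemma L2_norm_triangle:
  assumes u: "u \<in> L2_space S" and v: "v \<in> L2_space S"
  shows "L2_norm S (\<lambda>x. u x + v x) \<le> L2_norm S u + L2_norm S v"
proof (rule power2_le_imp_le)
  have "(L2_norm S (\<lambda>x. u x + v x))\<^sup>2 = (L2_norm S u)\<^sup>2 + 2 * L2_inner S u v + (L2_norm S v)\<^sup>2"
    using assms by (simp add: L2_inner_add_left L2_inner_add_right L2_add L2_inner_commute[of S v u]
        flip: L2_inner_self)
  also have "\<dots> \<le> (L2_norm S u + L2_norm S v)\<^sup>2"
    using L2_Cauchy_Schwarz[OF assms] by (simp add: power2_sum)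
  finally show "(L2_norm S (\<lambda>x. u x + v x))\<^sup>2 \<le> (L2_norm S u + L2_norm S v)\<^sup>2" .
qed (simp add: L2_norm_nonneg)

lemma L2_norm_triangle_diff:
  assumes "u \<in> L2_space S" and "v \<in> L2_space S"
  shows "\<bar>L2_norm S u - L2_norm S v\<bar> \<le> L2_norm S (\<lambda>x. u x - v x)"
  using L2_norm_triangle[OF L2_diff[OF assms] assms(2)]
    L2_norm_triangle[OF L2_diff[OF assms(2,1)] assms(1)] L2_norm_minus_commute[of S u v] by simp

lemma L2_space_cong_AE:
  assumes "S \<in> sets lebesgue" "u \<in> L2_space S" "AE x in lebesgue_on S. u x = v x"
  shows "v \<in> L2_space S"
proof -
  have v: "v \<in> borel_measurable (lebesgue_on S)"
    using borel_measurable_lebesgue_on_cong_AE assms L2_measurable by blast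
  moreover have "integrable (lebesgue_on S) (\<lambda>x. (norm (v x))\<^sup>2)"
    using assms(3) v L2_measurable[OF assms(2)]
    by (intro integrable_cong_AE_imp[OF L2_integrable[OF assms(2)]]) auto
  ultimately show ?thesis by (simp add: L2_space_def)
qed

lemma L2_inner_cong_AE:
  assumes S: "S \<in> sets lebesgue" and L2: "u \<in> L2_space S" "v \<in> L2_space S"
    and ae: "AE x in lebesgue_on S. u x = u' x" "AE x in lebesgue_on S. v x = v' x"
  shows "L2_inner S u v = L2_inner S u' v'"
  unfolding L2_inner_def
proof (rule integral_cong_AE)
  show "(\<lambda>x. u x \<bullet> v x) \<in> borel_measurable (lebesgue_on S)"
    by (intro borel_measurable_inner L2_measurable L2)
  show "(\<lambda>x. u' x \<bullet> v' x) \<in> borel_measurable (lebesgue_on S)"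
    by (intro borel_measurable_inner L2_measurable L2_space_cong_AE[OF S L2(1) ae(1)]
        L2_space_cong_AE[OF S L2(2) ae(2)])
  show "AE x in lebesgue_on S. u x \<bullet> v x = u' x \<bullet> v' x"
    using ae by eventually_elim simp
qed

lemma L2_norm_cong_AE:
  assumes "S \<in> sets lebesgue" "u \<in> L2_space S" "AE x in lebesgue_on S. u x = v x"
  shows "L2_norm S u = L2_norm S v"
  using L2_inner_cong_AE[OF assms(1,2,2,3,3)] by (simp add: L2_inner_self L2_norm_nonneg power2_eq_iff_nonneg)

lemma L2_inner_tendsto:
  assumes L2: "u \<in> L2_space S" "v \<in> L2_space S" "\<And>n. U n \<in> L2_space S" "\<And>n. V n \<in> L2_space S"
    and U: "(\<lambda>n. L2_norm S (\<lambda>x. u x - U n x)) \<longlonglongrightarrow> 0"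
    and V: "(\<lambda>n. L2_norm S (\<lambda>x. v x - V n x)) \<longlonglongrightarrow> 0"
  shows "(\<lambda>n. L2_inner S (U n) (V n)) \<longlonglongrightarrow> L2_inner S u v"
proof (rule LIM_zero_cancel, rule Lim_null_comparison)
  have "\<bar>L2_inner S (U n) (V n) - L2_inner S u v\<bar>
      \<le> (L2_norm S u + L2_norm S (\<lambda>x. u x - U n x)) * L2_norm S (\<lambda>x. v x - V n x)
        + L2_norm S (\<lambda>x. u x - U n x) * L2_norm S v" for n
  proof -
    have "L2_inner S u v - L2_inner S (U n) (V n)
        = L2_inner S (U n) (\<lambda>x. v x - V n x) + L2_inner S (\<lambda>x. u x - U n x) v"
      using L2 by (simp add: L2_inner_diff_left L2_inner_diff_right)
    \<comment> \<open>The norm of \<open>U n\<close> is estimated by that of \<open>u\<close> plus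
      the error, which replaces a separate argument that the sequence is bounded.\<close>
    moreover have "\<bar>L2_inner S (U n) (\<lambda>x. v x - V n x)\<bar>
        \<le> (L2_norm S u + L2_norm S (\<lambda>x. u x - U n x)) * L2_norm S (\<lambda>x. v x - V n x)"
      using L2_Cauchy_Schwarz[OF L2(3)[of n] L2_diff[OF L2(2) L2(4)[of n]]]
        L2_norm_triangle_diff[OF L2(1) L2(3)[of n]]
      by (elim order.trans) (intro mult_right_mono L2_norm_nonneg, simp)
    moreover have "\<bar>L2_inner S (\<lambda>x. u x - U n x) v\<bar> \<le> L2_norm S (\<lambda>x. u x - U n x) * L2_norm S v"
      by (intro L2_Cauchy_Schwarz L2_diff L2)
    ultimately show ?thesis by linarith
  qed
  then show "\<forall>\<^sub>F n in sequentially. norm (L2_inner S (U n) (V n) - L2_inner S u v)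
      \<le> (L2_norm S u + L2_norm S (\<lambda>x. u x - U n x)) * L2_norm S (\<lambda>x. v x - V n x)
        + L2_norm S (\<lambda>x. u x - U n x) * L2_norm S v"
    by simp
  have "(\<lambda>n. (L2_norm S u + L2_norm S (\<lambda>x. u x - U n x)) * L2_norm S (\<lambda>x. v x - V n x)
        + L2_norm S (\<lambda>x. u x - U n x) * L2_norm S v) \<longlonglongrightarrow> (L2_norm S u + 0) * 0 + 0 * L2_norm S v"
    by (intro tendsto_intros U V)
  then show "(\<lambda>n. (L2_norm S u + L2_norm S (\<lambda>x. u x - U n x)) * L2_norm S (\<lambda>x. v x - V n x)
        + L2_norm S (\<lambda>x. u x - U n x) * L2_norm S v) \<longlonglongrightarrow> 0" by simp
qed

lemma L2_continuous_bounded: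
  assumes "continuous_on UNIV u" and "bounded S" "S \<in> sets lebesgue"
  shows "u \<in> L2_space S"
  unfolding L2_space_def
proof safe
  show m: "u \<in> borel_measurable (lebesgue_on S)"
    using assms continuous_imp_measurable_on_sets_lebesgue continuous_on_subset by blast
  have "compact (u ` closure S)"
    using assms by (intro compact_continuous_image continuous_on_subset[OF assms(1)]) auto
  then obtain B where B: "\<And>x. x \<in> S \<Longrightarrow> norm (u x) \<le> B"
    using closure_subset by (fastforce simp: bounded_iff dest!: compact_imp_bounded)
  interpret finite_measure "lebesgue_on S"
    using assms by (intro finite_measure_lebesgue_on bounded_set_imp_lmeasurable)
  show "integrable (lebesgue_on S) (\<lambda>x. (norm (u x))\<^sup>2)"
    using m B by (intro integrable_const_bound[where B="B\<^sup>2"]) (auto intro!: AE_I2 power_mono)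
qed

section \<open>Test functions and weak gradients\<close>

lemma test_functions_Ck: "\<phi> \<in> test_functions \<Omega> \<Longrightarrow> Ck k \<phi>"
  by (simp add: test_functions_def)

lemma test_functions_continuous: "\<phi> \<in> test_functions \<Omega> \<Longrightarrow> continuous_on S \<phi>"
  using Ck_continuous[OF test_functions_Ck] continuous_on_subset by blast

lemma test_functions_differentiable: "\<phi> \<in> test_functions \<Omega> \<Longrightarrow> \<phi> differentiable at x"
  using test_functions_Ck[of \<phi> \<Omega> "Suc 0"] by simp

lemma test_functions_support:
  assumes "\<phi> \<in> test_functions \<Omega>"
  obtains K where "compact K" "K \<subseteq> \<Omega>" "\<And>x. x \<notin> K \<Longrightarrow> \<phi> x = 0"
  using assms closure_subset[of "{x. \<phi> x \<noteq> 0}"]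
  by (intro that[of "closure {x. \<phi> x \<noteq> 0}"]) (auto simp: test_functions_def)

lemma test_functionsI:
  assumes "\<And>k. Ck k \<phi>" "compact K" "K \<subseteq> \<Omega>" "\<And>x. x \<notin> K \<Longrightarrow> \<phi> x = 0"
  shows "\<phi> \<in> test_functions \<Omega>"
proof -
  have "closure {x. \<phi> x \<noteq> 0} \<subseteq> K"
    using assms by (intro closure_minimal) (auto simp: compact_imp_closed)
  moreover have "bounded {x. \<phi> x \<noteq> 0}"
    using assms by (intro bounded_subset[OF compact_imp_bounded[OF assms(2)]]) auto
  ultimately show ?thesis
    using assms by (auto simp: test_functions_def)
qed

lemma test_functions_add:
  assumes "\<phi> \<in> test_functions \<Omega>" "\<psi> \<in> test_functions \<Omega>"
  shows "(\<lambda>x. \<phi> x + \<psi> x) \<in> test_functions \<Omega>"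
proof -
  obtain K where K: "compact K" "K \<subseteq> \<Omega>" "\<And>x. x \<notin> K \<Longrightarrow> \<phi> x = 0"
    using assms(1) by (rule test_functions_support) blast
  obtain L where L: "compact L" "L \<subseteq> \<Omega>" "\<And>x. x \<notin> L \<Longrightarrow> \<psi> x = 0"
    using assms(2) by (rule test_functions_support) blast
  show ?thesis
    using K L
    by (intro test_functionsI[of _ "K \<union> L"] Ck_add test_functions_Ck[OF assms(1)]
        test_functions_Ck[OF assms(2)]) auto
qed

lemma test_functions_mult:
  assumes "\<phi> \<in> test_functions \<Omega>" "\<And>k. Ck k \<psi>"
  shows "(\<lambda>x. \<psi> x * \<phi> x) \<in> test_functions \<Omega>"
proof -
  obtain K where K: "compact K" "K \<subseteq> \<Omega>" "\<And>x. x \<notin> K \<Longrightarrow> \<phi> x = 0"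
    using assms(1) by (rule test_functions_support) blast
  show ?thesis
    using K by (intro test_functionsI[of _ K] Ck_mult test_functions_Ck[OF assms(1)] assms(2)) auto
qed

lemma test_functions_scale: "\<phi> \<in> test_functions \<Omega> \<Longrightarrow> (\<lambda>x. r * \<phi> x) \<in> test_functions \<Omega>"
  by (rule test_functions_mult) (auto simp: Ck_const)

lemma has_derivative_outside:
  assumes "closed K" "\<And>x. x \<notin> K \<Longrightarrow> \<phi> x = 0" "x \<notin> K"
  shows "(\<phi> has_derivative (\<lambda>_. 0)) (at x)"
  by (rule has_derivative_transform_within_open[of "\<lambda>_. 0" _ _ _ "- K"]) (use assms in auto)

lemma partial_deriv_outside:
  assumes "closed K" "\<And>x. x \<notin> K \<Longrightarrow> \<phi> x = 0" "x \<notin> K"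
  shows "partial_deriv j \<phi> x = 0"
  using has_derivative_outside[of K \<phi> x, OF assms] by (simp add: partial_deriv_eq)

lemma test_functions_partial_deriv:
  assumes "\<phi> \<in> test_functions \<Omega>"
  shows "partial_deriv j \<phi> \<in> test_functions \<Omega>"
proof -
  obtain K where K: "compact K" "K \<subseteq> \<Omega>" "\<And>x. x \<notin> K \<Longrightarrow> \<phi> x = 0"
    using assms(1) by (rule test_functions_support) blast
  have "Ck k (partial_deriv j \<phi>)" for k
    using test_functions_Ck[OF assms, of "Suc k"] by simp
  then show ?thesis
    using K by (intro test_functionsI[of _ K] partial_deriv_outside[of K]) (auto simp: compact_imp_closed)
qed

section \<open>Local integrability and the fundamental lemma\<close>

lemma locally_integrable_linear:
  "locally_integrable \<Omega> u \<Longrightarrow> bounded_linear h \<Longrightarrow> locally_integrable \<Omega> (\<lambda>x. h (u x))"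
  using absolutely_integrable_linear by (fastforce simp: locally_integrable_def o_def)

lemma locally_integrable_add:
  "locally_integrable \<Omega> u \<Longrightarrow> locally_integrable \<Omega> v \<Longrightarrow> locally_integrable \<Omega> (\<lambda>x. u x + v x)"
  by (auto simp: locally_integrable_def intro: set_integral_add)

lemma locally_integrable_continuous:
  fixes u :: "real ^ 'b \<Rightarrow> 'c::euclidean_space"
  shows "continuous_on UNIV u \<Longrightarrow> locally_integrable \<Omega> u"
  unfolding locally_integrable_def
proof safe
  fix K :: "(real ^ 'b) set" assume u: "continuous_on UNIV u" and K: "compact K"
  obtain a where "K \<subseteq> cbox (- a) a"
    using bounded_subset_cbox_symmetric[OF compact_imp_bounded[OF K]] by blast
  moreover have "u absolutely_integrable_on cbox (- a) a"
    by (intro absolutely_integrable_continuous continuous_on_subset[OF u] subset_UNIV)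
  ultimately show "u absolutely_integrable_on K"
    using K by (meson set_integrable_subset fmeasurableD lmeasurable_compact)
qed

lemma locally_integrable_component:
  assumes "locally_integrable \<Omega> u"
  shows "locally_integrable \<Omega> (\<lambda>x. u x $ i)"
  using assms by (rule locally_integrable_linear) (rule bounded_linear_vec_nth)

text \<open>\<open>h\<close> may fail to be integrable near the boundary; the product is confined to
  the compact support of \<phi>, where \<open>h\<close> is integrable and \<phi> is bounded.\<close>

lemma integrable_test_function:
  fixes h :: "'d::finite scalar_field"
  assumes \<Omega>: "\<Omega> \<in> sets lebesgue" and h: "locally_integrable \<Omega> h" and \<phi>: "\<phi> \<in> test_functions \<Omega>"
  shows "integrable (lebesgue_on \<Omega>) (\<lambda>x. h x * \<phi> x)"
proof -
  obtain K where K: "compact K" "K \<subseteq> \<Omega>" "\<And>x. x \<notin> K \<Longrightarrow> \<phi> x = 0"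
    using \<phi> by (rule test_functions_support) blast
  have "(\<lambda>x. \<phi> x * h x) absolutely_integrable_on K"
  proof (rule absolutely_integrable_bounded_measurable_product[where h="(*)" and f=\<phi> and g=h])
    show "bilinear ((*) :: real \<Rightarrow> real \<Rightarrow> real)"
      by (simp add: bilinear_conv_bounded_bilinear bounded_bilinear_mult)
    show K': "K \<in> sets lebesgue"
      using K by (simp add: lmeasurable_compact fmeasurableD)
    show "\<phi> \<in> borel_measurable (lebesgue_on K)"
      using K' \<phi> by (intro continuous_imp_measurable_on_sets_lebesgue test_functions_continuous)
    show "bounded (\<phi> ` K)"
      using K \<phi> by (intro compact_imp_bounded compact_continuous_image test_functions_continuous)
    show "h absolutely_integrable_on K"
      using h K by (auto simp: locally_integrable_def)
  qed
  then have int: "integrable lebesgue (\<lambda>x. indicator K x *\<^sub>R (\<phi> x * h x))"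
    by (simp add: set_integrable_def)
  have eq: "indicator K x *\<^sub>R (\<phi> x * h x) = indicator \<Omega> x *\<^sub>R (h x * \<phi> x)" for x
    using K(2) K(3)[of x] by (cases "x \<in> K") auto
  have "\<Omega> \<inter> space lebesgue \<in> sets lebesgue"
    using \<Omega> by simp
  from integrable_restrict_space[OF this, of "\<lambda>x. h x * \<phi> x"] int show ?thesis
    unfolding eq by blast
qed

text \<open>The bumps of the open box are admissible test functions and converge boundedly to its
  indicator. Dominated convergence therefore carries the hypothesis from test functions to boxes,
  whose boundary has measure zero.\<close>

lemma integral_cbox_eq_0:
  fixes h :: "'d::finite scalar_field"
  assumes \<Omega>: "\<Omega> \<in> sets lebesgue" and h: "locally_integrable \<Omega> h"
    and zero: "\<And>\<phi>. \<phi> \<in> test_functions \<Omega> \<Longrightarrow> (LINT x|lebesgue_on \<Omega>. h x * \<phi> x) = 0"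
    and sub: "cbox a b \<subseteq> \<Omega>"
  shows "integral (cbox a b) h = 0"
proof -
  have hint: "h absolutely_integrable_on cbox a b"
    using h sub by (auto simp: locally_integrable_def)
  then have *: "integrable lebesgue (\<lambda>x. indicator (cbox a b) x *\<^sub>R h x)"
    by (simp add: set_integrable_def)
  let ?s = "\<lambda>n x. indicator (cbox a b) x *\<^sub>R h x * bump a b n x"
  have bump0: "(LINT x|lebesgue. ?s n x) = 0" for n
  proof -
    have "(LINT x|lebesgue. ?s n x) = (LINT x|lebesgue. indicator \<Omega> x *\<^sub>R (h x * bump a b n x))"
      using sub bump_outside[of _ a b n] box_subset_cbox[of a b]
      by (intro Bochner_Integration.integral_cong refl) (auto simp: indicator_def subset_eq)
    also have "\<dots> = (LINT x|lebesgue_on \<Omega>. h x * bump a b n x)"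
      using \<Omega> by (simp add: integral_restrict_space)
    also have "\<dots> = 0"
      by (rule zero) (rule bump_test_function[OF sub])
    finally show ?thesis .
  qed
  have "(\<lambda>n. LINT x|lebesgue. ?s n x)
      \<longlonglongrightarrow> (LINT x|lebesgue. indicator (cbox a b) x *\<^sub>R h x * indicator (box a b) x)"
  proof (rule integral_dominated_convergence[where w="\<lambda>x. norm (indicator (cbox a b) x *\<^sub>R h x)"])
    show "(\<lambda>x. indicator (cbox a b) x *\<^sub>R h x * indicator (box a b) x) \<in> borel_measurable lebesgue"
      using * by (intro borel_measurable_times borel_measurable_integrable borel_measurable_indicator) auto
    have "bump a b n \<in> borel_measurable lebesgue" for n
      using Ck_continuous[OF Ck_bump[of 0 a b n]] by (simp add: borel_measurable_continuous_onI measurable_completion)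
    then show "?s n \<in> borel_measurable lebesgue" for n
      using * by (intro borel_measurable_times) auto
    show "integrable lebesgue (\<lambda>x. norm (indicator (cbox a b) x *\<^sub>R h x))"
      using * by (rule integrable_norm)
    show "AE x in lebesgue. (\<lambda>n. ?s n x) \<longlonglongrightarrow> indicator (cbox a b) x *\<^sub>R h x * indicator (box a b) x"
      by (intro AE_I2 tendsto_intros bump_tendsto)
    show "AE x in lebesgue. norm (?s n x) \<le> norm (indicator (cbox a b) x *\<^sub>R h x)" for n
      using bump_bounds[of a b n]
      by (intro AE_I2) (auto simp: abs_mult intro!: mult_left_le)
  qed
  then have "(LINT x|lebesgue. indicator (cbox a b) x *\<^sub>R h x * indicator (box a b) x) = 0"
    unfolding bump0 by (simp add: LIMSEQ_const_iff)
  moreover have "(LINT x|lebesgue. indicator (cbox a b) x *\<^sub>R h x * indicator (box a b) x)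
      = (LINT x:box a b|lebesgue. h x)"
    unfolding set_lebesgue_integral_def using box_subset_cbox[of a b]
    by (intro Bochner_Integration.integral_cong refl) (auto simp: indicator_def)
  moreover have "h absolutely_integrable_on box a b"
    using hint by (rule set_integrable_subset) (auto simp: box_subset_cbox)
  ultimately have "integral (box a b) h = 0"
    by (simp add: set_lebesgue_integral_eq_integral(2))
  then show ?thesis by (simp add: integral_open_interval)
qed

text \<open>No measurability of \<open>P\<close> is required, because subsets of null sets are
  measurable for the completed measure.\<close>

lemma AE_lebesgue_on_negligible:
  assumes "S \<in> sets lebesgue"
  shows "(AE x in lebesgue_on S. P x) \<longleftrightarrow> negligible {x \<in> S. \<not> P x}"
proof -
  have "(AE x in lebesgue_on S. P x) \<longleftrightarrow> (AE x in lebesgue. x \<in> S \<longrightarrow> P x)"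
    using assms by (simp add: AE_restrict_space_iff)
  also have "\<dots> \<longleftrightarrow> {x \<in> S. \<not> P x} \<in> null_sets lebesgue"
  proof
    assume "AE x in lebesgue. x \<in> S \<longrightarrow> P x"
    then obtain N where "N \<in> null_sets lebesgue" "{x. \<not> (x \<in> S \<longrightarrow> P x)} \<subseteq> N"
      by (auto simp: eventually_ae_filter)
    then show "{x \<in> S. \<not> P x} \<in> null_sets lebesgue"
      using null_sets_completion_subset[of "{x \<in> S. \<not> P x}" N] by auto
  next
    assume "{x \<in> S. \<not> P x} \<in> null_sets lebesgue"
    then show "AE x in lebesgue. x \<in> S \<longrightarrow> P x"
      by (rule AE_I') auto
  qed
  finally show ?thesis by (simp add: negligible_iff_null_sets)
qed

text \<open>The fundamental lemma of the calculus of variations, via Lebesgue's differentiation theorem.\<close>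

lemma locally_integrable_eq_0:
  fixes h :: "'d::finite scalar_field"
  assumes \<Omega>: "open \<Omega>" and h: "locally_integrable \<Omega> h"
    and zero: "\<And>\<phi>. \<phi> \<in> test_functions \<Omega> \<Longrightarrow> (LINT x|lebesgue_on \<Omega>. h x * \<phi> x) = 0"
  shows "AE x in lebesgue_on \<Omega>. h x = 0"
proof -
  have \<Omega>': "\<Omega> \<in> sets lebesgue" using \<Omega> by (simp add: lebesgue_openin)
  have local: "negligible {x \<in> box c d. h x \<noteq> 0}" if cd: "cbox c d \<subseteq> \<Omega>" for c d
  proof -
    \<comment> \<open>\<open>h\<close> is integrable only on compact subsets of \<Omega>, whereas
      the differentiation theorem wants integrability on every box; hence the truncation.\<close>
    define f where "f = (\<lambda>x. if x \<in> cbox c d then h x else 0)"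
    have hint: "h absolutely_integrable_on cbox c d"
      using h cd by (auto simp: locally_integrable_def)
    have "f absolutely_integrable_on UNIV"
      unfolding f_def using hint by (simp add: absolutely_integrable_restrict_UNIV)
    then have "f integrable_on cbox a b" for a b
      using set_lebesgue_integral_eq_integral(1) integrable_on_subcbox subset_UNIV by blast
    then obtain N where N: "negligible N" "\<And>x e. \<lbrakk>x \<notin> N; 0 < e\<rbrakk> \<Longrightarrow> \<exists>\<delta>>0. \<forall>t. 0 < t \<and> t < \<delta> \<longrightarrow>
        norm (integral (cbox x (x + t *\<^sub>R One)) f /\<^sub>R t ^ DIM(real ^ 'd) - f x) < e"
      using integrable_ccontinuous_explicit[of f] by metis
    have "h x = 0" if x: "x \<in> box c d" "x \<notin> N" for x
    proof (rule ccontr)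
      assume "h x \<noteq> 0"
      then obtain \<delta> where \<delta>: "\<delta> > 0" "\<And>t. 0 < t \<Longrightarrow> t < \<delta> \<Longrightarrow>
          norm (integral (cbox x (x + t *\<^sub>R One)) f /\<^sub>R t ^ DIM(real ^ 'd) - f x) < norm (h x)"
        using N(2)[OF x(2), of "norm (h x)"] by auto
      obtain r where r: "r > 0" "cball x r \<subseteq> box c d"
        using open_box x(1) open_contains_cball by metis
      \<comment> \<open>Keeps the cube with corner \<open>x\<close> and side \<open>t\<close> inside
        the ball of radius \<open>r\<close>. Adding 1 to the norm of \<open>One\<close> makes the
        denominator visibly positive.\<close>
      define t where "t = min (\<delta> / 2) (r / (norm (One :: real ^ 'd) + 1))"
      have t: "0 < t" "t < \<delta>" "t \<le> r / (norm (One :: real ^ 'd) + 1)"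
        using \<delta> r by (auto simp: t_def add_nonneg_pos)
      have "cbox x (x + t *\<^sub>R One) \<subseteq> cball x r"
      proof
        fix z assume z: "z \<in> cbox x (x + t *\<^sub>R One)"
        have "norm (z - x) \<le> norm (t *\<^sub>R (One :: real ^ 'd))"
          using z by (intro norm_le_componentwise) (auto simp: mem_box inner_diff_left inner_add_left algebra_simps)
        also have "\<dots> \<le> t * (norm (One :: real ^ 'd) + 1)"
          using t by simp
        also have "\<dots> \<le> r"
          using t(3) by (simp add: pos_le_divide_eq add_nonneg_pos)
        finally show "z \<in> cball x r" by (simp add: dist_norm norm_minus_commute)
      qed
      then have sub: "cbox x (x + t *\<^sub>R One) \<subseteq> cbox c d"
        using r box_subset_cbox by blast
      then have "integral (cbox x (x + t *\<^sub>R One)) f = integral (cbox x (x + t *\<^sub>R One)) h"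
        by (intro Henstock_Kurzweil_Integration.integral_cong) (auto simp: f_def)
      also have "\<dots> = 0"
        using sub cd by (intro integral_cbox_eq_0[OF \<Omega>' h zero]) auto
      finally show False
        using \<delta>(2)[OF t(1,2)] x box_subset_cbox[of c d] by (auto simp: f_def)
    qed
    then show ?thesis
      using N(1) by (rule_tac negligible_subset) auto
  qed
  obtain \<D> where \<D>: "countable \<D>" "\<D> \<subseteq> Pow \<Omega>" "\<And>X. X \<in> \<D> \<Longrightarrow> \<exists>a b. X = cbox a b" "\<Union>\<D> = \<Omega>"
    using open_countable_Union_open_cbox[OF \<Omega>] by metis
  have "negligible {x \<in> X. h x \<noteq> 0}" if X\<D>: "X \<in> \<D>" for X
  proof -
    obtain c d where X: "X = cbox c d" using \<D>(3)[OF X\<D>] by blast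
    \<comment> \<open>The local result concerns open boxes; each of the countably many closed boxes
      filling \<Omega> contributes its null boundary.\<close>
    have "{x \<in> X. h x \<noteq> 0} \<subseteq> {x \<in> box c d. h x \<noteq> 0} \<union> (cbox c d - box c d)"
      using X by auto
    moreover have "negligible ({x \<in> box c d. h x \<noteq> 0} \<union> (cbox c d - box c d))"
      using local[of c d] X\<D> X \<D>(2) by (intro negligible_Un negligible_frontier_interval) auto
    ultimately show ?thesis by (rule negligible_subset[rotated])
  qed
  then have "negligible (\<Union>X\<in>\<D>. {x \<in> X. h x \<noteq> 0})"
    using \<D>(1) by (intro negligible_countable_Union) auto
  moreover have "{x \<in> \<Omega>. h x \<noteq> 0} = (\<Union>X\<in>\<D>. {x \<in> X. h x \<noteq> 0})"
    using \<D>(4) by auto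
  ultimately show ?thesis
    using \<Omega>' by (simp add: AE_lebesgue_on_negligible)
qed

section \<open>Weak gradients and the linear structure of \<open>H1\<close>\<close>

lemma has_weak_grad_unique:
  fixes u :: "'d::finite vector_field"
  assumes \<Omega>: "open \<Omega>" and "has_weak_grad \<Omega> u G" "has_weak_grad \<Omega> u H"
  shows "AE x in lebesgue_on \<Omega>. G x = H x"
proof -
  have \<Omega>': "\<Omega> \<in> sets lebesgue" using \<Omega> by (simp add: lebesgue_openin)
  have li: "locally_integrable \<Omega> (\<lambda>x. G x $ i $ j)" "locally_integrable \<Omega> (\<lambda>x. H x $ i $ j)" for i j
    using assms by (auto simp: has_weak_grad_def intro!: locally_integrable_component)
  \<comment> \<open>The difference is written as a sum with a multiple by -1, so that local
    integrability follows from closure under sums and linear maps.\<close>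
  have "AE x in lebesgue_on \<Omega>. G x $ i $ j + - 1 * H x $ i $ j = 0" for i j
  proof (rule locally_integrable_eq_0[OF \<Omega>])
    show "locally_integrable \<Omega> (\<lambda>x. G x $ i $ j + - 1 * H x $ i $ j)"
      by (intro locally_integrable_add locally_integrable_linear[OF li(2)] li(1)) (rule bounded_linear_mult_right)
    fix \<phi> assume \<phi>: "\<phi> \<in> test_functions \<Omega>"
    have "- (LINT x|lebesgue_on \<Omega>. G x $ i $ j * \<phi> x) = - (LINT x|lebesgue_on \<Omega>. H x $ i $ j * \<phi> x)"
      using assms(2,3) \<phi> by (simp add: has_weak_grad_def)
    then show "(LINT x|lebesgue_on \<Omega>. (G x $ i $ j + - 1 * H x $ i $ j) * \<phi> x) = 0"
      using integrable_test_function[OF \<Omega>' li(1) \<phi>] integrable_test_function[OF \<Omega>' li(2) \<phi>]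
      by (simp add: left_diff_distrib)
  qed
  then have "AE x in lebesgue_on \<Omega>. \<forall>i j. G x $ i $ j + - 1 * H x $ i $ j = 0"
    by (simp add: AE_all_countable)
  then show ?thesis
    by eventually_elim (simp add: vec_eq_iff)
qed

lemma has_weak_grad_add:
  fixes u v :: "'d::finite vector_field"
  assumes \<Omega>: "\<Omega> \<in> sets lebesgue" and u: "has_weak_grad \<Omega> u G" and v: "has_weak_grad \<Omega> v H"
  shows "has_weak_grad \<Omega> (\<lambda>x. u x + v x) (\<lambda>x. G x + H x)"
  unfolding has_weak_grad_def
proof (intro conjI ballI allI)
  show "locally_integrable \<Omega> (\<lambda>x. u x + v x)" "locally_integrable \<Omega> (\<lambda>x. G x + H x)"
    using u v by (auto simp: has_weak_grad_def intro: locally_integrable_add)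
  fix \<phi> i j assume \<phi>: "\<phi> \<in> test_functions \<Omega>"
  have "integrable (lebesgue_on \<Omega>) (\<lambda>x. u x $ i * partial_deriv j \<phi> x)"
    "integrable (lebesgue_on \<Omega>) (\<lambda>x. v x $ i * partial_deriv j \<phi> x)"
    "integrable (lebesgue_on \<Omega>) (\<lambda>x. G x $ i $ j * \<phi> x)"
    "integrable (lebesgue_on \<Omega>) (\<lambda>x. H x $ i $ j * \<phi> x)"
    using u v \<phi> by (auto intro!: integrable_test_function[OF \<Omega>] locally_integrable_component
        test_functions_partial_deriv simp: has_weak_grad_def)
  then show "(LINT x|lebesgue_on \<Omega>. (u x + v x) $ i * partial_deriv j \<phi> x)
      = - (LINT x|lebesgue_on \<Omega>. (G x + H x) $ i $ j * \<phi> x)"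
    using u v \<phi> by (simp add: has_weak_grad_def distrib_right)
qed

lemma has_weak_grad_scaleR:
  fixes u :: "'d::finite vector_field"
  assumes u: "has_weak_grad \<Omega> u G"
  shows "has_weak_grad \<Omega> (\<lambda>x. r *\<^sub>R u x) (\<lambda>x. r *\<^sub>R G x)"
  using u by (auto simp: has_weak_grad_def mult.assoc
      intro!: locally_integrable_linear[of \<Omega> _ "\<lambda>x. r *\<^sub>R x"] bounded_linear_scaleR_right)

lemma has_weak_grad_wgrad: "has_weak_grad \<Omega> u G \<Longrightarrow> has_weak_grad \<Omega> u (wgrad \<Omega> u)"
  unfolding wgrad_def by (rule someI[of "has_weak_grad \<Omega> u"])

text \<open>The bridge from the arbitrary choice inside \<open>wgrad\<close> to any concrete
  gradient. Every identity for \<open>wgrad\<close> below is obtained through it and so holds almost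
  everywhere only.\<close>

lemma wgrad_eq_AE:
  "open \<Omega> \<Longrightarrow> has_weak_grad \<Omega> u G \<Longrightarrow> AE x in lebesgue_on \<Omega>. wgrad \<Omega> u x = G x"
  using has_weak_grad_unique has_weak_grad_wgrad by blast

lemma H1_wgrad: "u \<in> H1 \<Omega> \<Longrightarrow> has_weak_grad \<Omega> u (wgrad \<Omega> u)"
  using has_weak_grad_wgrad by (auto simp: H1_def)

lemma H1_L2: "u \<in> H1 \<Omega> \<Longrightarrow> u \<in> L2_space \<Omega>"
  by (simp add: H1_def)

text \<open>\<open>H1\<close> promises that some weak gradient is square integrable, while
  \<open>wgrad\<close> picks an unspecified one; uniqueness transfers the integrability.\<close>

lemma H1_wgrad_L2:
  fixes u :: "'d::finite vector_field"
  assumes "open \<Omega>" "u \<in> H1 \<Omega>"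
  shows "wgrad \<Omega> u \<in> L2_space \<Omega>"
proof -
  obtain G where G: "G \<in> L2_space \<Omega>" "has_weak_grad \<Omega> u G"
    using assms by (auto simp: H1_def)
  show ?thesis
    using assms(1) wgrad_eq_AE[OF assms(1) G(2)]
    by (intro L2_space_cong_AE[OF _ G(1)]) (auto simp: eq_commute lebesgue_openin)
qed

lemma H1_add:
  fixes u v :: "'d::finite vector_field"
  assumes \<Omega>: "open \<Omega>" and u: "u \<in> H1 \<Omega>" and v: "v \<in> H1 \<Omega>"
  shows "(\<lambda>x. u x + v x) \<in> H1 \<Omega>"
    and "AE x in lebesgue_on \<Omega>. wgrad \<Omega> (\<lambda>x. u x + v x) x = wgrad \<Omega> u x + wgrad \<Omega> v x"
proof -
  have *: "has_weak_grad \<Omega> (\<lambda>x. u x + v x) (\<lambda>x. wgrad \<Omega> u x + wgrad \<Omega> v x)"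
    using \<Omega> by (intro has_weak_grad_add H1_wgrad u v) (auto simp: lebesgue_openin)
  then show "(\<lambda>x. u x + v x) \<in> H1 \<Omega>"
    using L2_add[OF H1_wgrad_L2[OF \<Omega> u] H1_wgrad_L2[OF \<Omega> v]] L2_add[OF H1_L2[OF u] H1_L2[OF v]]
    by (auto simp: H1_def)
  show "AE x in lebesgue_on \<Omega>. wgrad \<Omega> (\<lambda>x. u x + v x) x = wgrad \<Omega> u x + wgrad \<Omega> v x"
    by (rule wgrad_eq_AE[OF \<Omega> *])
qed

lemma H1_scaleR:
  fixes u :: "'d::finite vector_field"
  assumes \<Omega>: "open \<Omega>" and u: "u \<in> H1 \<Omega>"
  shows "(\<lambda>x. r *\<^sub>R u x) \<in> H1 \<Omega>"
    and "AE x in lebesgue_on \<Omega>. wgrad \<Omega> (\<lambda>x. r *\<^sub>R u x) x = r *\<^sub>R wgrad \<Omega> u x"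
proof -
  have *: "has_weak_grad \<Omega> (\<lambda>x. r *\<^sub>R u x) (\<lambda>x. r *\<^sub>R wgrad \<Omega> u x)"
    by (intro has_weak_grad_scaleR H1_wgrad u)
  then show "(\<lambda>x. r *\<^sub>R u x) \<in> H1 \<Omega>"
    using L2_scaleR[OF H1_wgrad_L2[OF \<Omega> u]] L2_scaleR[OF H1_L2[OF u]]
    by (auto simp: H1_def)
  show "AE x in lebesgue_on \<Omega>. wgrad \<Omega> (\<lambda>x. r *\<^sub>R u x) x = r *\<^sub>R wgrad \<Omega> u x"
    by (rule wgrad_eq_AE[OF \<Omega> *])
qed

lemma H1_diff:
  fixes u v :: "'d::finite vector_field"
  assumes \<Omega>: "open \<Omega>" and u: "u \<in> H1 \<Omega>" and v: "v \<in> H1 \<Omega>"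
  shows "(\<lambda>x. u x - v x) \<in> H1 \<Omega>"
    and "AE x in lebesgue_on \<Omega>. wgrad \<Omega> (\<lambda>x. u x - v x) x = wgrad \<Omega> u x - wgrad \<Omega> v x"
proof -
  show "(\<lambda>x. u x - v x) \<in> H1 \<Omega>"
    using H1_add(1)[OF \<Omega> u H1_scaleR(1)[OF \<Omega> v, of "-1"]] by simp
  show "AE x in lebesgue_on \<Omega>. wgrad \<Omega> (\<lambda>x. u x - v x) x = wgrad \<Omega> u x - wgrad \<Omega> v x"
    using H1_add(2)[OF \<Omega> u H1_scaleR(1)[OF \<Omega> v, of "-1"]] H1_scaleR(2)[OF \<Omega> v, of "-1"]
    by eventually_elim simp
qed

section \<open>Integration by parts and the Friedrichs inequality\<close>

lemma continuous_compact_support_bounded: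
  fixes f :: "'a::metric_space \<Rightarrow> 'b::real_normed_vector"
  assumes "continuous_on UNIV f" "compact K" "\<And>x. x \<notin> K \<Longrightarrow> f x = 0"
  obtains B where "B \<ge> 0" "\<And>x. norm (f x) \<le> B"
proof -
  have "bounded (f ` K)"
    using assms continuous_on_subset by (blast intro: compact_imp_bounded compact_continuous_image)
  then obtain B where "B > 0" "\<And>x. x \<in> K \<Longrightarrow> norm (f x) \<le> B"
    by (auto simp: bounded_pos)
  then show ?thesis
    using assms(3) by (intro that[of B]) (auto, metis less_le_not_le linear norm_zero)
qed

lemma integrable_compact_support:
  fixes f :: "'a::euclidean_space \<Rightarrow> 'b::euclidean_space"
  assumes f: "continuous_on UNIV f" and K: "compact K" "\<And>x. x \<notin> K \<Longrightarrow> f x = 0"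
  shows "integrable lebesgue f"
proof -
  obtain a where a: "K \<subseteq> cbox (- a) a"
    using bounded_subset_cbox_symmetric[OF compact_imp_bounded[OF K(1)]] by blast
  have "f absolutely_integrable_on cbox (- a) a"
    by (intro absolutely_integrable_continuous continuous_on_subset[OF f] subset_UNIV)
  then have "integrable lebesgue (\<lambda>x. indicator (cbox (- a) a) x *\<^sub>R f x)"
    by (simp add: set_integrable_def)
  moreover have "indicator (cbox (- a) a) x *\<^sub>R f x = f x" for x
    using a K(2)[of x] by (auto simp: indicator_def)
  ultimately show ?thesis by simp
qed

text \<open>Continuity makes \<open>f\<close> Borel measurable, so the integral against the
  completed measure agrees with the one against \<open>lborel\<close>, which is invariant as an
  image measure.\<close>

lemma integral_translate:
  fixes f :: "'a::euclidean_space \<Rightarrow> real"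
  assumes "continuous_on UNIV f"
  shows "(LINT x|lebesgue. f (c + x)) = (LINT x|lebesgue. f x)"
proof -
  have m: "f \<in> borel_measurable borel"
    using assms by (rule borel_measurable_continuous_onI)
  then have "(LINT x|lebesgue. f x) = (LINT x|distr lborel borel ((+) c). f x)"
    by (simp add: integral_completion lborel_distr_plus)
  also have "\<dots> = (LINT x|lborel. f (c + x))"
    using m by (simp add: integral_distr)
  also have "\<dots> = (LINT x|lebesgue. f (c + x))"
    using measurable_compose[OF _ m, of "(+) c" borel] by (intro integral_completion[symmetric]) simp
  finally show ?thesis ..
qed

text \<open>Difference quotients integrate to zero by translation invariance.\<close>

lemma integral_directional_derivative_eq_0:
  fixes \<psi> :: "'a::euclidean_space \<Rightarrow> real"
  assumes D: "\<And>x. (\<psi> has_derivative D x) (at x)" and cont: "continuous_on UNIV (\<lambda>x. D x v)"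
    and K: "compact K" "\<And>x. x \<notin> K \<Longrightarrow> \<psi> x = 0"
  shows "integrable lebesgue (\<lambda>x. D x v)" "(LINT x|lebesgue. D x v) = 0"
proof -
  have D0: "D x v = 0" if "x \<notin> K" for x
    using has_derivative_unique[OF D has_derivative_outside[of K \<psi> x, OF compact_imp_closed[OF K(1)] K(2) that]]
    by simp
  show "integrable lebesgue (\<lambda>x. D x v)"
    using cont K(1) D0 by (rule integrable_compact_support)
  have \<psi>: "continuous_on UNIV \<psi>"
    using D by (meson has_derivative_continuous continuous_at_imp_continuous_on)
  obtain B where B: "B \<ge> 0" "\<And>x. norm (D x v) \<le> B"
    using continuous_compact_support_bounded[OF cont K(1) D0] by blast
  obtain r where r: "\<And>x. x \<in> K \<Longrightarrow> norm x \<le> r"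
    using compact_imp_bounded[OF K(1)] by (auto simp: bounded_iff)
  define h where "h = (\<lambda>n. inverse (real (Suc n)))"
  have h: "0 < h n" "h n \<le> 1" for n
    by (auto simp: h_def divide_simps)
  define q where "q = (\<lambda>n x. (\<psi> (h n *\<^sub>R v + x) - \<psi> x) / h n)"
  have line: "((\<lambda>t. \<psi> (t *\<^sub>R v + x)) has_real_derivative D (t *\<^sub>R v + x) v) (at t)" for t x
  proof -
    have "((\<lambda>t. t *\<^sub>R v + x) has_derivative (\<lambda>s. s *\<^sub>R v)) (at t)"
      by (auto intro!: derivative_eq_intros)
    from has_derivative_compose[OF this D]
    have "((\<lambda>t. \<psi> (t *\<^sub>R v + x)) has_derivative (\<lambda>s. D (t *\<^sub>R v + x) (s *\<^sub>R v))) (at t)" .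
    moreover have "D (t *\<^sub>R v + x) (s *\<^sub>R v) = s * D (t *\<^sub>R v + x) v" for s
      using linear_scale[OF has_derivative_linear[OF D]] by simp
    ultimately show ?thesis
      by (simp add: has_field_derivative_def mult.commute[of _ "D (t *\<^sub>R v + x) v"])
  qed
  \<comment> \<open>The dominating function: by the mean value theorem a quotient is a value of the
    derivative, and since the steps are at most 1, all quotients vanish outside the ball around the
    support enlarged by the length of \<open>v\<close>.\<close>
  have q_bound: "norm (q n x) \<le> B * indicator (cball 0 (r + norm v)) x" for n x
  proof (cases "x \<in> cball 0 (r + norm v)")
    case True
    obtain z where "\<psi> (h n *\<^sub>R v + x) - \<psi> (0 *\<^sub>R v + x) = (h n - 0) * D (z *\<^sub>R v + x) v"
      using MVT2[of 0 "h n" "\<lambda>t. \<psi> (t *\<^sub>R v + x)" "\<lambda>t. D (t *\<^sub>R v + x) v"] h(1)[of n] line by auto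
    then have "q n x = D (z *\<^sub>R v + x) v"
      using h(1)[of n] by (simp add: q_def)
    then show ?thesis using B True by simp
  next
    case False
    have "norm (h n *\<^sub>R v) \<le> norm v"
      using h[of n] by (simp add: mult_left_le_one_le)
    then have "norm x \<le> norm (h n *\<^sub>R v + x) + norm v"
      using norm_triangle_ineq4[of "h n *\<^sub>R v + x" "h n *\<^sub>R v"] by simp
    moreover have "norm x > r + norm v" using False by simp
    ultimately have "\<not> norm x \<le> r" "\<not> norm (h n *\<^sub>R v + x) \<le> r"
      using norm_ge_zero[of v] by linarith+
    then have "x \<notin> K" "h n *\<^sub>R v + x \<notin> K"
      using r by blast+
    then show ?thesis using K(2) False by (simp add: q_def)
  qed
  have q_int: "(LINT x|lebesgue. q n x) = 0" for n
  proof -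
    have *: "integrable lebesgue \<psi>"
      using \<psi> K by (rule integrable_compact_support)
    have "integrable lebesgue (\<lambda>x. \<psi> (h n *\<^sub>R v + x))"
    proof (rule integrable_compact_support)
      show "continuous_on UNIV (\<lambda>x. \<psi> (h n *\<^sub>R v + x))"
        by (rule continuous_on_compose2[OF \<psi>]) (auto intro!: continuous_intros)
      show "compact ((+) (- (h n *\<^sub>R v)) ` K)"
        using K(1) by (rule compact_translation)
      show "\<psi> (h n *\<^sub>R v + x) = 0" if "x \<notin> (+) (- (h n *\<^sub>R v)) ` K" for x
      proof (rule K(2), rule notI)
        assume "h n *\<^sub>R v + x \<in> K"
        then have "- (h n *\<^sub>R v) + (h n *\<^sub>R v + x) \<in> (+) (- (h n *\<^sub>R v)) ` K" by (rule imageI)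
        then show False using that by simp
      qed
    qed
    with * show ?thesis
      using integral_translate[OF \<psi>, of "h n *\<^sub>R v"] by (simp add: q_def)
  qed
  have "(\<lambda>n. LINT x|lebesgue. q n x) \<longlonglongrightarrow> (LINT x|lebesgue. D x v)"
  proof (rule integral_dominated_convergence[where w="\<lambda>x. B * indicator (cball 0 (r + norm v)) x"])
    show "(\<lambda>x. D x v) \<in> borel_measurable lebesgue"
      using borel_measurable_continuous_onI[OF cont] by (simp add: measurable_completion)
    have "continuous_on UNIV (q n)" for n
      unfolding q_def using h(1)[of n]
      by (auto intro!: continuous_intros \<psi> continuous_on_compose2[OF \<psi>])
    then show "q n \<in> borel_measurable lebesgue" for n
      by (simp add: measurable_completion borel_measurable_continuous_onI)
    show "integrable lebesgue (\<lambda>x. B * indicator (cball 0 (r + norm v)) x)"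
      by (intro integrable_mult_right) (simp flip: lmeasurable_iff_integrable)
    show "AE x in lebesgue. (\<lambda>n. q n x) \<longlonglongrightarrow> D x v"
    proof (rule AE_I2)
      fix x
      have "((\<lambda>t. (\<psi> ((0 + t) *\<^sub>R v + x) - \<psi> (0 *\<^sub>R v + x)) / t) \<longlongrightarrow> D (0 *\<^sub>R v + x) v) (at 0)"
        using line[of x 0] unfolding DERIV_def .
      moreover have "filterlim h (at 0) sequentially"
        unfolding h_def using LIMSEQ_inverse_real_of_nat by (intro filterlim_atI) auto
      ultimately show "(\<lambda>n. q n x) \<longlonglongrightarrow> D x v"
        unfolding q_def by (auto dest: filterlim_compose)
    qed
    show "AE x in lebesgue. norm (q n x) \<le> B * indicator (cball 0 (r + norm v)) x" for n
      by (intro AE_I2 q_bound)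
  qed
  then show "(LINT x|lebesgue. D x v) = 0"
    by (simp add: q_int LIMSEQ_const_iff)
qed

lemma lebesgue_on_integral_eq:
  fixes f :: "'a::euclidean_space \<Rightarrow> real"
  assumes "\<Omega> \<in> sets lebesgue" "\<And>x. x \<notin> \<Omega> \<Longrightarrow> f x = 0"
  shows "(LINT x|lebesgue_on \<Omega>. f x) = (LINT x|lebesgue. f x)"
proof -
  have "(LINT x|lebesgue_on \<Omega>. f x) = (LINT x|lebesgue. indicator \<Omega> x *\<^sub>R f x)"
    using assms(1) by (intro integral_restrict_space) simp
  also have "\<dots> = (LINT x|lebesgue. f x)"
    using assms(2) by (intro Bochner_Integration.integral_cong refl) (auto simp: indicator_def)
  finally show ?thesis .
qed

lemma test_function_has_derivative:
  "\<phi> \<in> test_functions \<Omega> \<Longrightarrow> (\<phi> has_derivative frechet_derivative \<phi> (at x)) (at x)"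
  using test_functions_differentiable by (auto simp flip: frechet_derivative_works)

text \<open>The product of the two functions is again a test function, so its partial derivative
  integrates to zero; the Leibniz rule splits that integral.\<close>

lemma test_function_integration_by_parts:
  assumes \<Omega>: "\<Omega> \<in> sets lebesgue" and \<phi>: "\<phi> \<in> test_functions \<Omega>" and \<psi>: "\<psi> \<in> test_functions \<Omega>"
  shows "(LINT x|lebesgue_on \<Omega>. \<phi> x * partial_deriv j \<psi> x) = - (LINT x|lebesgue_on \<Omega>. partial_deriv j \<phi> x * \<psi> x)"
proof -
  have prod: "(\<lambda>x. \<phi> x * \<psi> x) \<in> test_functions \<Omega>"
    using test_functions_mult[OF \<psi> test_functions_Ck[OF \<phi>]] .
  then obtain K where K: "compact K" "K \<subseteq> \<Omega>" "\<And>x. x \<notin> K \<Longrightarrow> \<phi> x * \<psi> x = 0"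
    by (rule test_functions_support) blast
  note dprod = test_functions_partial_deriv[OF prod, of j]
  have 0: "x \<notin> \<Omega> \<Longrightarrow> partial_deriv j (\<lambda>x. \<phi> x * \<psi> x) x = 0" for x
    using K by (intro partial_deriv_outside[of K]) (auto simp: compact_imp_closed)
  have "(LINT x|lebesgue. frechet_derivative (\<lambda>x. \<phi> x * \<psi> x) (at x) (axis j 1)) = 0"
    using test_functions_continuous[OF dprod, of UNIV] K
    by (intro integral_directional_derivative_eq_0[of "\<lambda>x. \<phi> x * \<psi> x" _ "axis j 1" K]
        test_function_has_derivative[OF prod]) (auto simp: partial_deriv_def[abs_def])
  then have "(LINT x|lebesgue. partial_deriv j (\<lambda>x. \<phi> x * \<psi> x) x) = 0"
    by (simp add: partial_deriv_def)
  then have "0 = (LINT x|lebesgue_on \<Omega>. partial_deriv j (\<lambda>x. \<phi> x * \<psi> x) x)"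
    using lebesgue_on_integral_eq[OF \<Omega> 0] by simp
  also have "\<dots> = (LINT x|lebesgue_on \<Omega>. \<phi> x * partial_deriv j \<psi> x + partial_deriv j \<phi> x * \<psi> x)"
    by (simp add: partial_deriv_mult test_functions_differentiable[OF \<phi>] test_functions_differentiable[OF \<psi>])
  also have "\<dots> = (LINT x|lebesgue_on \<Omega>. \<phi> x * partial_deriv j \<psi> x) + (LINT x|lebesgue_on \<Omega>. partial_deriv j \<phi> x * \<psi> x)"
    using integrable_test_function[OF \<Omega> locally_integrable_continuous test_functions_partial_deriv[OF \<psi>]]
      integrable_test_function[OF \<Omega> locally_integrable_continuous \<psi>]
      test_functions_continuous[OF \<phi>] test_functions_continuous[OF test_functions_partial_deriv[OF \<phi>]]
    by (intro Bochner_Integration.integral_add) blast+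
  finally show ?thesis by simp
qed

section \<open>Test fields and their classical gradients\<close>

definition test_fields :: "(real ^ 'd) set \<Rightarrow> 'd::finite vector_field set" where
  "test_fields \<Omega> = {\<Phi>. \<forall>i. (\<lambda>x. \<Phi> x $ i) \<in> test_functions \<Omega>}"

text \<open>The Jacobian in the index order of \<open>has_weak_grad\<close>, which makes it a weak
  gradient of a test field and a computable substitute for \<open>wgrad\<close>.\<close>

definition cgrad :: "'d::finite vector_field \<Rightarrow> real ^ 'd \<Rightarrow> real ^ 'd ^ 'd" where
  "cgrad \<Phi> x = (\<chi> i j. partial_deriv j (\<lambda>x. \<Phi> x $ i) x)"

lemma test_fieldsD: "\<Phi> \<in> test_fields \<Omega> \<Longrightarrow> (\<lambda>x. \<Phi> x $ i) \<in> test_functions \<Omega>"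
  by (simp add: test_fields_def)

lemma continuous_test_field:
  assumes "\<Phi> \<in> test_fields \<Omega>"
  shows "continuous_on S \<Phi>" "continuous_on S (cgrad \<Phi>)"
proof -
  have "continuous_on S (\<lambda>x. \<chi> i. \<Phi> x $ i)"
    by (intro continuous_on_vec_lambda test_functions_continuous[OF test_fieldsD[OF assms]])
  then show "continuous_on S \<Phi>" by simp
  show "continuous_on S (cgrad \<Phi>)"
    unfolding cgrad_def[abs_def]
    by (intro continuous_on_vec_lambda
        test_functions_continuous[OF test_functions_partial_deriv[OF test_fieldsD[OF assms]]])
qed

lemma has_weak_grad_cgrad:
  assumes \<Omega>: "\<Omega> \<in> sets lebesgue" and \<Phi>: "\<Phi> \<in> test_fields \<Omega>"
  shows "has_weak_grad \<Omega> \<Phi> (cgrad \<Phi>)"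
  unfolding has_weak_grad_def
  using test_function_integration_by_parts[OF \<Omega> test_fieldsD[OF \<Phi>]] continuous_test_field[OF \<Phi>]
  by (auto intro!: locally_integrable_continuous simp: cgrad_def)

lemma test_field_H1:
  assumes \<Omega>: "open \<Omega>" "bounded \<Omega>" and \<Phi>: "\<Phi> \<in> test_fields \<Omega>"
  shows "\<Phi> \<in> H1 \<Omega>" "AE x in lebesgue_on \<Omega>. wgrad \<Omega> \<Phi> x = cgrad \<Phi> x"
    "cgrad \<Phi> \<in> L2_space \<Omega>"
proof -
  have \<Omega>': "\<Omega> \<in> sets lebesgue" using \<Omega> by (simp add: lebesgue_openin)
  note * = has_weak_grad_cgrad[OF \<Omega>' \<Phi>] continuous_test_field[OF \<Phi>]
  show "\<Phi> \<in> H1 \<Omega>" "cgrad \<Phi> \<in> L2_space \<Omega>"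
    using * by (auto simp: H1_def intro!: L2_continuous_bounded \<Omega> \<Omega>')
  show "AE x in lebesgue_on \<Omega>. wgrad \<Omega> \<Phi> x = cgrad \<Phi> x"
    using * \<Omega> by (intro wgrad_eq_AE)
qed

text \<open>
  The one-dimensional Friedrichs inequality in direction \<open>v\<close>, from the identity
  \<open>(\<partial>\<phi>)\<^sup>2 - m\<^sup>2 \<phi>\<^sup>2 = (\<partial>\<phi> - m cot (m\<tau>) \<phi>)\<^sup>2 + \<partial> (m cot (m\<tau>) \<phi>\<^sup>2)\<close> with \<open>m = \<pi> / L\<close>.
\<close>

lemma directional_Friedrichs:
  fixes \<phi> :: "'a::euclidean_space \<Rightarrow> real"
  assumes D: "\<And>x. (\<phi> has_derivative D x) (at x)" and cont: "continuous_on UNIV (\<lambda>x. D x v)"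
    and K: "compact K" "\<And>x. x \<notin> K \<Longrightarrow> \<phi> x = 0"
    and v: "norm v = 1" and slab: "\<And>x. x \<in> K \<Longrightarrow> 0 < (x - x0) \<bullet> v" "\<And>x. x \<in> K \<Longrightarrow> (x - x0) \<bullet> v < L"
    and L: "L > 0"
  shows "(pi / L)\<^sup>2 * (LINT x|lebesgue. (\<phi> x)\<^sup>2) \<le> (LINT x|lebesgue. (D x v)\<^sup>2)"
proof -
  define m where "m = pi / L"
  define \<tau> where "\<tau> = (\<lambda>x. (x - x0) \<bullet> v)"
  define U where "U = {x. 0 < \<tau> x \<and> \<tau> x < L}"
  \<comment> \<open>The candidate for the derivative of \<open>\<psi>\<close>. The cotangent may be
    singular on the boundary of the slab, but \<open>\<psi>\<close> is zero off \<open>K\<close>,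
    which lies in the open slab \<open>U\<close>, so the value 0 outside \<open>U\<close> is
    right.\<close>
  define E where "E = (\<lambda>x h. if x \<in> U then - (m\<^sup>2) * (h \<bullet> v) * inverse ((sin (m * \<tau> x))\<^sup>2) * (\<phi> x)\<^sup>2
      + m * cot (m * \<tau> x) * (2 * \<phi> x * D x h) else 0)"
  define \<psi> where "\<psi> = (\<lambda>x. m * cot (m * \<tau> x) * (\<phi> x)\<^sup>2)"
  have \<phi>: "continuous_on UNIV \<phi>"
    using D by (meson has_derivative_continuous continuous_at_imp_continuous_on)
  have \<tau>: "continuous_on S \<tau>" for S
    unfolding \<tau>_def by (intro continuous_intros)
  have "open U"
    unfolding U_def by (intro open_Collect_conj open_Collect_less \<tau> continuous_intros)
  have "K \<subseteq> U" using slab by (auto simp: U_def \<tau>_def)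
  have D0: "D x = (\<lambda>_. 0)" if "x \<notin> K" for x
    using has_derivative_unique[OF D has_derivative_outside[of K \<phi> x, OF compact_imp_closed[OF K(1)] K(2) that]] .
  have sin_pos: "sin (m * \<tau> x) > 0" if "x \<in> U" for x
  proof (rule sin_gt_zero)
    show "0 < m * \<tau> x" using that L by (simp add: m_def U_def)
    have "m * \<tau> x < m * L"
      using that L by (intro mult_strict_left_mono) (auto simp: m_def U_def)
    then show "m * \<tau> x < pi" using L by (simp add: m_def)
  qed
  have E: "(\<psi> has_derivative E x) (at x)" for x
  proof (cases "x \<in> U")
    case True
    have \<tau>': "((\<lambda>x. m * \<tau> x) has_derivative (\<lambda>h. m * (h \<bullet> v))) (at x)"
      unfolding \<tau>_def by (auto intro!: derivative_eq_intros)
    have "(cot has_derivative (*) (- inverse ((sin (m * \<tau> x))\<^sup>2))) (at (m * \<tau> x))"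
      using DERIV_cot[of "m * \<tau> x"] sin_pos[OF True] by (simp add: has_field_derivative_def)
    from has_derivative_compose[OF \<tau>' this]
    have cot': "((\<lambda>x. cot (m * \<tau> x)) has_derivative
        (\<lambda>h. - inverse ((sin (m * \<tau> x))\<^sup>2) * (m * (h \<bullet> v)))) (at x)" .
    have "E x = (\<lambda>h. m * cot (m * \<tau> x) * (of_nat 2 * D x h * \<phi> x ^ (2 - 1))
        + (m * (- inverse ((sin (m * \<tau> x))\<^sup>2) * (m * (h \<bullet> v)))) * (\<phi> x)\<^sup>2)"
      using True by (simp add: E_def fun_eq_iff power2_eq_square algebra_simps)
    then show ?thesis
      unfolding \<psi>_def
      by (simp only:) (intro has_derivative_mult[OF has_derivative_mult_right[OF cot']] has_derivative_power D)
  next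
    case False
    have "(\<psi> has_derivative (\<lambda>_. 0)) (at x)"
      by (rule has_derivative_transform_within_open[of "\<lambda>_. 0" _ _ _ "- K"])
         (use K \<open>K \<subseteq> U\<close> False compact_imp_closed in \<open>auto simp: \<psi>_def\<close>)
    moreover have "E x = (\<lambda>_. 0)" using False by (simp add: E_def fun_eq_iff)
    ultimately show ?thesis by simp
  qed
  have contE: "continuous_on UNIV (\<lambda>x. E x v)"
  proof -
    have "continuous_on U (\<lambda>x. E x v) \<longleftrightarrow> continuous_on U (\<lambda>x. - (m\<^sup>2) * (v \<bullet> v) * inverse ((sin (m * \<tau> x))\<^sup>2) * (\<phi> x)\<^sup>2
      + m * cot (m * \<tau> x) * (2 * \<phi> x * D x v))"
      by (intro continuous_on_cong) (auto simp: E_def)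
    also have "\<dots>"
      unfolding cot_def using sin_pos
      by (auto intro!: continuous_intros \<tau> continuous_on_subset[OF \<phi>] continuous_on_subset[OF cont]
          simp: less_imp_neq[symmetric])
    finally have 1: "continuous_on U (\<lambda>x. E x v)" .
    have "continuous_on (- K) (\<lambda>x. E x v) \<longleftrightarrow> continuous_on (- K) (\<lambda>x. 0 :: real)"
      using K(2) by (intro continuous_on_cong) (auto simp: E_def)
    then have 2: "continuous_on (- K) (\<lambda>x. E x v)" by simp
    \<comment> \<open>Continuity is glued from two open sets: in the slab the sine has no zero, and
      off \<open>K\<close> everything vanishes.\<close>
    have "U \<union> - K = UNIV" using \<open>K \<subseteq> U\<close> by auto
    then show ?thesis
      using continuous_on_open_Un[OF \<open>open U\<close> _ 1 2] K(1) by (simp add: compact_imp_closed open_Compl)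
  qed
  have \<psi>0: "\<psi> x = 0" if "x \<notin> K" for x
    using K(2)[OF that] by (simp add: \<psi>_def)
  note int = integral_directional_derivative_eq_0[OF E contE K(1) \<psi>0]
  have i1: "integrable lebesgue (\<lambda>x. (\<phi> x)\<^sup>2)"
    by (rule integrable_compact_support[OF _ K(1)]) (auto intro!: continuous_intros \<phi> simp: K(2))
  have i2: "integrable lebesgue (\<lambda>x. (D x v)\<^sup>2)"
    by (rule integrable_compact_support[OF _ K(1)]) (auto intro!: continuous_intros cont simp: D0)
  have "m\<^sup>2 * (\<phi> x)\<^sup>2 + E x v \<le> (D x v)\<^sup>2" for x
  proof (cases "x \<in> U")
    case True
    define s where "s = sin (m * \<tau> x)"
    define k where "k = cos (m * \<tau> x)"
    have "s > 0" and sk: "s\<^sup>2 + k\<^sup>2 = 1" using sin_pos[OF True] by (auto simp: s_def k_def)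
    have "v \<bullet> v = 1" using v by (simp add: norm_eq_sqrt_inner)
    \<comment> \<open>This identity makes -m cot a solution of the Riccati equation z' = m^2 + z^2,
      which is what completes the square.\<close>
    have "inverse (s\<^sup>2) = 1 + (k / s)\<^sup>2"
      using sk \<open>s > 0\<close> by (simp add: field_simps)
    then have "(D x v)\<^sup>2 - m\<^sup>2 * (\<phi> x)\<^sup>2 - E x v = (D x v - m * (k / s) * \<phi> x)\<^sup>2"
      using True \<open>v \<bullet> v = 1\<close>
      by (simp add: E_def cot_def flip: s_def k_def) (simp add: power2_eq_square algebra_simps)
    then show ?thesis using zero_le_power2[of "D x v - m * (k / s) * \<phi> x"] by linarith
  next
    case False
    then have "\<phi> x = 0" using \<open>K \<subseteq> U\<close> K(2)[of x] by blast
    then show ?thesis using False by (simp add: E_def)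
  qed
  then have "(LINT x|lebesgue. m\<^sup>2 * (\<phi> x)\<^sup>2 + E x v) \<le> (LINT x|lebesgue. (D x v)\<^sup>2)"
    using i1 i2 int(1) by (intro integral_mono) auto
  then show ?thesis
    using i1 int by (simp add: m_def)
qed

section \<open>From one direction to all sides of the box\<close>

lemma frechet_derivative_eq_sum_partial_deriv:
  assumes "\<phi> differentiable at x"
  shows "frechet_derivative \<phi> (at x) v = (\<chi> j. partial_deriv j \<phi> x) \<bullet> v"
proof -
  have "linear (frechet_derivative \<phi> (at x))"
    using assms by (rule linear_frechet_derivative)
  then have "frechet_derivative \<phi> (at x) (\<Sum>j\<in>UNIV. v $ j *\<^sub>R axis j 1)
      = (\<Sum>j\<in>UNIV. v $ j * partial_deriv j \<phi> x)"
    by (simp add: linear_sum linear_scale partial_deriv_def)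
  then show ?thesis
    by (simp add: basis_expansion[of v, unfolded scalar_mult_eq_scaleR] inner_vec_def mult.commute)
qed

text \<open>The box need not be parallel to the axes, so gradients are resolved along its edges, the
  rotated basis vectors.\<close>

lemma orthogonal_transformation_Parseval:
  fixes g :: "real ^ 'd" and R :: "real ^ 'd \<Rightarrow> real ^ 'd"
  assumes R: "orthogonal_transformation R"
  shows "(\<Sum>i\<in>UNIV. (g \<bullet> R (axis i 1))\<^sup>2) = (norm g)\<^sup>2"
proof -
  obtain h where h: "g = R h"
    using orthogonal_transformation_surj[OF R] by (metis surjD)
  have "g \<bullet> R (axis i 1) = h $ i" for i
    using R by (simp add: h orthogonal_transformation_def cart_eq_inner_axis)
  moreover have "norm g = norm h"
    using R by (simp add: h orthogonal_transformation_norm)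
  ultimately show ?thesis
    by (simp add: norm_vec_def L2_set_def sum_nonneg)
qed

text \<open>The box is closed but \<Omega> is open: a point of \<Omega> can be moved a little both
  ways along an edge direction without leaving the box. The strict inequalities keep the argument of
  the cotangent off its poles.\<close>

lemma slab_of_box:
  fixes R :: "real ^ 'd \<Rightarrow> real ^ 'd"
  assumes \<Omega>: "open \<Omega>" and R: "orthogonal_transformation R" and sub: "\<Omega> \<subseteq> (\<lambda>x. x0 + R x) ` cbox 0 l"
    and x: "x \<in> \<Omega>"
  shows "0 < (x - x0) \<bullet> R (axis i 1)" "(x - x0) \<bullet> R (axis i 1) < l $ i"
proof -
  have weak: "0 \<le> (z - x0) \<bullet> R (axis i 1)" "(z - x0) \<bullet> R (axis i 1) \<le> l $ i" if z: "z \<in> \<Omega>" for z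
  proof -
    obtain s where "s \<in> cbox 0 l" "z = x0 + R s" using sub z by auto
    then show "0 \<le> (z - x0) \<bullet> R (axis i 1)" "(z - x0) \<bullet> R (axis i 1) \<le> l $ i"
      using R by (auto simp: orthogonal_transformation_def mem_box_cart simp flip: cart_eq_inner_axis)
  qed
  have n: "norm (R (axis i 1)) = 1"
    using R by (simp add: orthogonal_transformation_norm)
  then have n2: "R (axis i 1) \<bullet> R (axis i 1) = 1"
    by (simp add: norm_eq_1)
  obtain e where e: "e > 0" "cball x e \<subseteq> \<Omega>"
    using \<Omega> x open_contains_cball by blast
  have "x - e *\<^sub>R R (axis i 1) \<in> \<Omega>" "x + e *\<^sub>R R (axis i 1) \<in> \<Omega>"
    using e n by (auto intro!: subsetD[OF e(2)] simp: dist_norm)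
  from weak(1)[OF this(1)] weak(2)[OF this(2)]
  show "0 < (x - x0) \<bullet> R (axis i 1)" "(x - x0) \<bullet> R (axis i 1) < l $ i"
    using e n2 by (auto simp: inner_diff_left inner_add_left)
qed

text \<open>One directional inequality for each edge, added up. The factors
  \<open>(pi / l $ i)^2\<close> accumulate to the inverse square of \<open>poincare_const l\<close>,
  and by Parseval the directional derivatives form the full gradient.\<close>

lemma Friedrichs_test_function:
  fixes R :: "real ^ 'd \<Rightarrow> real ^ 'd"
  assumes \<Omega>: "open \<Omega>" and R: "orthogonal_transformation R" and sub: "\<Omega> \<subseteq> (\<lambda>x. x0 + R x) ` cbox 0 l"
    and l: "\<And>i. l $ i > 0" and \<phi>: "\<phi> \<in> test_functions \<Omega>"
  shows "(\<Sum>i\<in>UNIV. (pi / l $ i)\<^sup>2) * (LINT x|lebesgue. (\<phi> x)\<^sup>2)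
    \<le> (LINT x|lebesgue. (norm (\<chi> j. partial_deriv j \<phi> x))\<^sup>2)"
proof -
  obtain K where K: "compact K" "K \<subseteq> \<Omega>" "\<And>x. x \<notin> K \<Longrightarrow> \<phi> x = 0"
    using \<phi> by (rule test_functions_support) blast
  define D where "D = (\<lambda>x v. (\<chi> j. partial_deriv j \<phi> x) \<bullet> v)"
  have "D x = frechet_derivative \<phi> (at x)" for x
    by (rule ext)
       (simp add: D_def frechet_derivative_eq_sum_partial_deriv[OF test_functions_differentiable[OF \<phi>]])
  then have D: "(\<phi> has_derivative D x) (at x)" for x
    using test_function_has_derivative[OF \<phi>] by simp
  have cont: "continuous_on UNIV (\<lambda>x. D x v)" for v
    unfolding D_def by (intro continuous_intros continuous_on_vec_lambda
        test_functions_continuous[OF test_functions_partial_deriv[OF \<phi>]])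
  have D0: "D x v = 0" if "x \<notin> K" for x v
    using partial_deriv_outside[OF compact_imp_closed[OF K(1)] K(3) that]
    by (simp add: D_def inner_vec_def)
  have dir: "(pi / l $ i)\<^sup>2 * (LINT x|lebesgue. (\<phi> x)\<^sup>2) \<le> (LINT x|lebesgue. (D x (R (axis i 1)))\<^sup>2)" for i
    using K l slab_of_box[OF \<Omega> R sub] orthogonal_transformation_norm[OF R]
    by (intro directional_Friedrichs[OF D cont K(1,3), of _ x0]) auto
  have int: "integrable lebesgue (\<lambda>x. (D x (R (axis i 1)))\<^sup>2)" for i
    by (rule integrable_compact_support[OF _ K(1)]) (auto intro!: continuous_intros cont simp: D0)
  have "(\<Sum>i\<in>UNIV. (pi / l $ i)\<^sup>2) * (LINT x|lebesgue. (\<phi> x)\<^sup>2)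
      \<le> (\<Sum>i\<in>UNIV. LINT x|lebesgue. (D x (R (axis i 1)))\<^sup>2)"
    unfolding sum_distrib_right by (intro sum_mono dir)
  also have "\<dots> = (LINT x|lebesgue. (\<Sum>i\<in>UNIV. (D x (R (axis i 1)))\<^sup>2))"
    using int by (intro Bochner_Integration.integral_sum[symmetric]) auto
  also have "\<dots> = (LINT x|lebesgue. (norm (\<chi> j. partial_deriv j \<phi> x))\<^sup>2)"
    unfolding D_def orthogonal_transformation_Parseval[OF R] ..
  finally show ?thesis .
qed

lemma norm_vec_power2: "(norm x)\<^sup>2 = (\<Sum>i\<in>UNIV. (norm (x $ i))\<^sup>2)"
  by (simp add: norm_vec_def L2_set_def sum_nonneg)

lemma poincare_const_power2:
  fixes l :: "real ^ 'd"
  assumes "\<And>i. l $ i > 0"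
  shows "(poincare_const l)\<^sup>2 * (\<Sum>i\<in>UNIV. (pi / l $ i)\<^sup>2) = 1" "poincare_const l > 0"
proof -
  define S where "S = (\<Sum>i\<in>UNIV. 1 / \<bar>l $ i\<bar>\<^sup>2)"
  have "S > 0"
    unfolding S_def using assms less_imp_neq[OF assms] by (intro sum_pos) auto
  have "(S powr (- 1 / 2))\<^sup>2 = S powr (- 1)"
    using \<open>S > 0\<close> by (simp add: power2_eq_square flip: powr_add)
  then have "(S powr (- 1 / 2))\<^sup>2 * S = 1"
    using \<open>S > 0\<close> by (simp add: powr_minus)
  moreover have "(\<Sum>i\<in>UNIV. (pi / l $ i)\<^sup>2) = pi\<^sup>2 * S"
    by (simp add: S_def sum_distrib_left power_divide)
  ultimately show "(poincare_const l)\<^sup>2 * (\<Sum>i\<in>UNIV. (pi / l $ i)\<^sup>2) = 1"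
    unfolding poincare_const_def S_def[symmetric] by (simp add: power_divide)
  show "poincare_const l > 0"
    unfolding poincare_const_def S_def[symmetric] using \<open>S > 0\<close> by simp
qed

lemma Friedrichs_test_field:
  assumes \<Omega>: "open \<Omega>" and box: "in_box_with_sides \<Omega> l" and \<Phi>: "\<Phi> \<in> test_fields \<Omega>"
  shows "L2_norm \<Omega> \<Phi> \<le> poincare_const l * L2_norm \<Omega> (cgrad \<Phi>)"
proof -
  obtain x0 R where l: "\<And>i. l $ i > 0" and R: "orthogonal_transformation R"
    and sub: "\<Omega> \<subseteq> (\<lambda>x. x0 + R x) ` cbox 0 l"
    using box by (auto simp: in_box_with_sides_def)
  have \<Omega>': "\<Omega> \<in> sets lebesgue" using \<Omega> by (simp add: lebesgue_openin)
  define P where "P = (\<Sum>i\<in>UNIV. (pi / l $ i)\<^sup>2)"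
  have supp: "\<exists>K. compact K \<and> K \<subseteq> \<Omega> \<and> (\<forall>x. x \<notin> K \<longrightarrow> \<Phi> x $ i = 0)" for i
    using test_functions_support[OF test_fieldsD[OF \<Phi>, of i]] by metis
  have i1: "integrable lebesgue (\<lambda>x. (\<Phi> x $ i)\<^sup>2)" for i
  proof -
    obtain K where K: "compact K" "\<forall>x. x \<notin> K \<longrightarrow> \<Phi> x $ i = 0" using supp[of i] by blast
    then show ?thesis
      by (intro integrable_compact_support[OF _ K(1)])
         (auto intro!: continuous_intros test_functions_continuous[OF test_fieldsD[OF \<Phi>]])
  qed
  have grad0: "cgrad \<Phi> x $ i = 0" if "closed K" "\<forall>x. x \<notin> K \<longrightarrow> \<Phi> x $ i = 0" "x \<notin> K" for x i K
    using partial_deriv_outside[of K "\<lambda>x. \<Phi> x $ i" x] that by (simp add: cgrad_def vec_eq_iff)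
  have i2: "integrable lebesgue (\<lambda>x. (norm (cgrad \<Phi> x $ i))\<^sup>2)" for i
  proof -
    obtain K where K: "compact K" "\<forall>x. x \<notin> K \<longrightarrow> \<Phi> x $ i = 0" using supp[of i] by blast
    then show ?thesis
      using grad0[OF compact_imp_closed[OF K(1)] K(2)]
      by (intro integrable_compact_support[OF _ K(1)])
         (auto intro!: continuous_intros continuous_on_component continuous_test_field(2)[OF \<Phi>])
  qed
  have out: "\<Phi> x = 0" "cgrad \<Phi> x = 0" if "x \<notin> \<Omega>" for x
  proof -
    have "\<Phi> x $ i = 0 \<and> cgrad \<Phi> x $ i = 0" for i
      using supp[of i] that grad0 by (metis compact_imp_closed subsetD)
    then show "\<Phi> x = 0" "cgrad \<Phi> x = 0" by (auto simp: vec_eq_iff)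
  qed
  have n1: "(L2_norm \<Omega> \<Phi>)\<^sup>2 = (\<Sum>i\<in>UNIV. LINT x|lebesgue. (\<Phi> x $ i)\<^sup>2)"
  proof -
    have "(L2_norm \<Omega> \<Phi>)\<^sup>2 = (LINT x|lebesgue. (norm (\<Phi> x))\<^sup>2)"
      using out by (simp add: L2_norm_def lebesgue_on_integral_eq[OF \<Omega>'])
    also have "\<dots> = (\<Sum>i\<in>UNIV. LINT x|lebesgue. (\<Phi> x $ i)\<^sup>2)"
      unfolding norm_vec_power2 using i1 by (simp add: Bochner_Integration.integral_sum)
    finally show ?thesis .
  qed
  have n2: "(L2_norm \<Omega> (cgrad \<Phi>))\<^sup>2 = (\<Sum>i\<in>UNIV. LINT x|lebesgue. (norm (cgrad \<Phi> x $ i))\<^sup>2)"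
  proof -
    have "(L2_norm \<Omega> (cgrad \<Phi>))\<^sup>2 = (LINT x|lebesgue. (norm (cgrad \<Phi> x))\<^sup>2)"
      using out by (simp add: L2_norm_def lebesgue_on_integral_eq[OF \<Omega>'])
    also have "\<dots> = (\<Sum>i\<in>UNIV. LINT x|lebesgue. (norm (cgrad \<Phi> x $ i))\<^sup>2)"
      unfolding norm_vec_power2[of "cgrad \<Phi> _"] using i2 by (intro Bochner_Integration.integral_sum) auto
    finally show ?thesis .
  qed
  have "P * (L2_norm \<Omega> \<Phi>)\<^sup>2 \<le> (L2_norm \<Omega> (cgrad \<Phi>))\<^sup>2"
    unfolding n1 n2 sum_distrib_left P_def
    using Friedrichs_test_function[OF \<Omega> R sub l test_fieldsD[OF \<Phi>]]
    by (intro sum_mono) (simp add: cgrad_def)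
  then have "(poincare_const l)\<^sup>2 * (P * (L2_norm \<Omega> \<Phi>)\<^sup>2) \<le> (poincare_const l * L2_norm \<Omega> (cgrad \<Phi>))\<^sup>2"
    unfolding power_mult_distrib by (intro mult_left_mono) auto
  then have "(L2_norm \<Omega> \<Phi>)\<^sup>2 \<le> (poincare_const l * L2_norm \<Omega> (cgrad \<Phi>))\<^sup>2"
    using poincare_const_power2(1)[OF l] by (simp add: P_def flip: mult.assoc)
  then show ?thesis
    using poincare_const_power2(2)[OF l] L2_norm_nonneg[of \<Omega>]
    by (meson less_imp_le mult_nonneg_nonneg power2_le_imp_le)
qed

section \<open>The space $H^1_0$\<close>

lemma test_fields_add: "\<Phi> \<in> test_fields \<Omega> \<Longrightarrow> \<Psi> \<in> test_fields \<Omega> \<Longrightarrow> (\<lambda>x. \<Phi> x + \<Psi> x) \<in> test_fields \<Omega>"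
  by (simp add: test_fields_def test_functions_add)

lemma test_fields_scaleR: "\<Phi> \<in> test_fields \<Omega> \<Longrightarrow> (\<lambda>x. r *\<^sub>R \<Phi> x) \<in> test_fields \<Omega>"
  by (simp add: test_fields_def test_functions_scale)

lemma cgrad_add:
  assumes "\<Phi> \<in> test_fields \<Omega>" "\<Psi> \<in> test_fields \<Omega>"
  shows "cgrad (\<lambda>x. \<Phi> x + \<Psi> x) x = cgrad \<Phi> x + cgrad \<Psi> x"
proof -
  have "partial_deriv j (\<lambda>x. \<Phi> x $ i + \<Psi> x $ i) x
      = partial_deriv j (\<lambda>x. \<Phi> x $ i) x + partial_deriv j (\<lambda>x. \<Psi> x $ i) x" for i j
    by (intro partial_deriv_add test_functions_differentiable[OF test_fieldsD[OF assms(1)]]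
        test_functions_differentiable[OF test_fieldsD[OF assms(2)]])
  then show ?thesis by (simp add: cgrad_def vec_eq_iff)
qed

lemma cgrad_scaleR:
  assumes "\<Phi> \<in> test_fields \<Omega>"
  shows "cgrad (\<lambda>x. r *\<^sub>R \<Phi> x) x = r *\<^sub>R cgrad \<Phi> x"
proof -
  have "partial_deriv j (\<lambda>x. r * \<Phi> x $ i) x = r * partial_deriv j (\<lambda>x. \<Phi> x $ i) x" for i j
    using partial_deriv_mult[of "\<lambda>_. r" x "\<lambda>x. \<Phi> x $ i" j]
      test_functions_differentiable[OF test_fieldsD[OF assms]]
    by (simp add: partial_deriv_def)
  then show ?thesis by (simp add: cgrad_def vec_eq_iff)
qed

lemma H10_H1: "u \<in> H10 \<Omega> \<Longrightarrow> u \<in> H1 \<Omega>"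
  by (simp add: H10_def)

text \<open>The definition of \<open>H10\<close> involves the chosen gradient of every single
  difference. Here it is expressed by one fixed gradient of \<open>u\<close> and classical
  gradients, a form in which limits can be taken.\<close>

lemma H1_norm_diff_test_field:
  fixes u :: "'d::finite vector_field"
  assumes \<Omega>: "open \<Omega>" "bounded \<Omega>" and u: "u \<in> H1 \<Omega>" and \<Phi>: "\<Phi> \<in> test_fields \<Omega>"
  shows "(H1_norm \<Omega> (\<lambda>x. u x - \<Phi> x))\<^sup>2
    = (L2_norm \<Omega> (\<lambda>x. u x - \<Phi> x))\<^sup>2 + (L2_norm \<Omega> (\<lambda>x. wgrad \<Omega> u x - cgrad \<Phi> x))\<^sup>2"
proof -
  note \<Phi>' = test_field_H1[OF \<Omega> \<Phi>]
  have "L2_norm \<Omega> (wgrad \<Omega> (\<lambda>x. u x - \<Phi> x)) = L2_norm \<Omega> (\<lambda>x. wgrad \<Omega> u x - cgrad \<Phi> x)"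
  proof (rule L2_norm_cong_AE)
    show "wgrad \<Omega> (\<lambda>x. u x - \<Phi> x) \<in> L2_space \<Omega>"
      by (intro H1_wgrad_L2 H1_diff \<Omega> u \<Phi>')
    show "AE x in lebesgue_on \<Omega>. wgrad \<Omega> (\<lambda>x. u x - \<Phi> x) x = wgrad \<Omega> u x - cgrad \<Phi> x"
      using H1_diff(2)[OF \<Omega>(1) u \<Phi>'(1)] \<Phi>'(2) by eventually_elim simp
  qed (use \<Omega> in \<open>simp add: lebesgue_openin\<close>)
  then show ?thesis by (simp add: H1_norm_def)
qed

lemma H10_approx:
  fixes u :: "'d::finite vector_field"
  assumes \<Omega>: "open \<Omega>" "bounded \<Omega>" and u: "u \<in> H10 \<Omega>"
  obtains \<Phi> where "\<And>n::nat. \<Phi> n \<in> test_fields \<Omega>" "(\<lambda>n. L2_norm \<Omega> (\<lambda>x. u x - \<Phi> n x)) \<longlonglongrightarrow> 0"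
    "(\<lambda>n. L2_norm \<Omega> (\<lambda>x. wgrad \<Omega> u x - cgrad (\<Phi> n) x)) \<longlonglongrightarrow> 0"
proof -
  obtain \<Phi> where \<Phi>: "\<And>n::nat. \<Phi> n \<in> test_fields \<Omega>" and lim: "(\<lambda>n. H1_norm \<Omega> (\<lambda>x. u x - \<Phi> n x)) \<longlonglongrightarrow> 0"
    using u by (auto simp: H10_def test_fields_def)
  note eq = H1_norm_diff_test_field[OF \<Omega> H10_H1[OF u] \<Phi>]
  have nonneg: "0 \<le> H1_norm \<Omega> v" for v by (simp add: H1_norm_def)
  have "L2_norm \<Omega> (\<lambda>x. u x - \<Phi> n x) \<le> H1_norm \<Omega> (\<lambda>x. u x - \<Phi> n x)"
    "L2_norm \<Omega> (\<lambda>x. wgrad \<Omega> u x - cgrad (\<Phi> n) x) \<le> H1_norm \<Omega> (\<lambda>x. u x - \<Phi> n x)" for n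
    by (rule power2_le_imp_le[OF _ nonneg], simp add: eq)+
  then have "(\<lambda>n. L2_norm \<Omega> (\<lambda>x. u x - \<Phi> n x)) \<longlonglongrightarrow> 0"
    "(\<lambda>n. L2_norm \<Omega> (\<lambda>x. wgrad \<Omega> u x - cgrad (\<Phi> n) x)) \<longlonglongrightarrow> 0"
    by (auto intro!: tendsto_sandwich[OF _ _ tendsto_const lim] simp: L2_norm_nonneg)
  with \<Phi> show ?thesis by (rule that)
qed

text \<open>Converse of \<open>H10_approx\<close>; the closure of \<open>H10\<close> under linear
  operations is proved by passing through this pair.\<close>

lemma H10I:
  fixes u :: "'d::finite vector_field"
  assumes \<Omega>: "open \<Omega>" "bounded \<Omega>" and u: "u \<in> H1 \<Omega>" and \<Phi>: "\<And>n::nat. \<Phi> n \<in> test_fields \<Omega>"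
    and lim: "(\<lambda>n. L2_norm \<Omega> (\<lambda>x. u x - \<Phi> n x)) \<longlonglongrightarrow> 0"
      "(\<lambda>n. L2_norm \<Omega> (\<lambda>x. wgrad \<Omega> u x - cgrad (\<Phi> n) x)) \<longlonglongrightarrow> 0"
  shows "u \<in> H10 \<Omega>"
proof -
  have "(\<lambda>n. (H1_norm \<Omega> (\<lambda>x. u x - \<Phi> n x))\<^sup>2) \<longlonglongrightarrow> 0\<^sup>2 + 0\<^sup>2"
    unfolding H1_norm_diff_test_field[OF \<Omega> u \<Phi>] by (intro tendsto_intros lim)
  then have "(\<lambda>n. sqrt ((H1_norm \<Omega> (\<lambda>x. u x - \<Phi> n x))\<^sup>2)) \<longlonglongrightarrow> sqrt 0"
    by (intro tendsto_real_sqrt) simp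
  moreover have "0 \<le> H1_norm \<Omega> v" for v by (simp add: H1_norm_def)
  ultimately show ?thesis
    using u \<Phi> by (auto simp: H10_def test_fields_def)
qed

lemma L2_norm_tendsto_0_add:
  assumes L2: "u \<in> L2_space S" "v \<in> L2_space S" "\<And>n. U n \<in> L2_space S" "\<And>n. V n \<in> L2_space S"
    and U: "(\<lambda>n. L2_norm S (\<lambda>x. u x - U n x)) \<longlonglongrightarrow> 0"
    and V: "(\<lambda>n. L2_norm S (\<lambda>x. v x - V n x)) \<longlonglongrightarrow> 0"
  shows "(\<lambda>n. L2_norm S (\<lambda>x. (u x + v x) - (U n x + V n x))) \<longlonglongrightarrow> 0"
proof (rule tendsto_sandwich[OF _ _ tendsto_const])
  have "L2_norm S (\<lambda>x. (u x + v x) - (U n x + V n x))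
      \<le> L2_norm S (\<lambda>x. u x - U n x) + L2_norm S (\<lambda>x. v x - V n x)" for n
    using L2_norm_triangle[OF L2_diff[OF L2(1) L2(3)[of n]] L2_diff[OF L2(2) L2(4)[of n]]]
    by (simp add: algebra_simps)
  then show "\<forall>\<^sub>F n in sequentially. L2_norm S (\<lambda>x. (u x + v x) - (U n x + V n x))
      \<le> L2_norm S (\<lambda>x. u x - U n x) + L2_norm S (\<lambda>x. v x - V n x)" by simp
  show "(\<lambda>n. L2_norm S (\<lambda>x. u x - U n x) + L2_norm S (\<lambda>x. v x - V n x)) \<longlonglongrightarrow> 0"
    using tendsto_add[OF U V] by simp
qed (simp add: L2_norm_nonneg)

lemma H10_add:
  fixes u v :: "'d::finite vector_field"
  assumes \<Omega>: "open \<Omega>" "bounded \<Omega>" and u: "u \<in> H10 \<Omega>" and v: "v \<in> H10 \<Omega>"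
  shows "(\<lambda>x. u x + v x) \<in> H10 \<Omega>"
proof -
  have \<Omega>': "\<Omega> \<in> sets lebesgue" using \<Omega> by (simp add: lebesgue_openin)
  obtain \<Phi> where \<Phi>: "\<And>n::nat. \<Phi> n \<in> test_fields \<Omega>" "(\<lambda>n. L2_norm \<Omega> (\<lambda>x. u x - \<Phi> n x)) \<longlonglongrightarrow> 0"
    "(\<lambda>n. L2_norm \<Omega> (\<lambda>x. wgrad \<Omega> u x - cgrad (\<Phi> n) x)) \<longlonglongrightarrow> 0"
    using H10_approx[OF \<Omega> u] by blast
  obtain \<Psi> where \<Psi>: "\<And>n::nat. \<Psi> n \<in> test_fields \<Omega>" "(\<lambda>n. L2_norm \<Omega> (\<lambda>x. v x - \<Psi> n x)) \<longlonglongrightarrow> 0"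
    "(\<lambda>n. L2_norm \<Omega> (\<lambda>x. wgrad \<Omega> v x - cgrad (\<Psi> n) x)) \<longlonglongrightarrow> 0"
    using H10_approx[OF \<Omega> v] by blast
  note u1 = H10_H1[OF u] and v1 = H10_H1[OF v]
  note \<Phi>1 = test_field_H1[OF \<Omega> \<Phi>(1)] and \<Psi>1 = test_field_H1[OF \<Omega> \<Psi>(1)]
  show ?thesis
  proof (rule H10I[OF \<Omega> H1_add(1)[OF \<Omega>(1) u1 v1], of "\<lambda>n x. \<Phi> n x + \<Psi> n x"])
    show "(\<lambda>x. \<Phi> n x + \<Psi> n x) \<in> test_fields \<Omega>" for n
      by (intro test_fields_add \<Phi> \<Psi>)
    show "(\<lambda>n. L2_norm \<Omega> (\<lambda>x. u x + v x - (\<Phi> n x + \<Psi> n x))) \<longlonglongrightarrow> 0"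
      using \<Phi>(2) \<Psi>(2) by (intro L2_norm_tendsto_0_add H1_L2 u1 v1 \<Phi>1 \<Psi>1)
    have "(\<lambda>n. L2_norm \<Omega> (\<lambda>x. wgrad \<Omega> u x + wgrad \<Omega> v x - (cgrad (\<Phi> n) x + cgrad (\<Psi> n) x))) \<longlonglongrightarrow> 0"
      using \<Phi>(3) \<Psi>(3) by (intro L2_norm_tendsto_0_add H1_wgrad_L2 \<Omega> u1 v1 \<Phi>1 \<Psi>1)
    moreover have "L2_norm \<Omega> (\<lambda>x. wgrad \<Omega> u x + wgrad \<Omega> v x - (cgrad (\<Phi> n) x + cgrad (\<Psi> n) x))
        = L2_norm \<Omega> (\<lambda>x. wgrad \<Omega> (\<lambda>x. u x + v x) x - cgrad (\<lambda>x. \<Phi> n x + \<Psi> n x) x)" for n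
    proof (rule L2_norm_cong_AE[OF \<Omega>'])
      show "(\<lambda>x. wgrad \<Omega> u x + wgrad \<Omega> v x - (cgrad (\<Phi> n) x + cgrad (\<Psi> n) x)) \<in> L2_space \<Omega>"
        by (intro L2_diff L2_add H1_wgrad_L2 \<Omega> u1 v1 \<Phi>1 \<Psi>1)
      show "AE x in lebesgue_on \<Omega>. wgrad \<Omega> u x + wgrad \<Omega> v x - (cgrad (\<Phi> n) x + cgrad (\<Psi> n) x)
          = wgrad \<Omega> (\<lambda>x. u x + v x) x - cgrad (\<lambda>x. \<Phi> n x + \<Psi> n x) x"
        using H1_add(2)[OF \<Omega>(1) u1 v1]
        by eventually_elim (simp add: cgrad_add[OF \<Phi>(1) \<Psi>(1)])
    qed
    ultimately show "(\<lambda>n. L2_norm \<Omega> (\<lambda>x. wgrad \<Omega> (\<lambda>x. u x + v x) x - cgrad (\<lambda>x. \<Phi> n x + \<Psi> n x) x)) \<longlonglongrightarrow> 0"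
      by simp
  qed
qed

lemma H10_scaleR:
  fixes u :: "'d::finite vector_field"
  assumes \<Omega>: "open \<Omega>" "bounded \<Omega>" and u: "u \<in> H10 \<Omega>"
  shows "(\<lambda>x. r *\<^sub>R u x) \<in> H10 \<Omega>"
proof -
  have \<Omega>': "\<Omega> \<in> sets lebesgue" using \<Omega> by (simp add: lebesgue_openin)
  obtain \<Phi> where \<Phi>: "\<And>n::nat. \<Phi> n \<in> test_fields \<Omega>" "(\<lambda>n. L2_norm \<Omega> (\<lambda>x. u x - \<Phi> n x)) \<longlonglongrightarrow> 0"
    "(\<lambda>n. L2_norm \<Omega> (\<lambda>x. wgrad \<Omega> u x - cgrad (\<Phi> n) x)) \<longlonglongrightarrow> 0"
    using H10_approx[OF \<Omega> u] by blast
  note u1 = H10_H1[OF u] and \<Phi>1 = test_field_H1[OF \<Omega> \<Phi>(1)]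
  show ?thesis
  proof (rule H10I[OF \<Omega> H1_scaleR(1)[OF \<Omega>(1) u1], of "\<lambda>n x. r *\<^sub>R \<Phi> n x"])
    show "(\<lambda>x. r *\<^sub>R \<Phi> n x) \<in> test_fields \<Omega>" for n
      by (intro test_fields_scaleR \<Phi>)
    show "(\<lambda>n. L2_norm \<Omega> (\<lambda>x. r *\<^sub>R u x - r *\<^sub>R \<Phi> n x)) \<longlonglongrightarrow> 0"
      using tendsto_mult[OF tendsto_const[of "\<bar>r\<bar>"] \<Phi>(2)]
      by (simp add: L2_norm_scaleR flip: scaleR_diff_right)
    have "L2_norm \<Omega> (\<lambda>x. r *\<^sub>R (wgrad \<Omega> u x - cgrad (\<Phi> n) x))
        = L2_norm \<Omega> (\<lambda>x. wgrad \<Omega> (\<lambda>x. r *\<^sub>R u x) x - cgrad (\<lambda>x. r *\<^sub>R \<Phi> n x) x)" for n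
    proof (rule L2_norm_cong_AE[OF \<Omega>'])
      show "(\<lambda>x. r *\<^sub>R (wgrad \<Omega> u x - cgrad (\<Phi> n) x)) \<in> L2_space \<Omega>"
        by (intro L2_diff L2_scaleR H1_wgrad_L2 \<Omega> u1 \<Phi>1)
      show "AE x in lebesgue_on \<Omega>. r *\<^sub>R (wgrad \<Omega> u x - cgrad (\<Phi> n) x)
          = wgrad \<Omega> (\<lambda>x. r *\<^sub>R u x) x - cgrad (\<lambda>x. r *\<^sub>R \<Phi> n x) x"
        using H1_scaleR(2)[OF \<Omega>(1) u1, of r]
        by eventually_elim (simp add: cgrad_scaleR[OF \<Phi>(1)] scaleR_diff_right)
    qed
    then show "(\<lambda>n. L2_norm \<Omega> (\<lambda>x. wgrad \<Omega> (\<lambda>x. r *\<^sub>R u x) x - cgrad (\<lambda>x. r *\<^sub>R \<Phi> n x) x)) \<longlonglongrightarrow> 0"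
      using tendsto_mult[OF tendsto_const[of "\<bar>r\<bar>"] \<Phi>(3)] by (simp add: L2_norm_scaleR)
  qed
qed

lemma H10_diff:
  fixes u v :: "'d::finite vector_field"
  assumes "open \<Omega>" "bounded \<Omega>" "u \<in> H10 \<Omega>" "v \<in> H10 \<Omega>"
  shows "(\<lambda>x. u x - v x) \<in> H10 \<Omega>"
  using H10_add[OF assms(1-3) H10_scaleR[OF assms(1,2,4), of "-1"]] by simp

lemma L2_norm_tendsto:
  assumes "u \<in> L2_space S" "\<And>n. U n \<in> L2_space S" "(\<lambda>n. L2_norm S (\<lambda>x. u x - U n x)) \<longlonglongrightarrow> 0"
  shows "(\<lambda>n. L2_norm S (U n)) \<longlonglongrightarrow> L2_norm S u"
proof (rule LIM_zero_cancel, rule Lim_null_comparison[OF _ assms(3)])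
  show "\<forall>\<^sub>F n in sequentially. norm (L2_norm S (U n) - L2_norm S u) \<le> L2_norm S (\<lambda>x. u x - U n x)"
    using L2_norm_triangle_diff[OF assms(1,2)] by (simp add: abs_minus_commute)
qed

lemma Friedrichs_H10:
  fixes u :: "'d::finite vector_field"
  assumes \<Omega>: "open \<Omega>" "bounded \<Omega>" and box: "in_box_with_sides \<Omega> l" and u: "u \<in> H10 \<Omega>"
  shows "L2_norm \<Omega> u \<le> poincare_const l * L2_norm \<Omega> (wgrad \<Omega> u)"
proof -
  obtain \<Phi> where \<Phi>: "\<And>n::nat. \<Phi> n \<in> test_fields \<Omega>" "(\<lambda>n. L2_norm \<Omega> (\<lambda>x. u x - \<Phi> n x)) \<longlonglongrightarrow> 0"
    "(\<lambda>n. L2_norm \<Omega> (\<lambda>x. wgrad \<Omega> u x - cgrad (\<Phi> n) x)) \<longlonglongrightarrow> 0"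
    using H10_approx[OF \<Omega> u] by blast
  note u1 = H10_H1[OF u] and \<Phi>1 = test_field_H1[OF \<Omega> \<Phi>(1)]
  have "(\<lambda>n. L2_norm \<Omega> (\<Phi> n)) \<longlonglongrightarrow> L2_norm \<Omega> u"
    using \<Phi>(2) by (intro L2_norm_tendsto H1_L2 u1 \<Phi>1)
  moreover have "(\<lambda>n. poincare_const l * L2_norm \<Omega> (cgrad (\<Phi> n))) \<longlonglongrightarrow> poincare_const l * L2_norm \<Omega> (wgrad \<Omega> u)"
    using \<Phi>(3) by (intro tendsto_intros L2_norm_tendsto H1_wgrad_L2 u1 \<Omega> \<Phi>1)
  ultimately show ?thesis
    using Friedrichs_test_field[OF \<Omega>(1) box \<Phi>(1)] by (rule_tac LIMSEQ_le) auto
qed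

section \<open>Skew symmetry of the advection form\<close>

text \<open>\<open>norm A\<close> is the Frobenius norm, so Cauchy-Schwarz in each row is
  enough.\<close>

lemma norm_matrix_vector_mult_le:
  fixes A :: "real ^ 'n ^ 'm"
  shows "norm (A *v x) \<le> norm A * norm x"
proof (rule power2_le_imp_le)
  have "(norm (A *v x))\<^sup>2 = (\<Sum>i\<in>UNIV. (A $ i \<bullet> x)\<^sup>2)"
    unfolding norm_vec_power2[of "A *v x"] by (simp add: matrix_mult_dot)
  also have "\<dots> \<le> (\<Sum>i\<in>UNIV. (norm (A $ i))\<^sup>2 * (norm x)\<^sup>2)"
    by (intro sum_mono) (metis Cauchy_Schwarz_ineq power2_norm_eq_inner)
  also have "\<dots> = (norm A * norm x)\<^sup>2"
    by (simp add: norm_vec_power2[of A] power_mult_distrib sum_distrib_right)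
  finally show "(norm (A *v x))\<^sup>2 \<le> (norm A * norm x)\<^sup>2" .
qed simp

lemma Linf_norm_AE:
  assumes "c \<in> Linf_space \<Omega>"
  shows "AE x in lebesgue_on \<Omega>. norm (c x) \<le> real_of_ereal (Linf_norm \<Omega> c)"
proof -
  have "AE x in lebesgue_on \<Omega>. ereal (norm (c x)) \<le> Linf_norm \<Omega> c"
    unfolding Linf_norm_def by (rule esssup_AE)
  then show ?thesis
  proof eventually_elim
    case (elim x)
    moreover have "Linf_norm \<Omega> c < \<infinity>" using assms by (simp add: Linf_space_def)
    \<comment> \<open>The value minus infinity, for which \<open>real_of_ereal\<close> would give 0,
      cannot lie above the norm of \<open>c x\<close>.\<close>
    ultimately show ?case by (cases "Linf_norm \<Omega> c") auto
  qed
qed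

text \<open>The absolute value allows the bound to be used before the sign of the essential supremum
  is settled by \<open>Linf_norm_nonneg\<close>.\<close>

lemma L2_matrix_vector_mult:
  fixes G :: "real ^ 'd \<Rightarrow> real ^ 'n ^ 'm"
  assumes G: "G \<in> L2_space \<Omega>" and c: "c \<in> Linf_space \<Omega>"
  shows "(\<lambda>x. G x *v c x) \<in> L2_space \<Omega>"
    "L2_norm \<Omega> (\<lambda>x. G x *v c x) \<le> \<bar>real_of_ereal (Linf_norm \<Omega> c)\<bar> * L2_norm \<Omega> G"
proof -
  define M where "M = \<bar>real_of_ereal (Linf_norm \<Omega> c)\<bar>"
  have cM: "c \<in> borel_measurable (lebesgue_on \<Omega>)" using c by (simp add: Linf_space_def)
  have "continuous_on UNIV (\<lambda>z. fst z *v (snd z :: real ^ 'n) :: real ^ 'm)"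
    unfolding matrix_vector_mult_def
    by (intro continuous_on_vec_lambda continuous_intros)
  then have m: "(\<lambda>x. G x *v c x) \<in> borel_measurable (lebesgue_on \<Omega>)"
    by (rule borel_measurable_continuous_Pair[OF L2_measurable[OF G] cM])
  have bound: "AE x in lebesgue_on \<Omega>. (norm (G x *v c x))\<^sup>2 \<le> M\<^sup>2 * (norm (G x))\<^sup>2"
    using Linf_norm_AE[OF c]
  proof eventually_elim
    case (elim x)
    have "norm (G x *v c x) \<le> norm (G x) * norm (c x)" by (rule norm_matrix_vector_mult_le)
    also have "\<dots> \<le> norm (G x) * M" using elim unfolding M_def by (intro mult_left_mono order.trans[OF _ abs_ge_self]) auto
    finally have "(norm (G x *v c x))\<^sup>2 \<le> (norm (G x) * M)\<^sup>2" by (rule power_mono) simp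
    then show ?case by (simp add: power_mult_distrib mult.commute)
  qed
  have i: "integrable (lebesgue_on \<Omega>) (\<lambda>x. M\<^sup>2 * (norm (G x))\<^sup>2)"
    using L2_integrable[OF G] by simp
  have i2: "integrable (lebesgue_on \<Omega>) (\<lambda>x. (norm (G x *v c x))\<^sup>2)"
    using m bound by (intro Bochner_Integration.integrable_bound[OF i]) auto
  with m show "(\<lambda>x. G x *v c x) \<in> L2_space \<Omega>" by (simp add: L2_space_def)
  have "(LINT x|lebesgue_on \<Omega>. (norm (G x *v c x))\<^sup>2) \<le> (LINT x|lebesgue_on \<Omega>. M\<^sup>2 * (norm (G x))\<^sup>2)"
    using i i2 bound by (rule_tac integral_mono_AE) auto
  then have "L2_norm \<Omega> (\<lambda>x. G x *v c x) \<le> sqrt (M\<^sup>2 * (LINT x|lebesgue_on \<Omega>. (norm (G x))\<^sup>2))"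
    unfolding L2_norm_def by simp
  then show "L2_norm \<Omega> (\<lambda>x. G x *v c x) \<le> \<bar>real_of_ereal (Linf_norm \<Omega> c)\<bar> * L2_norm \<Omega> G"
    by (simp add: real_sqrt_mult L2_norm_def M_def)
qed

lemma partial_deriv_sum_mult:
  assumes "finite I" "\<And>i. i \<in> I \<Longrightarrow> f i differentiable at x" "\<And>i. i \<in> I \<Longrightarrow> g i differentiable at x"
  shows "partial_deriv j (\<lambda>x. \<Sum>i\<in>I. f i x * g i x) x
    = (\<Sum>i\<in>I. f i x * partial_deriv j (g i) x + partial_deriv j (f i) x * g i x)"
proof -
  have "((\<lambda>x. \<Sum>i\<in>I. f i x * g i x) has_derivative
      (\<lambda>h. \<Sum>i\<in>I. f i x * frechet_derivative (g i) (at x) h + frechet_derivative (f i) (at x) h * g i x)) (at x)"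
    using assms(2,3) by (intro has_derivative_sum has_derivative_mult) (auto simp flip: frechet_derivative_works)
  then show ?thesis by (subst partial_deriv_eq) (auto simp: partial_deriv_def)
qed

text \<open>By the product rule both terms together are the integral of c . grad \<psi> for the test
  function \<psi>, the pointwise inner product of the two fields. The weak gradient of
  \<open>c\<close> moves the derivative over, which leaves the divergence of
  \<open>c\<close>.\<close>

lemma advection_skew_test_field:
  fixes c :: "'d::finite vector_field"
  assumes \<Omega>: "open \<Omega>" "bounded \<Omega>" and c: "c \<in> W1inf \<Omega>" and div: "AE x in lebesgue_on \<Omega>. wdiv \<Omega> c x = 0"
    and \<Phi>: "\<Phi> \<in> test_fields \<Omega>" and \<Psi>: "\<Psi> \<in> test_fields \<Omega>"
  shows "L2_inner \<Omega> (\<lambda>x. cgrad \<Phi> x *v c x) \<Psi> + L2_inner \<Omega> (\<lambda>x. cgrad \<Psi> x *v c x) \<Phi> = 0"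
proof -
  have \<Omega>': "\<Omega> \<in> sets lebesgue" using \<Omega> by (simp add: lebesgue_openin)
  have c1: "c \<in> Linf_space \<Omega>" and wc: "has_weak_grad \<Omega> c (wgrad \<Omega> c)"
    using c has_weak_grad_wgrad by (auto simp: W1inf_def)
  define \<psi> where "\<psi> = (\<lambda>x. \<Sum>i\<in>UNIV. \<Phi> x $ i * \<Psi> x $ i)"
  note \<Phi>1 = test_field_H1[OF \<Omega> \<Phi>] and \<Psi>1 = test_field_H1[OF \<Omega> \<Psi>]
  have \<psi>: "\<psi> \<in> test_functions \<Omega>"
  proof -
    have "(\<lambda>x. \<Sum>i\<in>I. \<Phi> x $ i * \<Psi> x $ i) \<in> test_functions \<Omega>" if "finite I" "I \<noteq> {}" for I
      using that
    proof (induction rule: finite_ne_induct)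
      case (singleton i)
      show ?case
        by simp (rule test_functions_mult[OF test_fieldsD[OF \<Psi>] test_functions_Ck[OF test_fieldsD[OF \<Phi>]]])
    next
      case (insert i I)
      then show ?case
        using test_functions_add[OF test_functions_mult[OF test_fieldsD[OF \<Psi>, of i] test_functions_Ck[OF test_fieldsD[OF \<Phi>, of i]]] insert.IH]
        by simp
    qed
    then show ?thesis unfolding \<psi>_def by simp
  qed
  have d: "partial_deriv j \<psi> x = (\<Sum>i\<in>UNIV. \<Phi> x $ i * cgrad \<Psi> x $ i $ j + cgrad \<Phi> x $ i $ j * \<Psi> x $ i)" for j x
    unfolding \<psi>_def cgrad_def
    by (subst partial_deriv_sum_mult)
       (auto intro: test_functions_differentiable[OF test_fieldsD[OF \<Phi>]] test_functions_differentiable[OF test_fieldsD[OF \<Psi>]])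
  have ic: "integrable (lebesgue_on \<Omega>) (\<lambda>x. c x $ j * partial_deriv j \<psi> x)" for j
    using wc by (intro integrable_test_function[OF \<Omega>'] locally_integrable_component test_functions_partial_deriv \<psi>)
      (simp add: has_weak_grad_def)
  have ig: "integrable (lebesgue_on \<Omega>) (\<lambda>x. wgrad \<Omega> c x $ j $ j * \<psi> x)" for j
    using wc by (intro integrable_test_function[OF \<Omega>'] locally_integrable_component \<psi>)
      (simp add: has_weak_grad_def)
  have "L2_inner \<Omega> (\<lambda>x. cgrad \<Phi> x *v c x) \<Psi> + L2_inner \<Omega> (\<lambda>x. cgrad \<Psi> x *v c x) \<Phi>
      = (LINT x|lebesgue_on \<Omega>. (cgrad \<Phi> x *v c x) \<bullet> \<Psi> x + (cgrad \<Psi> x *v c x) \<bullet> \<Phi> x)"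
    unfolding L2_inner_def
    by (intro Bochner_Integration.integral_add[symmetric] L2_integrable_inner L2_matrix_vector_mult c1 \<Phi>1 \<Psi>1 H1_L2)
  also have "\<dots> = (LINT x|lebesgue_on \<Omega>. (\<Sum>j\<in>UNIV. c x $ j * partial_deriv j \<psi> x))"
  proof (rule Bochner_Integration.integral_cong[OF refl])
    fix x
    have "(cgrad \<Phi> x *v c x) \<bullet> \<Psi> x + (cgrad \<Psi> x *v c x) \<bullet> \<Phi> x
        = (\<Sum>i\<in>UNIV. \<Sum>j\<in>UNIV. c x $ j * (\<Phi> x $ i * cgrad \<Psi> x $ i $ j + cgrad \<Phi> x $ i $ j * \<Psi> x $ i))"
      by (simp add: inner_vec_def matrix_vector_mult_def sum_distrib_left sum_distrib_right sum.distrib algebra_simps)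
    also have "\<dots> = (\<Sum>j\<in>UNIV. c x $ j * partial_deriv j \<psi> x)"
      by (subst sum.swap) (simp add: d sum_distrib_left)
    finally show "(cgrad \<Phi> x *v c x) \<bullet> \<Psi> x + (cgrad \<Psi> x *v c x) \<bullet> \<Phi> x = (\<Sum>j\<in>UNIV. c x $ j * partial_deriv j \<psi> x)" .
  qed
  also have "\<dots> = (\<Sum>j\<in>UNIV. LINT x|lebesgue_on \<Omega>. c x $ j * partial_deriv j \<psi> x)"
    by (intro Bochner_Integration.integral_sum ic)
  also have "\<dots> = (\<Sum>j\<in>UNIV. - (LINT x|lebesgue_on \<Omega>. wgrad \<Omega> c x $ j $ j * \<psi> x))"
    using wc \<psi> by (intro sum.cong refl) (simp add: has_weak_grad_def)
  also have "\<dots> = - (LINT x|lebesgue_on \<Omega>. (\<Sum>j\<in>UNIV. wgrad \<Omega> c x $ j $ j * \<psi> x))"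
    using ig by (subst Bochner_Integration.integral_sum) (auto simp: sum_negf)
  also have "(LINT x|lebesgue_on \<Omega>. (\<Sum>j\<in>UNIV. wgrad \<Omega> c x $ j $ j * \<psi> x)) = (LINT x|lebesgue_on \<Omega>. 0)"
  proof (rule integral_cong_AE)
    show "(\<lambda>x. \<Sum>j\<in>UNIV. wgrad \<Omega> c x $ j $ j * \<psi> x) \<in> borel_measurable (lebesgue_on \<Omega>)"
      using ig by (intro borel_measurable_sum) auto
    show "AE x in lebesgue_on \<Omega>. (\<Sum>j\<in>UNIV. wgrad \<Omega> c x $ j $ j * \<psi> x) = 0"
      using div by eventually_elim (simp add: wdiv_def trace_def flip: sum_distrib_right)
  qed simp
  finally show ?thesis by simp
qed

lemma advection_skew:
  fixes c :: "'d::finite vector_field"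
  assumes \<Omega>: "open \<Omega>" "bounded \<Omega>" and c: "c \<in> W1inf \<Omega>" and div: "AE x in lebesgue_on \<Omega>. wdiv \<Omega> c x = 0"
    and u: "u \<in> H10 \<Omega>" and v: "v \<in> H10 \<Omega>"
  shows "L2_inner \<Omega> (\<lambda>x. wgrad \<Omega> u x *v c x) v = - L2_inner \<Omega> (\<lambda>x. wgrad \<Omega> v x *v c x) u"
proof -
  have c1: "c \<in> Linf_space \<Omega>" using c by (simp add: W1inf_def)
  \<comment> \<open>Multiplication by the bounded field \<open>c\<close> preserves L2 convergence of
    gradients, so the identity for test fields survives the limit in both arguments.\<close>
  have conv: "(\<lambda>n. L2_norm \<Omega> (\<lambda>x. G x *v c x - H n x *v c x)) \<longlonglongrightarrow> 0"
    if "G \<in> L2_space \<Omega>" "\<And>n::nat. H n \<in> L2_space \<Omega>" "(\<lambda>n. L2_norm \<Omega> (\<lambda>x. G x - H n x)) \<longlonglongrightarrow> 0"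
    for G and H :: "nat \<Rightarrow> real ^ 'd \<Rightarrow> real ^ 'd ^ 'd"
  proof (rule tendsto_sandwich[OF _ _ tendsto_const])
    show "\<forall>\<^sub>F n in sequentially. L2_norm \<Omega> (\<lambda>x. G x *v c x - H n x *v c x)
        \<le> \<bar>real_of_ereal (Linf_norm \<Omega> c)\<bar> * L2_norm \<Omega> (\<lambda>x. G x - H n x)"
      using L2_matrix_vector_mult(2)[OF L2_diff[OF that(1,2)] c1]
      by (simp add: matrix_vector_mult_diff_rdistrib)
    show "(\<lambda>n. \<bar>real_of_ereal (Linf_norm \<Omega> c)\<bar> * L2_norm \<Omega> (\<lambda>x. G x - H n x)) \<longlonglongrightarrow> 0"
      using tendsto_mult[OF tendsto_const that(3)] by simp
  qed (simp add: L2_norm_nonneg)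
  obtain \<Phi> where \<Phi>: "\<And>n::nat. \<Phi> n \<in> test_fields \<Omega>" "(\<lambda>n. L2_norm \<Omega> (\<lambda>x. u x - \<Phi> n x)) \<longlonglongrightarrow> 0"
    "(\<lambda>n. L2_norm \<Omega> (\<lambda>x. wgrad \<Omega> u x - cgrad (\<Phi> n) x)) \<longlonglongrightarrow> 0"
    using H10_approx[OF \<Omega> u] by blast
  obtain \<Psi> where \<Psi>: "\<And>n::nat. \<Psi> n \<in> test_fields \<Omega>" "(\<lambda>n. L2_norm \<Omega> (\<lambda>x. v x - \<Psi> n x)) \<longlonglongrightarrow> 0"
    "(\<lambda>n. L2_norm \<Omega> (\<lambda>x. wgrad \<Omega> v x - cgrad (\<Psi> n) x)) \<longlonglongrightarrow> 0"
    using H10_approx[OF \<Omega> v] by blast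
  note u1 = H10_H1[OF u] and v1 = H10_H1[OF v]
  note \<Phi>1 = test_field_H1[OF \<Omega> \<Phi>(1)] and \<Psi>1 = test_field_H1[OF \<Omega> \<Psi>(1)]
  have "(\<lambda>n. L2_inner \<Omega> (\<lambda>x. cgrad (\<Phi> n) x *v c x) (\<Psi> n) + L2_inner \<Omega> (\<lambda>x. cgrad (\<Psi> n) x *v c x) (\<Phi> n))
      \<longlonglongrightarrow> L2_inner \<Omega> (\<lambda>x. wgrad \<Omega> u x *v c x) v + L2_inner \<Omega> (\<lambda>x. wgrad \<Omega> v x *v c x) u"
    by (intro tendsto_add L2_inner_tendsto L2_matrix_vector_mult(1) c1 H1_wgrad_L2 H1_L2 \<Omega> u1 v1 \<Phi>1 \<Psi>1
        conv \<Phi>(2,3) \<Psi>(2,3))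
  then show ?thesis
    unfolding advection_skew_test_field[OF \<Omega> c div \<Phi>(1) \<Psi>(1)] by (simp add: LIMSEQ_const_iff)
qed

section \<open>Summation over the mesh\<close>

text \<open>The parametrisation maps a hyperplane of the full space into that same space; it is a
  Lipschitz image of a null set without any drop in dimension.\<close>

lemma negligible_Lipschitz_graph:
  fixes n :: "'a::euclidean_space"
  assumes n: "norm n = 1" and \<gamma>: "L-lipschitz_on {z. z \<bullet> n = 0} (\<gamma> :: 'a \<Rightarrow> real)"
  shows "negligible {y. y \<bullet> n = \<gamma> (y - (y \<bullet> n) *\<^sub>R n)}"
proof -
  have nn: "n \<bullet> n = 1" using n by (simp add: norm_eq_1)
  have "negligible ((\<lambda>z. z + \<gamma> z *\<^sub>R n) ` {z. z \<bullet> n = 0})"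
  proof (rule negligible_locally_Lipschitz_image)
    show "negligible {z. z \<bullet> n = 0}"
      using negligible_hyperplane[of n 0] nn by (force simp: inner_commute)
    show "\<exists>T B. open T \<and> x \<in> T \<and> (\<forall>y\<in>{z. z \<bullet> n = 0} \<inter> T.
        norm (y + \<gamma> y *\<^sub>R n - (x + \<gamma> x *\<^sub>R n)) \<le> B * norm (y - x))" if x: "x \<in> {z. z \<bullet> n = 0}" for x
    proof (intro exI[of _ UNIV] exI[of _ "1 + L"] conjI ballI)
      fix y assume y: "y \<in> {z. z \<bullet> n = 0} \<inter> UNIV"
      have "norm (y + \<gamma> y *\<^sub>R n - (x + \<gamma> x *\<^sub>R n)) = norm ((y - x) + (\<gamma> y - \<gamma> x) *\<^sub>R n)"
        by (simp add: algebra_simps)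
      also have "\<dots> \<le> norm (y - x) + \<bar>\<gamma> y - \<gamma> x\<bar>"
        using norm_triangle_ineq[of "y - x" "(\<gamma> y - \<gamma> x) *\<^sub>R n"] n by simp
      also have "\<bar>\<gamma> y - \<gamma> x\<bar> \<le> L * norm (y - x)"
        using lipschitz_onD[OF \<gamma>, of y x] x y by (simp add: dist_norm)
      finally show "norm (y + \<gamma> y *\<^sub>R n - (x + \<gamma> x *\<^sub>R n)) \<le> (1 + L) * norm (y - x)"
        by (simp add: algebra_simps)
    qed auto
  qed simp
  moreover have "{y. y \<bullet> n = \<gamma> (y - (y \<bullet> n) *\<^sub>R n)} \<subseteq> (\<lambda>z. z + \<gamma> z *\<^sub>R n) ` {z. z \<bullet> n = 0}"
  proof
    fix y assume y: "y \<in> {y. y \<bullet> n = \<gamma> (y - (y \<bullet> n) *\<^sub>R n)}"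
    let ?z = "y - (y \<bullet> n) *\<^sub>R n"
    have "?z \<bullet> n = 0" using nn by (simp add: inner_diff_left)
    moreover have "y = ?z + \<gamma> ?z *\<^sub>R n"
      using y by simp
    ultimately show "y \<in> (\<lambda>z. z + \<gamma> z *\<^sub>R n) ` {z. z \<bullet> n = 0}" by blast
  qed
  ultimately show ?thesis by (rule negligible_subset)
qed

text \<open>Inside a chart the frontier lies on the graph. Points below it belong to the open set
  \<Omega>, and the part above it is open and misses \<Omega>, hence its closure. Local
  negligibility suffices.\<close>

lemma negligible_frontier_Lipschitz:
  assumes \<Omega>: "open \<Omega>" and lip: "lipschitz_boundary \<Omega>"
  shows "negligible (frontier \<Omega>)"
proof (rule iffD2[OF locally_negligible_alt], rule ballI)
  fix x assume x: "x \<in> frontier \<Omega>"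
  from lip[unfolded lipschitz_boundary_def, rule_format, OF x] obtain U n L \<gamma> where U: "open U" "x \<in> U" and n: "norm n = 1"
    and \<gamma>: "L-lipschitz_on {z. z \<bullet> n = 0} \<gamma>"
    and graph: "\<Omega> \<inter> U = {y \<in> U. y \<bullet> n < \<gamma> (y - (y \<bullet> n) *\<^sub>R n)}"
    by (elim exE conjE)
  have nn: "n \<bullet> n = 1" using n by (simp add: norm_eq_1)
  have cont: "continuous_on UNIV (\<lambda>y. \<gamma> (y - (y \<bullet> n) *\<^sub>R n))"
    by (rule continuous_on_compose2[OF lipschitz_on_continuous_on[OF \<gamma>]])
       (use nn in \<open>auto intro!: continuous_intros simp: inner_diff_left\<close>)
  have "frontier \<Omega> \<inter> U \<subseteq> {y. y \<bullet> n = \<gamma> (y - (y \<bullet> n) *\<^sub>R n)}"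
  proof
    fix y assume y: "y \<in> frontier \<Omega> \<inter> U"
    then have "y \<notin> \<Omega>" "y \<in> closure \<Omega>"
      using \<Omega> by (auto simp: frontier_def interior_open)
    define W where "W = U \<inter> {y. \<gamma> (y - (y \<bullet> n) *\<^sub>R n) < y \<bullet> n}"
    have "open W"
      unfolding W_def using U by (intro open_Int open_Collect_less cont continuous_intros) 
    moreover have "W \<inter> \<Omega> = {}"
      using graph by (force simp: W_def)
    ultimately have "y \<notin> W"
      using \<open>y \<in> closure \<Omega>\<close> by (auto simp: open_Int_closure_eq_empty[of W \<Omega>, symmetric])
    moreover have "\<not> y \<bullet> n < \<gamma> (y - (y \<bullet> n) *\<^sub>R n)"
      using y \<open>y \<notin> \<Omega>\<close> graph by blast
    ultimately show "y \<in> {y. y \<bullet> n = \<gamma> (y - (y \<bullet> n) *\<^sub>R n)}"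
      using y by (auto simp: W_def)
  qed
  then have "negligible (frontier \<Omega> \<inter> U)"
    using negligible_Lipschitz_graph[OF n \<gamma>] negligible_subset by blast
  then show "\<exists>U. openin (top_of_set (frontier \<Omega>)) U \<and> x \<in> U \<and> negligible U"
    using U x by (intro exI[of _ "frontier \<Omega> \<inter> U"]) (auto simp: openin_open)
qed

text \<open>The intersection is a face of both simplices and a proper face of at least one of them,
  since \<open>K\<close> and \<open>K'\<close> differ; a proper face has smaller dimension, hence
  empty interior.\<close>

lemma mesh_elements_negligible_Int:
  fixes \<T> :: "(real ^ 'd) set set"
  assumes mesh: "conforming_mesh \<Omega> \<T>" and K: "K \<in> \<T>" "K' \<in> \<T>" "K \<noteq> K'"
  shows "negligible (K \<inter> K')"
proof -
  have dim: "aff_dim K = int CARD('d)" "aff_dim K' = int CARD('d)" and conv: "convex K" "convex K'"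
    using mesh K by (auto simp: conforming_mesh_def aff_dim_simplex convex_simplex)
  have face: "(K \<inter> K') face_of K" "(K' \<inter> K) face_of K'"
    using mesh K by (auto simp: conforming_mesh_def triangulation_def)
  have "aff_dim (K \<inter> K') < int CARD('d)"
  proof (cases "K \<inter> K' = K")
    case True
    then have "aff_dim (K' \<inter> K) < aff_dim K'"
      using K(3) face conv by (intro face_of_aff_dim_lt) auto
    then show ?thesis using dim by (simp add: Int_commute)
  next
    case False
    then show ?thesis
      using face_of_aff_dim_lt[OF conv(1) face(1)] dim by simp
  qed
  then have "interior (K \<inter> K') = {}"
    using aff_dim_nonempty_interior[of "K \<inter> K'"] by auto
  then show ?thesis
    using conv by (simp add: negligible_convex_interior convex_Int)
qed

text \<open>The elements are closed, share faces and cover the closure of \<Omega>, not \<Omega>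
  itself. Both discrepancies are null sets, so the elementwise norms add up exactly.\<close>

lemma sum_L2_norm_mesh:
  fixes g :: "real ^ 'd \<Rightarrow> 'b::euclidean_space"
  assumes domain: "open \<Omega>" "lipschitz_boundary \<Omega>" and mesh: "conforming_mesh \<Omega> \<T>"
    and g: "g \<in> L2_space \<Omega>"
  shows "(\<Sum>K\<in>\<T>. (L2_norm K g)\<^sup>2) = (L2_norm \<Omega> g)\<^sup>2"
proof -
  define h where "h = (\<lambda>x. (norm (g x))\<^sup>2)"
  have T: "finite \<T>" "\<Union>\<T> = closure \<Omega>" using mesh by (auto simp: conforming_mesh_def triangulation_def)
  have compact: "compact K" if "K \<in> \<T>" for K
    using mesh that compact_simplex by (auto simp: conforming_mesh_def)
  have \<Omega>': "\<Omega> \<in> sets lebesgue" using domain by (simp add: lebesgue_openin)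
  have neg: "negligible (closure \<Omega> - \<Omega>)"
    using negligible_frontier_Lipschitz[OF domain] domain(1) by (simp add: frontier_def interior_open)
  have "h absolutely_integrable_on \<Omega>"
    using L2_integrable[OF g] \<Omega>' by (simp add: h_def set_integrable_def integrable_restrict_space)
  then have hcl: "h absolutely_integrable_on closure \<Omega>"
    by (subst absolutely_integrable_spike_set_eq[of _ \<Omega>])
       (auto intro: negligible_subset[OF neg] negligible_subset[OF negligible_empty] dest: subsetD[OF closure_subset])
  have hK: "h absolutely_integrable_on K" if "K \<in> \<T>" for K
    using hcl that T(2) compact[OF that]
    by (intro set_integrable_subset[OF hcl]) (auto simp: lmeasurable_compact fmeasurableD)
  have norm_eq: "(L2_norm S g)\<^sup>2 = integral S h" if "h absolutely_integrable_on S" "S \<in> sets lebesgue" for S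
  proof -
    have "integrable (lebesgue_on S) h"
      using that by (simp add: set_integrable_def integrable_restrict_space)
    then show ?thesis
      using lebesgue_integral_eq_integral[OF _ that(2), of h]
      by (simp add: L2_norm_def h_def flip: lebesgue_integral_eq_integral[OF _ that(2)])
  qed
  have "(h has_integral (\<Sum>K\<in>\<T>. integral K h)) (\<Union>\<T>)"
  proof (rule has_integral_Union[OF T(1)])
    show "(h has_integral integral K h) K" if "K \<in> \<T>" for K
      using hK[OF that] set_lebesgue_integral_eq_integral(1) by blast
    show "pairwise (\<lambda>S S'. negligible (S \<inter> S')) \<T>"
      using mesh_elements_negligible_Int[OF mesh] by (auto simp: pairwise_def)
  qed
  then have "(\<Sum>K\<in>\<T>. integral K h) = integral (closure \<Omega>) h"
    unfolding T(2) by (rule integral_unique[symmetric])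
  also have "\<dots> = integral \<Omega> h"
    by (rule integral_spike_set)
       (auto intro: negligible_subset[OF neg] negligible_subset[OF negligible_empty] dest: subsetD[OF closure_subset])
  finally show ?thesis
    using norm_eq hK compact \<open>h absolutely_integrable_on \<Omega>\<close> \<Omega>' by (simp add: lmeasurable_compact fmeasurableD)
qed

section \<open>Forms and energy estimates\<close>

lemma L2_bounded_linear:
  assumes u: "u \<in> L2_space S" and h: "bounded_linear h"
  shows "(\<lambda>x. h (u x)) \<in> L2_space S"
proof -
  obtain B where B: "\<And>x. norm (h x) \<le> norm x * B"
    using bounded_linear.bounded[OF h] by blast
  have m: "(\<lambda>x. h (u x)) \<in> borel_measurable (lebesgue_on S)"
    using measurable_compose[OF L2_measurable[OF u] borel_measurable_continuous_onI[OF linear_continuous_on[OF h]]] .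
  moreover have "integrable (lebesgue_on S) (\<lambda>x. (norm (h (u x)))\<^sup>2)"
  proof (rule Bochner_Integration.integrable_bound)
    show "integrable (lebesgue_on S) (\<lambda>x. B\<^sup>2 * (norm (u x))\<^sup>2)"
      using L2_integrable[OF u] by simp
    have "(norm (h (u x)))\<^sup>2 \<le> B\<^sup>2 * (norm (u x))\<^sup>2" for x
      using power_mono[OF B[of "u x"] norm_ge_zero, of 2] by (simp add: power_mult_distrib mult.commute)
    then show "AE x in lebesgue_on S. norm ((norm (h (u x)))\<^sup>2) \<le> norm (B\<^sup>2 * (norm (u x))\<^sup>2)"
      by (intro AE_I2) simp
  qed (use m in measurable)
  ultimately show ?thesis by (simp add: L2_space_def)
qed

lemma bounded_linear_trace: "bounded_linear (trace :: real ^ 'n ^ 'n \<Rightarrow> real)"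
  unfolding trace_def[abs_def]
  by (intro bounded_linear_sum bounded_linear_compose[OF bounded_linear_vec_nth bounded_linear_vec_nth])

text \<open>A nonempty open set is not null, so a negative essential bound would be contradicted at
  some point.\<close>

lemma Linf_norm_nonneg:
  assumes "open \<Omega>" "\<Omega> \<noteq> {}" "c \<in> Linf_space \<Omega>"
  shows "0 \<le> real_of_ereal (Linf_norm \<Omega> c)"
proof (rule ccontr)
  assume neg: "\<not> ?thesis"
  have "AE x in lebesgue_on \<Omega>. False"
    using Linf_norm_AE[OF assms(3)]
  proof eventually_elim
    case (elim x)
    then show ?case using neg norm_ge_zero[of "c x"] by linarith
  qed
  then have "negligible \<Omega>"
    using assms(1) by (simp add: AE_lebesgue_on_negligible lebesgue_openin)
  then show False using assms open_not_negligible by blast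
qed

lemma weighted_Cauchy_Schwarz:
  fixes a b c d :: real
  assumes "\<epsilon> \<ge> 0" "\<kappa> \<ge> 0"
  shows "\<epsilon> * (a * b) + \<kappa> * (c * d) \<le> sqrt (\<epsilon> * a\<^sup>2 + \<kappa> * c\<^sup>2) * sqrt (\<epsilon> * b\<^sup>2 + \<kappa> * d\<^sup>2)"
proof -
  \<comment> \<open>Lagrange's identity with weights.\<close>
  have "(\<epsilon> * a\<^sup>2 + \<kappa> * c\<^sup>2) * (\<epsilon> * b\<^sup>2 + \<kappa> * d\<^sup>2) - (\<epsilon> * (a * b) + \<kappa> * (c * d))\<^sup>2 = \<epsilon> * \<kappa> * (a * d - b * c)\<^sup>2"
    by (simp add: power2_eq_square algebra_simps)
  then have "(\<epsilon> * (a * b) + \<kappa> * (c * d))\<^sup>2 \<le> (\<epsilon> * a\<^sup>2 + \<kappa> * c\<^sup>2) * (\<epsilon> * b\<^sup>2 + \<kappa> * d\<^sup>2)"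
    using mult_nonneg_nonneg[OF mult_nonneg_nonneg[OF assms] zero_le_power2[of "a * d - b * c"]] by linarith
  then show ?thesis
    unfolding real_sqrt_mult[symmetric] by (rule real_le_rsqrt)
qed

text \<open>Counterpart of \<open>normV\<close> with the mesh removed; on \<open>H10\<close> the two
  agree by \<open>sum_L2_norm_mesh\<close>.\<close>

definition energy_norm :: "(real ^ 'd) set \<Rightarrow> real \<Rightarrow> real \<Rightarrow> 'd vector_field \<Rightarrow> real" where
  "energy_norm \<Omega> \<epsilon> \<kappa> u = sqrt (\<epsilon> * (L2_norm \<Omega> (wgrad \<Omega> u))\<^sup>2 + \<kappa> * (L2_norm \<Omega> u)\<^sup>2)"

text \<open>The setting of a single equation, without mesh and controls. Of the bounding box only a
  Friedrichs inequality with a positive constant is kept.\<close>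

locale oseen =
  fixes \<Omega> :: "(real ^ 'd::finite) set" and \<epsilon> \<kappa> C\<^sub>P :: real and c :: "'d vector_field"
  assumes open_\<Omega>: "open \<Omega>" and bounded_\<Omega>: "bounded \<Omega>" and nonempty_\<Omega>: "\<Omega> \<noteq> {}"
    and \<epsilon>: "\<epsilon> > 0" and \<kappa>: "\<kappa> \<ge> 0" and C\<^sub>P: "C\<^sub>P > 0"
    and Friedrichs: "\<And>u. u \<in> H10 \<Omega> \<Longrightarrow> L2_norm \<Omega> u \<le> C\<^sub>P * L2_norm \<Omega> (wgrad \<Omega> u)"
    and c: "c \<in> W1inf \<Omega>" and div_c: "AE x in lebesgue_on \<Omega>. wdiv \<Omega> c x = 0"
begin

abbreviation "V \<equiv> H10 \<Omega>"
abbreviation "\<A> \<equiv> formA \<Omega> \<epsilon> \<kappa> c"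
abbreviation "\<C> \<equiv> formC \<Omega> \<epsilon> \<kappa> c"
abbreviation "\<B> \<equiv> formB \<Omega>"
abbreviation "ip \<equiv> L2_inner \<Omega>"
abbreviation "N2 \<equiv> L2_norm \<Omega>"
abbreviation "NV \<equiv> energy_norm \<Omega> \<epsilon> \<kappa>"
abbreviation "C\<^sub>\<Omega> \<equiv> energy_const \<epsilon> \<kappa> C\<^sub>P"
abbreviation "C\<^sub>c\<^sub>t \<equiv> continuity_const \<Omega> \<epsilon> c C\<^sub>\<Omega>"
abbreviation "adv u \<equiv> (\<lambda>x. wgrad \<Omega> u x *v c x)"

lemma \<Omega>_lebesgue: "\<Omega> \<in> sets lebesgue"
  using open_\<Omega> by (simp add: lebesgue_openin)

lemma c_Linf: "c \<in> Linf_space \<Omega>"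
  using c by (simp add: W1inf_def)

lemma V_L2: "u \<in> V \<Longrightarrow> u \<in> L2_space \<Omega>"
  and V_grad_L2: "u \<in> V \<Longrightarrow> wgrad \<Omega> u \<in> L2_space \<Omega>"
  using H10_H1 H1_L2 H1_wgrad_L2[OF open_\<Omega>] by blast+

lemma V_adv_L2: "u \<in> V \<Longrightarrow> adv u \<in> L2_space \<Omega>"
  by (intro L2_matrix_vector_mult c_Linf V_grad_L2)

lemma V_wdiv_L2: "u \<in> V \<Longrightarrow> wdiv \<Omega> u \<in> L2_space \<Omega>"
  unfolding wdiv_def[abs_def] by (rule L2_bounded_linear[OF V_grad_L2 bounded_linear_trace])

lemmas V_add = H10_add[OF open_\<Omega> bounded_\<Omega>]
  and V_scaleR = H10_scaleR[OF open_\<Omega> bounded_\<Omega>]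
  and V_diff = H10_diff[OF open_\<Omega> bounded_\<Omega>]

lemma formA_alt:
  assumes "u \<in> V" "v \<in> V"
  shows "\<A> u v = \<epsilon> * ip (wgrad \<Omega> u) (wgrad \<Omega> v) + \<kappa> * ip u v + ip (adv u) v"
  unfolding formA_def
  by (subst L2_inner_add_left)
     (auto intro: L2_scaleR V_adv_L2 V_L2 assms simp: L2_inner_scaleR_left)

lemma formC_alt:
  assumes "u \<in> V" "v \<in> V"
  shows "\<C> u v = \<epsilon> * ip (wgrad \<Omega> u) (wgrad \<Omega> v) + \<kappa> * ip u v - ip (adv u) v"
  unfolding formC_def
  by (subst L2_inner_diff_left)
     (auto intro: L2_scaleR V_adv_L2 V_L2 assms simp: L2_inner_scaleR_left)

text \<open>The advection term changes sign in \<C> and changes sign again when its arguments are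
  exchanged. This transposition is the duality between state and adjoint, and it reduces the
  linearity of \<C> to that of \<A>.\<close>

lemma formC_eq_formA: "u \<in> V \<Longrightarrow> v \<in> V \<Longrightarrow> \<C> u v = \<A> v u"
  using advection_skew[OF open_\<Omega> bounded_\<Omega> c div_c, of u v]
  by (simp add: formA_alt formC_alt L2_inner_commute[of \<Omega> "wgrad \<Omega> u"] L2_inner_commute[of \<Omega> u])

section \<open>Bilinearity of the forms\<close>

lemma formA_add_left:
  assumes u: "u \<in> V" and v: "v \<in> V" and z: "z \<in> V"
  shows "\<A> (\<lambda>x. u x + v x) z = \<A> u z + \<A> v z"
proof -
  \<comment> \<open>The chosen gradients are additive only almost everywhere, so additivity is
    applied under each integral rather than to the functions.\<close>
  have ae: "AE x in lebesgue_on \<Omega>. wgrad \<Omega> u x + wgrad \<Omega> v x = wgrad \<Omega> (\<lambda>x. u x + v x) x"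
    using H1_add(2)[OF open_\<Omega> H10_H1[OF u] H10_H1[OF v]] by (simp add: eq_commute)
  have "ip (wgrad \<Omega> (\<lambda>x. u x + v x)) (wgrad \<Omega> z) = ip (\<lambda>x. wgrad \<Omega> u x + wgrad \<Omega> v x) (wgrad \<Omega> z)"
    by (rule sym, rule L2_inner_cong_AE[OF \<Omega>_lebesgue]) (auto intro: L2_add V_grad_L2 u v z ae)
  moreover have "ip (adv (\<lambda>x. u x + v x)) z = ip (\<lambda>x. adv u x + adv v x) z"
  proof (rule sym, rule L2_inner_cong_AE[OF \<Omega>_lebesgue])
    show "AE x in lebesgue_on \<Omega>. adv u x + adv v x = adv (\<lambda>x. u x + v x) x"
      using ae by eventually_elim (simp flip: matrix_vector_mult_add_rdistrib)
    show "(\<lambda>x. adv u x + adv v x) \<in> L2_space \<Omega>" by (intro L2_add V_adv_L2 u v)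
  qed (auto intro: V_L2 z)
  ultimately show ?thesis
    by (simp add: formA_alt u v z V_add L2_inner_add_left V_grad_L2 V_adv_L2 V_L2 algebra_simps)
qed

lemma formA_scaleR_left:
  assumes u: "u \<in> V" and z: "z \<in> V"
  shows "\<A> (\<lambda>x. r *\<^sub>R u x) z = r * \<A> u z"
proof -
  have ae: "AE x in lebesgue_on \<Omega>. r *\<^sub>R wgrad \<Omega> u x = wgrad \<Omega> (\<lambda>x. r *\<^sub>R u x) x"
    using H1_scaleR(2)[OF open_\<Omega> H10_H1[OF u]] by (simp add: eq_commute)
  have "ip (wgrad \<Omega> (\<lambda>x. r *\<^sub>R u x)) (wgrad \<Omega> z) = ip (\<lambda>x. r *\<^sub>R wgrad \<Omega> u x) (wgrad \<Omega> z)"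
    by (rule sym, rule L2_inner_cong_AE[OF \<Omega>_lebesgue]) (auto intro: L2_scaleR V_grad_L2 u z ae)
  moreover have "ip (adv (\<lambda>x. r *\<^sub>R u x)) z = ip (\<lambda>x. r *\<^sub>R adv u x) z"
  proof (rule sym, rule L2_inner_cong_AE[OF \<Omega>_lebesgue])
    show "AE x in lebesgue_on \<Omega>. r *\<^sub>R adv u x = adv (\<lambda>x. r *\<^sub>R u x) x"
      using ae by eventually_elim (simp add: scaleR_matrix_vector_assoc)
    show "(\<lambda>x. r *\<^sub>R adv u x) \<in> L2_space \<Omega>" by (intro L2_scaleR V_adv_L2 u)
  qed (auto intro: V_L2 z)
  ultimately show ?thesis
    by (simp add: formA_alt u z V_scaleR L2_inner_scaleR_left algebra_simps)
qed

lemma formA_add_right: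
  assumes u: "u \<in> V" and v: "v \<in> V" and z: "z \<in> V"
  shows "\<A> z (\<lambda>x. u x + v x) = \<A> z u + \<A> z v"
proof -
  have ae: "AE x in lebesgue_on \<Omega>. wgrad \<Omega> u x + wgrad \<Omega> v x = wgrad \<Omega> (\<lambda>x. u x + v x) x"
    using H1_add(2)[OF open_\<Omega> H10_H1[OF u] H10_H1[OF v]] by (simp add: eq_commute)
  have "ip (wgrad \<Omega> z) (wgrad \<Omega> (\<lambda>x. u x + v x)) = ip (wgrad \<Omega> z) (\<lambda>x. wgrad \<Omega> u x + wgrad \<Omega> v x)"
    by (rule sym, rule L2_inner_cong_AE[OF \<Omega>_lebesgue]) (auto intro: L2_add V_grad_L2 u v z ae)
  then show ?thesis
    by (simp add: formA_alt u v z V_add L2_inner_add_right V_grad_L2 V_adv_L2 V_L2 algebra_simps)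
qed

lemma formA_scaleR_right:
  assumes u: "u \<in> V" and z: "z \<in> V"
  shows "\<A> z (\<lambda>x. r *\<^sub>R u x) = r * \<A> z u"
proof -
  have ae: "AE x in lebesgue_on \<Omega>. r *\<^sub>R wgrad \<Omega> u x = wgrad \<Omega> (\<lambda>x. r *\<^sub>R u x) x"
    using H1_scaleR(2)[OF open_\<Omega> H10_H1[OF u]] by (simp add: eq_commute)
  have "ip (wgrad \<Omega> z) (wgrad \<Omega> (\<lambda>x. r *\<^sub>R u x)) = ip (wgrad \<Omega> z) (\<lambda>x. r *\<^sub>R wgrad \<Omega> u x)"
    by (rule sym, rule L2_inner_cong_AE[OF \<Omega>_lebesgue]) (auto intro: L2_scaleR V_grad_L2 u z ae)
  then show ?thesis
    by (simp add: formA_alt u z V_scaleR L2_inner_scaleR_right algebra_simps)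
qed

lemma formA_diff_left:
  assumes u: "u \<in> V" and v: "v \<in> V" and z: "z \<in> V"
  shows "\<A> (\<lambda>x. u x - v x) z = \<A> u z - \<A> v z"
  using formA_add_left[OF u V_scaleR[OF v, of "-1"] z] formA_scaleR_left[OF v z, of "-1"] by simp

lemma formA_diff_right:
  assumes u: "u \<in> V" and v: "v \<in> V" and z: "z \<in> V"
  shows "\<A> z (\<lambda>x. u x - v x) = \<A> z u - \<A> z v"
  using formA_add_right[OF u V_scaleR[OF v, of "-1"] z] formA_scaleR_right[OF v z, of "-1"] by simp

lemma formB_diff_left:
  assumes u: "u \<in> V" and v: "v \<in> V" and \<phi>: "\<phi> \<in> L2_space \<Omega>"
  shows "\<B> (\<lambda>x. u x - v x) \<phi> = \<B> u \<phi> - \<B> v \<phi>"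
proof -
  have "ip \<phi> (\<lambda>x. wdiv \<Omega> u x - wdiv \<Omega> v x) = ip \<phi> (wdiv \<Omega> (\<lambda>x. u x - v x))"
  proof (rule L2_inner_cong_AE[OF \<Omega>_lebesgue \<phi>])
    show "AE x in lebesgue_on \<Omega>. wdiv \<Omega> u x - wdiv \<Omega> v x = wdiv \<Omega> (\<lambda>x. u x - v x) x"
      using H1_diff(2)[OF open_\<Omega> H10_H1[OF u] H10_H1[OF v]]
      by eventually_elim (simp add: wdiv_def trace_sub)
  qed (auto intro: L2_diff V_wdiv_L2 u v)
  then show ?thesis
    by (simp add: formB_def L2_inner_diff_right V_wdiv_L2 u v \<phi>)
qed

lemma formB_diff_right:
  "u \<in> V \<Longrightarrow> \<phi> \<in> L2_space \<Omega> \<Longrightarrow> \<psi> \<in> L2_space \<Omega> \<Longrightarrow> \<B> u (\<lambda>x. \<phi> x - \<psi> x) = \<B> u \<phi> - \<B> u \<psi>"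
  by (simp add: formB_def L2_inner_diff_left V_wdiv_L2)

section \<open>The energy norm and its constants\<close>

lemma energy_norm_nonneg: "0 \<le> NV u"
  using \<epsilon> \<kappa> by (simp add: energy_norm_def)

lemma energy_norm_power2: "(NV u)\<^sup>2 = \<epsilon> * (N2 (wgrad \<Omega> u))\<^sup>2 + \<kappa> * (N2 u)\<^sup>2"
  using \<epsilon> \<kappa> by (simp add: energy_norm_def)

text \<open>For equal arguments skew symmetry forces the advection term to vanish.\<close>

lemma formA_self: "u \<in> V \<Longrightarrow> \<A> u u = (NV u)\<^sup>2"
  using advection_skew[OF open_\<Omega> bounded_\<Omega> c div_c, of u u]
  by (simp add: formA_alt energy_norm_power2 L2_inner_self)

lemma sqrt_mult_le_energy_norm:
  "sqrt \<epsilon> * N2 (wgrad \<Omega> u) \<le> NV u" "sqrt \<kappa> * N2 u \<le> NV u"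
  using \<epsilon> \<kappa> by (auto intro!: power2_le_imp_le[OF _ energy_norm_nonneg] simp: power_mult_distrib energy_norm_power2)

text \<open>There are two routes: Friedrichs through the gradient part and, for nonzero \<kappa>,
  the reaction part directly. \<open>energy_const\<close> is the better of the two factors.\<close>

lemma L2_norm_le_energy_norm:
  assumes u: "u \<in> V"
  shows "N2 u \<le> C\<^sub>\<Omega> * NV u"
proof -
  have "N2 u \<le> C\<^sub>P * N2 (wgrad \<Omega> u)" by (rule Friedrichs[OF u])
  also have "\<dots> = C\<^sub>P / sqrt \<epsilon> * (sqrt \<epsilon> * N2 (wgrad \<Omega> u))" using \<epsilon> by simp
  also have "\<dots> \<le> C\<^sub>P / sqrt \<epsilon> * NV u"
    using \<epsilon> C\<^sub>P by (intro mult_left_mono sqrt_mult_le_energy_norm) auto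
  finally have 1: "N2 u \<le> C\<^sub>P / sqrt \<epsilon> * NV u" .
  have 2: "N2 u \<le> 1 / sqrt \<kappa> * NV u" if "\<kappa> \<noteq> 0"
    using sqrt_mult_le_energy_norm(2)[of u] that \<kappa> by (simp add: field_simps)
  show ?thesis
    using 1 2 by (auto simp: energy_const_def min_def)
qed

lemma energy_const_pos: "0 < C\<^sub>\<Omega>"
  using \<epsilon> \<kappa> C\<^sub>P by (auto simp: energy_const_def)

lemma continuity_const_ge_1: "1 \<le> C\<^sub>c\<^sub>t"
  using energy_const_pos \<epsilon> Linf_norm_nonneg[OF open_\<Omega> nonempty_\<Omega> c_Linf]
  by (simp add: continuity_const_def)

text \<open>The symmetric part contributes the 1 in the continuity constant. In the advection term
  the gradient costs 1 / sqrt eps and the L2 norm of the other argument costs the energy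
  constant.\<close>

lemma formA_bound:
  assumes u: "u \<in> V" and v: "v \<in> V"
  shows "\<bar>\<A> u v\<bar> \<le> C\<^sub>c\<^sub>t * (NV u * NV v)" "\<bar>\<C> u v\<bar> \<le> C\<^sub>c\<^sub>t * (NV u * NV v)"
proof -
  let ?M = "real_of_ereal (Linf_norm \<Omega> c)"
  have M: "0 \<le> ?M" by (rule Linf_norm_nonneg[OF open_\<Omega> nonempty_\<Omega> c_Linf])
  have "\<bar>\<epsilon> * ip (wgrad \<Omega> u) (wgrad \<Omega> v) + \<kappa> * ip u v\<bar>
      \<le> \<epsilon> * \<bar>ip (wgrad \<Omega> u) (wgrad \<Omega> v)\<bar> + \<kappa> * \<bar>ip u v\<bar>"
    using abs_triangle_ineq[of "\<epsilon> * ip (wgrad \<Omega> u) (wgrad \<Omega> v)" "\<kappa> * ip u v"] \<epsilon> \<kappa>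
    by (simp add: abs_mult)
  also have "\<dots> \<le> \<epsilon> * (N2 (wgrad \<Omega> u) * N2 (wgrad \<Omega> v)) + \<kappa> * (N2 u * N2 v)"
    using \<epsilon> \<kappa> by (intro add_mono mult_left_mono L2_Cauchy_Schwarz V_grad_L2 V_L2 u v) auto
  also have "\<dots> \<le> NV u * NV v"
    unfolding energy_norm_def using \<epsilon> \<kappa> by (intro weighted_Cauchy_Schwarz) auto
  finally have 1: "\<bar>\<epsilon> * ip (wgrad \<Omega> u) (wgrad \<Omega> v) + \<kappa> * ip u v\<bar> \<le> NV u * NV v" .
  have "\<bar>ip (adv u) v\<bar> \<le> N2 (adv u) * N2 v"
    by (intro L2_Cauchy_Schwarz V_adv_L2 V_L2 u v)
  also have "\<dots> \<le> (?M * N2 (wgrad \<Omega> u)) * (C\<^sub>\<Omega> * NV v)"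
    using L2_matrix_vector_mult(2)[OF V_grad_L2[OF u] c_Linf] M unfolding abs_of_nonneg[OF M]
    by (intro mult_mono L2_norm_le_energy_norm v) (auto simp: L2_norm_nonneg)
  also have "\<dots> = ?M * C\<^sub>\<Omega> / sqrt \<epsilon> * (sqrt \<epsilon> * N2 (wgrad \<Omega> u)) * NV v"
    using \<epsilon> by simp
  also have "\<dots> \<le> ?M * C\<^sub>\<Omega> / sqrt \<epsilon> * NV u * NV v"
    using M \<epsilon> energy_const_pos
    by (intro mult_right_mono mult_left_mono sqrt_mult_le_energy_norm energy_norm_nonneg) auto
  finally have 2: "\<bar>ip (adv u) v\<bar> \<le> ?M * C\<^sub>\<Omega> / sqrt \<epsilon> * NV u * NV v" .
  have "C\<^sub>c\<^sub>t * (NV u * NV v) = NV u * NV v + ?M * C\<^sub>\<Omega> / sqrt \<epsilon> * NV u * NV v"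
    by (simp add: continuity_const_def algebra_simps)
  with 1 2 show "\<bar>\<A> u v\<bar> \<le> C\<^sub>c\<^sub>t * (NV u * NV v)" "\<bar>\<C> u v\<bar> \<le> C\<^sub>c\<^sub>t * (NV u * NV v)"
    by (auto simp: formA_alt formC_alt u v)
qed

lemma L2_inner_le_energy_norm:
  assumes "g \<in> L2_space \<Omega>" "u \<in> V"
  shows "\<bar>ip g u\<bar> \<le> C\<^sub>\<Omega> * N2 g * NV u"
proof -
  have "\<bar>ip g u\<bar> \<le> N2 g * N2 u" by (intro L2_Cauchy_Schwarz V_L2 assms)
  also have "\<dots> \<le> N2 g * (C\<^sub>\<Omega> * NV u)" by (intro mult_left_mono L2_norm_le_energy_norm assms L2_norm_nonneg)
  finally show ?thesis by (simp add: mult_ac)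
qed

lemma energy_estimate:
  assumes "g \<in> L2_space \<Omega>" "u \<in> V" "(NV u)\<^sup>2 = ip g u"
  shows "NV u \<le> C\<^sub>\<Omega> * N2 g"
proof (cases "NV u = 0")
  case True
  then show ?thesis using energy_const_pos L2_norm_nonneg[of \<Omega> g] by simp
next
  case False
  then have "NV u > 0" using energy_norm_nonneg[of u] by simp
  moreover have "NV u * NV u \<le> C\<^sub>\<Omega> * N2 g * NV u"
    using L2_inner_le_energy_norm[OF assms(1,2)] assms(3) by (simp add: power2_eq_square)
  ultimately show ?thesis by simp
qed

lemma energy_norm_le_grad:
  assumes "u \<in> V"
  shows "NV u \<le> sqrt (\<epsilon> + \<kappa> * C\<^sub>P\<^sup>2) * N2 (wgrad \<Omega> u)"
proof -
  have "(N2 u)\<^sup>2 \<le> (C\<^sub>P * N2 (wgrad \<Omega> u))\<^sup>2"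
    by (intro power_mono Friedrichs assms L2_norm_nonneg)
  then have "\<kappa> * (N2 u)\<^sup>2 \<le> \<kappa> * (C\<^sub>P * N2 (wgrad \<Omega> u))\<^sup>2"
    using \<kappa> by (rule mult_left_mono)
  then have "NV u \<le> sqrt ((\<epsilon> + \<kappa> * C\<^sub>P\<^sup>2) * (N2 (wgrad \<Omega> u))\<^sup>2)"
    unfolding energy_norm_def by (intro real_sqrt_le_mono) (simp add: algebra_simps power_mult_distrib)
  then show ?thesis
    by (simp add: real_sqrt_mult L2_norm_nonneg)
qed

text \<open>The inf-sup condition measures velocities by the gradient, the hypothesis by the energy
  norm; the factor sqrt (eps + kappa C_P^2) in the inf-sup constant is the cost of the
  conversion.\<close>

lemma pressure_bound:
  assumes \<beta>: "\<beta> > 0" "inf_sup_condition \<Omega> \<beta>" and p: "p \<in> L2_zero_mean \<Omega>" and "N \<ge> 0"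
    and bound: "\<And>\<xi>. \<xi> \<in> V \<Longrightarrow> \<B> \<xi> p \<le> N * NV \<xi>"
  shows "N2 p \<le> inf_sup_const \<epsilon> \<kappa> C\<^sub>P \<beta> * N"
proof -
  let ?s = "sqrt (\<epsilon> + \<kappa> * C\<^sub>P\<^sup>2)"
  have "ereal (\<B> \<xi> p / N2 (wgrad \<Omega> \<xi>)) \<le> ereal (N * ?s)" if "\<xi> \<in> V" for \<xi>
  proof (cases "N2 (wgrad \<Omega> \<xi>) = 0")
    \<comment> \<open>The quotient is then 0, division by zero being 0, and stays below the
      bound.\<close>
    case True
    then show ?thesis using \<open>N \<ge> 0\<close> \<epsilon> \<kappa> by simp
  next
    case False
    then have "N2 (wgrad \<Omega> \<xi>) > 0" using L2_norm_nonneg[of \<Omega> "wgrad \<Omega> \<xi>"] by simp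
    moreover have "\<B> \<xi> p \<le> N * (?s * N2 (wgrad \<Omega> \<xi>))"
      using bound[OF that] mult_left_mono[OF energy_norm_le_grad[OF that] \<open>N \<ge> 0\<close>] by linarith
    ultimately show ?thesis by (simp add: pos_divide_le_eq mult.assoc)
  qed
  then have "ereal (\<beta> * N2 p) \<le> ereal (N * ?s)"
    using \<beta>(2) p unfolding inf_sup_condition_def
    by (blast intro: order.trans SUP_least)
  then show ?thesis
    using \<beta>(1) by (simp add: inf_sup_const_def field_simps)
qed

text \<open>One argument for both equations: \<open>F\<close> is \<A> with \<open>s\<close> = 1 or
  \<C> with \<open>s\<close> = -1. Testing with \<open>u\<close> removes the pressure and gives the
  energy estimate. Solving the equation for the pressure term then leaves one share bounded by the
  continuity of \<open>F\<close> and one by the data, whence the factor 1 + C_ct.\<close>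

lemma saddle_point_bound:
  fixes F :: "'d vector_field \<Rightarrow> 'd vector_field \<Rightarrow> real" and s :: real
  assumes \<beta>: "\<beta> > 0" "inf_sup_condition \<Omega> \<beta>" and s: "\<bar>s\<bar> = 1"
    and u: "u \<in> V" and p: "p \<in> L2_zero_mean \<Omega>" and g: "g \<in> L2_space \<Omega>"
    and F: "F u u = (NV u)\<^sup>2" "\<And>\<xi>. \<xi> \<in> V \<Longrightarrow> \<bar>F u \<xi>\<bar> \<le> C\<^sub>c\<^sub>t * (NV u * NV \<xi>)"
    and eq: "\<And>\<xi>. \<xi> \<in> V \<Longrightarrow> F u \<xi> - s * \<B> \<xi> p = ip g \<xi>" and div: "\<B> u p = 0"
  shows "NV u \<le> C\<^sub>\<Omega> * N2 g"
    "N2 p \<le> inf_sup_const \<epsilon> \<kappa> C\<^sub>P \<beta> * (1 + C\<^sub>c\<^sub>t) * (C\<^sub>\<Omega> * N2 g)"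
proof -
  show u_bound: "NV u \<le> C\<^sub>\<Omega> * N2 g"
    using F(1) eq[OF u] div by (intro energy_estimate g u) simp
  have pos: "0 \<le> (1 + C\<^sub>c\<^sub>t) * (C\<^sub>\<Omega> * N2 g)"
    using continuity_const_ge_1 energy_const_pos L2_norm_nonneg[of \<Omega> g] by simp
  have "\<B> \<xi> p \<le> (1 + C\<^sub>c\<^sub>t) * (C\<^sub>\<Omega> * N2 g) * NV \<xi>" if \<xi>: "\<xi> \<in> V" for \<xi>
  proof -
    have "\<bar>s * \<B> \<xi> p\<bar> = \<bar>F u \<xi> - ip g \<xi>\<bar>" using eq[OF \<xi>] by (simp add: abs_if split: if_splits)
    then have "\<B> \<xi> p \<le> \<bar>F u \<xi>\<bar> + \<bar>ip g \<xi>\<bar>" using s by (simp add: abs_mult)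
    also have "\<dots> \<le> C\<^sub>c\<^sub>t * (NV u * NV \<xi>) + C\<^sub>\<Omega> * N2 g * NV \<xi>"
      by (intro add_mono F \<xi> L2_inner_le_energy_norm g)
    also have "C\<^sub>c\<^sub>t * (NV u * NV \<xi>) \<le> C\<^sub>c\<^sub>t * (C\<^sub>\<Omega> * N2 g * NV \<xi>)"
      using continuity_const_ge_1 by (intro mult_left_mono mult_right_mono u_bound energy_norm_nonneg) auto
    finally show ?thesis by (simp add: algebra_simps)
  qed
  from pressure_bound[OF \<beta> p pos this]
  show "N2 p \<le> inf_sup_const \<epsilon> \<kappa> C\<^sub>P \<beta> * (1 + C\<^sub>c\<^sub>t) * (C\<^sub>\<Omega> * N2 g)"
    by (simp add: mult.assoc)
qed

section \<open>Differences of solutions and their stability\<close>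

lemma L2_zero_mean_L2: "p \<in> L2_zero_mean \<Omega> \<Longrightarrow> p \<in> L2_space \<Omega>"
  by (simp add: L2_zero_mean_def)

lemma L2_integrable_real:
  fixes p :: "'d scalar_field"
  assumes "p \<in> L2_space \<Omega>"
  shows "integrable (lebesgue_on \<Omega>) p"
proof -
  have "(\<lambda>x. 1) \<in> L2_space \<Omega>"
    by (intro L2_continuous_bounded continuous_on_const bounded_\<Omega> \<Omega>_lebesgue)
  from L2_integrable_inner[OF this assms] show ?thesis by (simp add: inner_real_def)
qed

lemma L2_zero_mean_diff:
  "p \<in> L2_zero_mean \<Omega> \<Longrightarrow> q \<in> L2_zero_mean \<Omega> \<Longrightarrow> (\<lambda>x. p x - q x) \<in> L2_zero_mean \<Omega>"
  by (simp add: L2_zero_mean_def L2_diff L2_integrable_real)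

lemma state_solution_diff:
  assumes 1: "state_solution \<Omega> \<epsilon> \<kappa> c g1 y1 p1" and 2: "state_solution \<Omega> \<epsilon> \<kappa> c g2 y2 p2"
    and g: "g1 \<in> L2_space \<Omega>" "g2 \<in> L2_space \<Omega>"
  shows "state_solution \<Omega> \<epsilon> \<kappa> c (\<lambda>x. g1 x - g2 x) (\<lambda>x. y1 x - y2 x) (\<lambda>x. p1 x - p2 x)"
proof -
  have "\<A> y1 \<xi> = ip g1 \<xi> + \<B> \<xi> p1" "\<A> y2 \<xi> = ip g2 \<xi> + \<B> \<xi> p2" if "\<xi> \<in> V" for \<xi>
    using 1 2 that by (auto simp: state_solution_def algebra_simps)
  then show ?thesis
    using assms unfolding state_solution_def
    by (auto simp: V_diff L2_zero_mean_diff formA_diff_left formB_diff_left formB_diff_right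
        L2_zero_mean_L2 L2_inner_diff_left V_L2)
qed

lemma adjoint_solution_diff:
  assumes 1: "adjoint_solution \<Omega> \<epsilon> \<kappa> c g1 y1 p1" and 2: "adjoint_solution \<Omega> \<epsilon> \<kappa> c g2 y2 p2"
    and g: "g1 \<in> L2_space \<Omega>" "g2 \<in> L2_space \<Omega>"
  shows "adjoint_solution \<Omega> \<epsilon> \<kappa> c (\<lambda>x. g1 x - g2 x) (\<lambda>x. y1 x - y2 x) (\<lambda>x. p1 x - p2 x)"
proof -
  \<comment> \<open>The adjoint equation is rewritten with \<A>, whose linearity in the second
    argument then gives the claim.\<close>
  have "\<A> \<zeta> y1 = ip g1 \<zeta> - \<B> \<zeta> p1" "\<A> \<zeta> y2 = ip g2 \<zeta> - \<B> \<zeta> p2" if "\<zeta> \<in> V" for \<zeta>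
    using 1 2 that by (auto simp: adjoint_solution_def formC_eq_formA algebra_simps)
  then show ?thesis
    using assms unfolding adjoint_solution_def
    by (auto simp: V_diff L2_zero_mean_diff formC_eq_formA formA_diff_right formB_diff_left formB_diff_right
        L2_zero_mean_L2 L2_inner_diff_left V_L2)
qed

lemma state_solution_bound:
  assumes \<beta>: "\<beta> > 0" "inf_sup_condition \<Omega> \<beta>" and g: "g \<in> L2_space \<Omega>"
    and sol: "state_solution \<Omega> \<epsilon> \<kappa> c g y p"
  shows "NV y \<le> C\<^sub>\<Omega> * N2 g" "N2 p \<le> inf_sup_const \<epsilon> \<kappa> C\<^sub>P \<beta> * (1 + C\<^sub>c\<^sub>t) * (C\<^sub>\<Omega> * N2 g)"
  using sol saddle_point_bound[OF \<beta>, of 1 y p g \<A>] g formA_bound(1)[of y] formA_self[of y]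
  by (auto simp: state_solution_def)

lemma adjoint_solution_bound:
  assumes \<beta>: "\<beta> > 0" "inf_sup_condition \<Omega> \<beta>" and g: "g \<in> L2_space \<Omega>"
    and sol: "adjoint_solution \<Omega> \<epsilon> \<kappa> c g w q"
  shows "NV w \<le> C\<^sub>\<Omega> * N2 g" "N2 q \<le> inf_sup_const \<epsilon> \<kappa> C\<^sub>P \<beta> * (1 + C\<^sub>c\<^sub>t) * (C\<^sub>\<Omega> * N2 g)"
  using sol saddle_point_bound[OF \<beta>, of "-1" w q g \<C>] g formA_bound(2)[of w] formA_self[of w]
  by (auto simp: adjoint_solution_def formC_eq_formA)

text \<open>The square is expanded with the bilinear \<A>; the advection parts of the two mixed
  terms cancel, and weighted Cauchy-Schwarz handles the rest.\<close>

lemma energy_norm_triangle: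
  assumes u: "u \<in> V" and v: "v \<in> V"
  shows "NV (\<lambda>x. u x + v x) \<le> NV u + NV v"
proof (rule power2_le_imp_le)
  have "\<A> u v + \<A> v u = 2 * (\<epsilon> * ip (wgrad \<Omega> u) (wgrad \<Omega> v) + \<kappa> * ip u v)"
    using advection_skew[OF open_\<Omega> bounded_\<Omega> c div_c u v]
    by (simp add: formA_alt u v L2_inner_commute[of \<Omega> "wgrad \<Omega> v"] L2_inner_commute[of \<Omega> v u])
  also have "\<epsilon> * ip (wgrad \<Omega> u) (wgrad \<Omega> v) + \<kappa> * ip u v
      \<le> \<epsilon> * (N2 (wgrad \<Omega> u) * N2 (wgrad \<Omega> v)) + \<kappa> * (N2 u * N2 v)"
    using L2_Cauchy_Schwarz[OF V_grad_L2[OF u] V_grad_L2[OF v]] L2_Cauchy_Schwarz[OF V_L2[OF u] V_L2[OF v]] \<epsilon> \<kappa>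
    by (intro add_mono mult_left_mono) auto
  also have "\<dots> \<le> NV u * NV v"
    unfolding energy_norm_def using \<epsilon> \<kappa> by (intro weighted_Cauchy_Schwarz) auto
  finally have "\<A> u v + \<A> v u \<le> 2 * (NV u * NV v)" by simp
  moreover have "(NV (\<lambda>x. u x + v x))\<^sup>2 = (NV u)\<^sup>2 + (\<A> u v + \<A> v u) + (NV v)\<^sup>2"
    using u v by (simp add: V_add formA_add_left formA_add_right flip: formA_self)
  ultimately show "(NV (\<lambda>x. u x + v x))\<^sup>2 \<le> (NV u + NV v)\<^sup>2"
    by (simp add: power2_sum)
qed (simp add: energy_norm_nonneg)

end

section \<open>The control error\<close>

text \<open>The Fredholm alternative. The matrix may be singular, as happens for a Gram matrix of
  dependent fields, but the quadratic bound makes the right-hand side vanish on the kernel of the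
  transposed system, which is the solvability condition.\<close>

lemma linear_system_2x2_solvable:
  fixes a11 a12 a21 a22 b1 b2 M :: real
  assumes "\<And>s t. (s * b1 + t * b2)\<^sup>2 \<le> M * (s\<^sup>2 * a11 + s * t * (a12 + a21) + t\<^sup>2 * a22)"
  obtains s t where "s * a11 + t * a21 = b1" "s * a12 + t * a22 = b2"
proof -
  have kernel: "s * b1 + t * b2 = 0" if "s * a11 + t * a12 = 0" "s * a21 + t * a22 = 0" for s t
  proof -
    have "s\<^sup>2 * a11 + s * t * (a12 + a21) + t\<^sup>2 * a22
        = s * (s * a11 + t * a12) + t * (s * a21 + t * a22)"
      by (simp add: power2_eq_square algebra_simps)
    then have "(s * b1 + t * b2)\<^sup>2 \<le> 0" using assms[of s t] that by simp
    then show ?thesis by simp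
  qed
  define \<Delta> where "\<Delta> = a11 * a22 - a12 * a21"
  show ?thesis
  proof (cases "\<Delta> = 0")
    case False
    show ?thesis
    proof (rule that)
      show "(b1 * a22 - b2 * a21) / \<Delta> * a11 + (b2 * a11 - b1 * a12) / \<Delta> * a21 = b1"
        using False by (simp add: divide_simps) (simp add: \<Delta>_def algebra_simps)
      show "(b1 * a22 - b2 * a21) / \<Delta> * a12 + (b2 * a11 - b1 * a12) / \<Delta> * a22 = b2"
        using False by (simp add: divide_simps) (simp add: \<Delta>_def algebra_simps)
    qed
  next
    case True
    \<comment> \<open>With zero determinant the vectors (a12, -a11) and (a22, -a21) lie in that
      kernel.\<close>
    then have 1: "a12 * b1 = a11 * b2" and 2: "a22 * b1 = a21 * b2"
      using kernel[of a12 "- a11"] kernel[of a22 "- a21"] by (simp_all add: \<Delta>_def algebra_simps)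
    consider "a11 \<noteq> 0" | "a12 \<noteq> 0" | "a21 \<noteq> 0" | "a22 \<noteq> 0"
      | "a11 = 0" "a12 = 0" "a21 = 0" "a22 = 0" by blast
    then show ?thesis
    proof cases
      case 1
      with \<open>a12 * b1 = a11 * b2\<close> show ?thesis
        by (intro that[of "b1 / a11" 0]) (auto simp: field_simps)
    next
      case 2
      with \<open>a12 * b1 = a11 * b2\<close> show ?thesis
        by (intro that[of "b2 / a12" 0]) (auto simp: field_simps)
    next
      case 3
      with \<open>a22 * b1 = a21 * b2\<close> show ?thesis
        by (intro that[of 0 "b1 / a21"]) (auto simp: field_simps)
    next
      case 4
      with \<open>a22 * b1 = a21 * b2\<close> show ?thesis
        by (intro that[of 0 "b2 / a22"]) (auto simp: field_simps)
    next
      case 5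
      then show ?thesis
        using kernel[of 1 0] kernel[of 0 1] by (intro that[of 0 0]) auto
    qed
  qed
qed

context oseen
begin

text \<open>The energy constant enters twice: from the data to the energy norm, and from the energy
  norm back to L2.\<close>

lemma L2_norm_le_of_energy_estimate:
  assumes "g \<in> L2_space \<Omega>" "u \<in> V" "\<A> u u = ip g u"
  shows "N2 u \<le> C\<^sub>\<Omega>\<^sup>2 * N2 g"
proof -
  have "N2 u \<le> C\<^sub>\<Omega> * (C\<^sub>\<Omega> * N2 g)"
    using assms energy_const_pos
    by (intro order.trans[OF L2_norm_le_energy_norm] mult_left_mono energy_estimate) (auto simp: formA_self)
  then show ?thesis by (simp add: power2_eq_square mult.assoc)
qed

text \<open>
  The state with right-hand side \<open>\<delta>\<close> is only needed when tested with \<open>Y\<close> and \<open>W\<close>, so its Galerkin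
  approximation \<open>Z\<close> on their span can replace it.
\<close>

lemma adjoint_inner_lower_bound:
  assumes Y: "Y \<in> V" and W: "W \<in> V"
    and D: "D \<in> L2_space \<Omega>" and \<delta>: "\<delta> \<in> L2_space \<Omega>" and r: "r \<in> L2_space \<Omega>"
    and state: "\<And>\<xi>. \<xi> \<in> {Y, W} \<Longrightarrow> \<A> Y \<xi> = ip D \<xi> + ip \<delta> \<xi>"
    and adjoint: "\<And>\<zeta>. \<zeta> \<in> {Y, W} \<Longrightarrow> \<C> W \<zeta> = ip Y \<zeta> + ip r \<zeta>"
  shows "- ip D W \<le> (C\<^sub>\<Omega>\<^sup>2 * N2 \<delta> + N2 r) * (C\<^sub>\<Omega>\<^sup>2 * N2 D)"
proof -
  have comb: "(\<lambda>x. s *\<^sub>R Y x + t *\<^sub>R W x) \<in> V" for s t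
    by (intro V_add V_scaleR Y W)
  have ip_comb: "ip g (\<lambda>x. s *\<^sub>R Y x + t *\<^sub>R W x) = s * ip g Y + t * ip g W" if "g \<in> L2_space \<Omega>" for s t g
    using that Y W by (simp add: L2_inner_add_right L2_scaleR V_L2 L2_inner_scaleR_right)
  have A_comb_left: "\<A> (\<lambda>x. s *\<^sub>R Y x + t *\<^sub>R W x) z = s * \<A> Y z + t * \<A> W z" if "z \<in> V" for s t z
    using that Y W by (simp add: formA_add_left formA_scaleR_left V_scaleR)
  have A_comb_right: "\<A> z (\<lambda>x. s *\<^sub>R Y x + t *\<^sub>R W x) = s * \<A> z Y + t * \<A> z W" if "z \<in> V" for s t z
    using that Y W by (simp add: formA_add_right formA_scaleR_right V_scaleR)
  \<comment> \<open>The solvability condition for the Galerkin system: the functional given by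
    \<open>\<delta>\<close> is bounded by the energy, and the energy of a combination is the
    quadratic form of the matrix of \<A>.\<close>
  have "(s * ip \<delta> Y + t * ip \<delta> W)\<^sup>2
      \<le> (C\<^sub>\<Omega> * N2 \<delta>)\<^sup>2 * (s\<^sup>2 * \<A> Y Y + s * t * (\<A> Y W + \<A> W Y) + t\<^sup>2 * \<A> W W)" for s t
  proof -
    let ?z = "\<lambda>x. s *\<^sub>R Y x + t *\<^sub>R W x"
    have "(ip \<delta> ?z)\<^sup>2 \<le> (C\<^sub>\<Omega> * N2 \<delta> * NV ?z)\<^sup>2"
      using L2_inner_le_energy_norm[OF \<delta> comb, of s t] by (simp add: abs_le_square_iff[symmetric])
    also have "\<dots> = (C\<^sub>\<Omega> * N2 \<delta>)\<^sup>2 * \<A> ?z ?z"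
      by (simp add: power_mult_distrib formA_self comb)
    also have "\<A> ?z ?z = s\<^sup>2 * \<A> Y Y + s * t * (\<A> Y W + \<A> W Y) + t\<^sup>2 * \<A> W W"
      by (simp add: A_comb_left A_comb_right comb Y W power2_eq_square algebra_simps)
    finally show ?thesis by (simp add: ip_comb \<delta>)
  qed
  then obtain s t where st: "s * \<A> Y Y + t * \<A> W Y = ip \<delta> Y" "s * \<A> Y W + t * \<A> W W = ip \<delta> W"
    by (rule linear_system_2x2_solvable)
  define Z where "Z = (\<lambda>x. s *\<^sub>R Y x + t *\<^sub>R W x)"
  \<comment> \<open>\<open>X\<close> is \<open>Y\<close> minus \<open>Z\<close>, the share of the
    state due to \<open>D\<close>: against \<open>Y\<close> and \<open>W\<close> it satisfies the
    equation with \<open>D\<close> alone. Both \<open>Z\<close> and \<open>X\<close> lie in the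
    span, so their energy estimates use no other test fields.\<close>
  define X where "X = (\<lambda>x. (1 - s) *\<^sub>R Y x + (- t) *\<^sub>R W x)"
  have ZV: "Z \<in> V" and XV: "X \<in> V" unfolding Z_def X_def by (rule comb)+
  have AZ: "\<A> Z Y = ip \<delta> Y" "\<A> Z W = ip \<delta> W"
    using st by (simp_all add: Z_def A_comb_left Y W)
  have AX: "\<A> X Y = ip D Y" "\<A> X W = ip D W"
    using st state[of Y] state[of W] unfolding X_def A_comb_left[OF Y] A_comb_left[OF W] left_diff_distrib
    by simp_all
  have "\<A> Z Z = s * \<A> Z Y + t * \<A> Z W"
    using A_comb_right[OF ZV, of s t] by (simp flip: Z_def)
  also have "\<dots> = ip \<delta> Z"
    using ip_comb[OF \<delta>, of s t] by (simp add: AZ flip: Z_def)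
  finally have Z_bound: "N2 Z \<le> C\<^sub>\<Omega>\<^sup>2 * N2 \<delta>"
    by (intro L2_norm_le_of_energy_estimate \<delta> ZV)
  have "\<A> X X = (1 - s) * \<A> X Y + (- t) * \<A> X W"
    using A_comb_right[OF XV, of "1 - s" "- t"] by (simp only: flip: X_def)
  also have "\<dots> = ip D X"
    using ip_comb[OF D, of "1 - s" "- t"] by (simp only: AX flip: X_def)
  finally have X_bound: "N2 X \<le> C\<^sub>\<Omega>\<^sup>2 * N2 D"
    by (intro L2_norm_le_of_energy_estimate D XV)
  \<comment> \<open>Duality: the state equation of \<open>X\<close> tested with \<open>W\<close> is
    the adjoint equation of \<open>W\<close> tested with \<open>X\<close>, which is available
    because \<open>X\<close> is a combination of \<open>Y\<close> and \<open>W\<close>.\<close>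
  have "ip D W = \<C> W X" using AX(2) by (simp add: formC_eq_formA W XV)
  also have "\<dots> = (1 - s) * \<C> W Y + (- t) * \<C> W W"
    using A_comb_left[OF W, of "1 - s" "- t"] by (simp only: formC_eq_formA W XV Y flip: X_def)
  also have "\<dots> = ((1 - s) * ip Y Y + (- t) * ip Y W) + ((1 - s) * ip r Y + (- t) * ip r W)"
    by (simp add: adjoint algebra_simps)
  also have "\<dots> = ip Y X + ip r X"
    unfolding X_def ip_comb[OF V_L2[OF Y]] ip_comb[OF r] ..
  also have "ip Y X = ip X X + ip Z X"
  proof -
    have "Y = (\<lambda>x. X x + Z x)" by (simp add: X_def Z_def fun_eq_iff algebra_simps)
    then show ?thesis using L2_inner_add_left[OF V_L2[OF XV] V_L2[OF ZV] V_L2[OF XV]] by simp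
  qed
  \<comment> \<open>Splitting \<open>Y\<close> into \<open>X\<close> and \<open>Z\<close> exposes
    the square of the norm of \<open>X\<close>, which carries a minus sign and is dropped
    next.\<close>
  finally have "- ip D W = - (N2 X)\<^sup>2 - ip Z X - ip r X"
    by (simp add: L2_inner_self)
  also have "\<dots> \<le> N2 Z * N2 X + N2 r * N2 X"
    using L2_Cauchy_Schwarz[OF V_L2[OF ZV] V_L2[OF XV]] L2_Cauchy_Schwarz[OF r V_L2[OF XV]]
      zero_le_power2[of "N2 X"] by linarith
  also have "\<dots> \<le> (C\<^sub>\<Omega>\<^sup>2 * N2 \<delta> + N2 r) * (C\<^sub>\<Omega>\<^sup>2 * N2 D)"
    unfolding distrib_right[symmetric] using Z_bound X_bound
    by (intro mult_mono) (auto simp: L2_norm_nonneg intro!: add_nonneg_nonneg mult_nonneg_nonneg)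
  finally show ?thesis .
qed

end

text \<open>In each component the clamped value minimises w m + theta m^2 / 2 over an interval, and
  the inequality is the first-order condition. With t = -w / theta it reads (m - t) (v - m) >=
  0.\<close>

lemma box_projection_variational_inequality:
  fixes a b w v :: "real ^ 'd"
  assumes \<theta>: "\<theta> > 0" and ab: "\<And>i. a $ i < b $ i" and v: "\<And>i. a $ i \<le> v $ i \<and> v $ i \<le> b $ i"
  shows "0 \<le> (w + \<theta> *\<^sub>R (\<chi> i. min (b $ i) (max (a $ i) ((- 1 / \<theta>) * w $ i))))
    \<bullet> (v - (\<chi> i. min (b $ i) (max (a $ i) ((- 1 / \<theta>) * w $ i))))"
proof -
  have "0 \<le> (w $ i + \<theta> * m) * (v $ i - m)"
    if m: "m = min (b $ i) (max (a $ i) ((- 1 / \<theta>) * w $ i))" for i m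
  proof -
    define t where "t = (- 1 / \<theta>) * w $ i"
    have "w $ i = - \<theta> * t" using \<theta> by (simp add: t_def)
    then have "(w $ i + \<theta> * m) * (v $ i - m) = \<theta> * ((m - t) * (v $ i - m))"
      by (simp add: algebra_simps)
    moreover have "0 \<le> (m - t) * (v $ i - m)"
      using v[of i] ab[of i] m by (fold t_def) (auto simp: min_def max_def zero_le_mult_iff)
    ultimately show ?thesis using \<theta> by (metis less_imp_le mult_nonneg_nonneg)
  qed
  then show ?thesis
    by (auto simp: inner_vec_def intro!: sum_nonneg)
qed

lemma box_projection_admissible:
  fixes w :: "'d::finite vector_field"
  assumes \<Omega>: "\<Omega> \<in> sets lebesgue" "bounded \<Omega>" and w: "w \<in> L2_space \<Omega>" and ab: "\<And>i. a $ i < b $ i"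
  shows "box_projection a b w \<in> admissible_controls \<Omega> a b"
proof -
  have bounds: "a $ i \<le> box_projection a b w x $ i \<and> box_projection a b w x $ i \<le> b $ i" for i x
    using ab[of i] by (auto simp: box_projection_def)
  have "continuous_on UNIV (\<lambda>z :: real ^ 'd. \<chi> i. min (b $ i) (max (a $ i) (z $ i)))"
    by (intro continuous_on_vec_lambda continuous_intros)
  from measurable_compose[OF L2_measurable[OF w] borel_measurable_continuous_onI[OF this]]
  have m: "box_projection a b w \<in> borel_measurable (lebesgue_on \<Omega>)"
    by (simp add: box_projection_def[abs_def])
  interpret finite_measure "lebesgue_on \<Omega>"
    using \<Omega> by (intro finite_measure_lebesgue_on bounded_set_imp_lmeasurable)
  define B where "B = (\<Sum>i\<in>UNIV. \<bar>a $ i\<bar> + \<bar>b $ i\<bar>)"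
  have "norm (box_projection a b w x) \<le> B" for x
  proof -
    have "norm (box_projection a b w x) \<le> (\<Sum>i\<in>UNIV. \<bar>box_projection a b w x $ i\<bar>)"
      by (rule norm_le_l1_cart)
    also have "\<dots> \<le> B"
      unfolding B_def
    proof (rule sum_mono)
      fix i show "\<bar>box_projection a b w x $ i\<bar> \<le> \<bar>a $ i\<bar> + \<bar>b $ i\<bar>"
        using bounds[of i x] by linarith
    qed
    finally show ?thesis .
  qed
  then have "integrable (lebesgue_on \<Omega>) (\<lambda>x. (norm (box_projection a b w x))\<^sup>2)"
    using m by (intro integrable_const_bound[where B="B\<^sup>2"]) (auto intro!: AE_I2 power_mono)
  with m bounds show ?thesis
    by (simp add: admissible_controls_def L2_space_def)
qed

text \<open>Here \<open>k\<close> stands for \<open>C\<^sub>i\<^sub>s (1 + C\<^sub>c\<^sub>t)\<close>.\<close>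

lemma total_error_arithmetic:
  fixes C k \<theta> \<rho> \<mu> \<omega> U D \<eta>\<^sub>y \<eta>\<^sub>p \<eta>\<^sub>w \<eta>\<^sub>q \<eta>\<^sub>u ey ep ew eq :: real
  assumes pos: "\<theta> > 0" "\<rho> \<ge> 0" "C > 0"
    and nonneg: "0 \<le> U" "0 \<le> D" "0 \<le> ey" "0 \<le> ep" "0 \<le> ew" "0 \<le> eq"
    and U: "U \<le> D + \<eta>\<^sub>u" and D: "\<theta> * D \<le> C * \<eta>\<^sub>w + C ^ 3 * \<eta>\<^sub>y + C ^ 4 * \<eta>\<^sub>u"
    and ey: "ey \<le> \<eta>\<^sub>y + C * U" and ew: "ew \<le> \<eta>\<^sub>w + C\<^sup>2 * ey"
    and ep: "ep \<le> \<eta>\<^sub>p + k * C * U" and eq: "eq \<le> \<eta>\<^sub>q + k * C\<^sup>2 * ey"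
    and \<mu>: "\<mu> = 4 / \<theta>\<^sup>2" and \<omega>: "\<omega> = k\<^sup>2"
  shows "ey\<^sup>2 + \<rho> * ep\<^sup>2 + ew\<^sup>2 + \<rho> * eq\<^sup>2 + U\<^sup>2
    \<le> (2 + 2 * \<mu> * C ^ 6 + 4 * (1 + \<rho> * \<omega>) * (C ^ 4 + \<mu> * C ^ 8 + 2 * \<mu> * C ^ 12)) * \<eta>\<^sub>y\<^sup>2
      + 2 * \<rho> * \<eta>\<^sub>p\<^sup>2
      + (2 + \<mu> * C\<^sup>2 + 2 * \<mu> * (1 + \<rho> * \<omega>) * (C ^ 4 + 2 * C ^ 8)) * \<eta>\<^sub>w\<^sup>2
      + 2 * \<rho> * \<eta>\<^sub>q\<^sup>2
      + (2 + 2 * \<mu> * C ^ 8 + 4 * (1 + \<rho> * \<omega>) * (C\<^sup>2 + 2 * C ^ 6 + \<mu> * C ^ 10 + 2 * \<mu> * C ^ 14)) * \<eta>\<^sub>u\<^sup>2"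
proof -
  have sq: "x\<^sup>2 \<le> 2 * s\<^sup>2 + 2 * t\<^sup>2" if "0 \<le> x" "x \<le> s + t" for x s t :: real
  proof -
    have "x\<^sup>2 \<le> (s + t)\<^sup>2" using that by (intro power_mono)
    also have "\<dots> \<le> 2 * s\<^sup>2 + 2 * t\<^sup>2"
      using sum_squares_bound[of s t] by (simp add: power2_sum)
    finally show ?thesis .
  qed
  have "0 \<le> \<mu>" using \<mu> by simp
  have "0 \<le> \<omega>" using \<omega> by simp
  \<comment> \<open>The resulting bound for U^2. The \<open>\<eta>\<^sub>w\<close> term is split off
    first and picks up two factors 2, which is mu = 4 / theta^2; the other two terms are separated
    afterwards and get one factor 2 more.\<close>
  define S where "S = \<mu> * C\<^sup>2 * \<eta>\<^sub>w\<^sup>2 + 2 * \<mu> * C ^ 6 * \<eta>\<^sub>y\<^sup>2 + (2 + 2 * \<mu> * C ^ 8) * \<eta>\<^sub>u\<^sup>2"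
  have "(\<theta> * D)\<^sup>2 \<le> 2 * (C * \<eta>\<^sub>w)\<^sup>2 + 2 * (C ^ 3 * \<eta>\<^sub>y + C ^ 4 * \<eta>\<^sub>u)\<^sup>2"
    using D nonneg pos by (intro sq) auto
  also have "(C ^ 3 * \<eta>\<^sub>y + C ^ 4 * \<eta>\<^sub>u)\<^sup>2 \<le> 2 * (C ^ 3 * \<eta>\<^sub>y)\<^sup>2 + 2 * (C ^ 4 * \<eta>\<^sub>u)\<^sup>2"
    using sum_squares_bound[of "C ^ 3 * \<eta>\<^sub>y" "C ^ 4 * \<eta>\<^sub>u"] by (simp add: power2_sum)
  finally have "\<theta>\<^sup>2 * D\<^sup>2 \<le> 2 * C\<^sup>2 * \<eta>\<^sub>w\<^sup>2 + 4 * C ^ 6 * \<eta>\<^sub>y\<^sup>2 + 4 * C ^ 8 * \<eta>\<^sub>u\<^sup>2"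
    by (simp add: power_mult_distrib flip: power_mult)
  then have "\<mu> * (\<theta>\<^sup>2 * D\<^sup>2) \<le> \<mu> * (2 * C\<^sup>2 * \<eta>\<^sub>w\<^sup>2 + 4 * C ^ 6 * \<eta>\<^sub>y\<^sup>2 + 4 * C ^ 8 * \<eta>\<^sub>u\<^sup>2)"
    using \<open>0 \<le> \<mu>\<close> by (rule mult_left_mono)
  moreover have "\<mu> * (\<theta>\<^sup>2 * D\<^sup>2) = 4 * D\<^sup>2" using pos by (simp add: \<mu>)
  moreover have "U\<^sup>2 \<le> 2 * D\<^sup>2 + 2 * \<eta>\<^sub>u\<^sup>2" using U nonneg by (intro sq)
  moreover have "\<mu> * (2 * C\<^sup>2 * \<eta>\<^sub>w\<^sup>2 + 4 * C ^ 6 * \<eta>\<^sub>y\<^sup>2 + 4 * C ^ 8 * \<eta>\<^sub>u\<^sup>2) = 2 * S - 4 * \<eta>\<^sub>u\<^sup>2"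
    by (simp add: S_def algebra_simps)
  ultimately have US: "U\<^sup>2 \<le> S" by linarith
  have ey2: "ey\<^sup>2 \<le> 2 * \<eta>\<^sub>y\<^sup>2 + 2 * C\<^sup>2 * U\<^sup>2"
    using sq[OF nonneg(3) ey] by (simp add: power_mult_distrib)
  have ew2: "ew\<^sup>2 \<le> 2 * \<eta>\<^sub>w\<^sup>2 + 2 * C ^ 4 * ey\<^sup>2"
    using sq[OF nonneg(5) ew] by (simp add: power_mult_distrib flip: power_mult)
  have ep2: "\<rho> * ep\<^sup>2 \<le> 2 * \<rho> * \<eta>\<^sub>p\<^sup>2 + 2 * \<rho> * \<omega> * C\<^sup>2 * U\<^sup>2"
    using mult_left_mono[OF sq[OF nonneg(4) ep] pos(2)] by (simp add: \<omega> power_mult_distrib algebra_simps)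
  have eq2: "\<rho> * eq\<^sup>2 \<le> 2 * \<rho> * \<eta>\<^sub>q\<^sup>2 + 2 * \<rho> * \<omega> * C ^ 4 * ey\<^sup>2"
    using mult_left_mono[OF sq[OF nonneg(6) eq] pos(2)]
    by (simp add: \<omega> power_mult_distrib algebra_simps flip: power_mult)
  define R where "R = 2 * \<rho> * \<eta>\<^sub>p\<^sup>2 + 2 * \<eta>\<^sub>w\<^sup>2 + 2 * \<rho> * \<eta>\<^sub>q\<^sup>2"
  define m where "m = 1 + \<rho> * \<omega>"
  have m: "1 \<le> m" using pos \<open>0 \<le> \<omega>\<close> by (simp add: m_def)
  \<comment> \<open>\<open>ew\<close> and \<open>eq\<close> depend on \<open>ey\<close> in the same
    way with weights 1 and \<open>\<rho> * \<omega>\<close>, which merge into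
    \<open>m\<close>.\<close>
  have "ey\<^sup>2 + \<rho> * ep\<^sup>2 + ew\<^sup>2 + \<rho> * eq\<^sup>2 + U\<^sup>2
      \<le> (1 + 2 * m * C ^ 4) * ey\<^sup>2 + R + (1 + 2 * \<rho> * \<omega> * C\<^sup>2) * U\<^sup>2"
    using ew2 ep2 eq2 by (simp add: R_def m_def algebra_simps)
  also have "(1 + 2 * m * C ^ 4) * ey\<^sup>2 \<le> (1 + 2 * m * C ^ 4) * (2 * \<eta>\<^sub>y\<^sup>2 + 2 * C\<^sup>2 * U\<^sup>2)"
    using m pos by (intro mult_left_mono ey2) auto
  \<comment> \<open>Here 2 C^2 from the velocity and 2 rho omega C^2 from the pressure combine to 2
    m C^2.\<close>
  also have "(1 + 2 * m * C ^ 4) * (2 * \<eta>\<^sub>y\<^sup>2 + 2 * C\<^sup>2 * U\<^sup>2) + R + (1 + 2 * \<rho> * \<omega> * C\<^sup>2) * U\<^sup>2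
      = (2 + 4 * m * C ^ 4) * \<eta>\<^sub>y\<^sup>2 + R + (1 + 2 * m * C\<^sup>2 + 4 * m * C ^ 6) * U\<^sup>2"
    unfolding m_def by algebra
  also have "(1 + 2 * m * C\<^sup>2 + 4 * m * C ^ 6) * U\<^sup>2 \<le> (1 + 2 * m * C\<^sup>2 + 4 * m * C ^ 6) * S"
    using m pos by (intro mult_left_mono US) auto
  also have "(2 + 4 * m * C ^ 4) * \<eta>\<^sub>y\<^sup>2 + R + (1 + 2 * m * C\<^sup>2 + 4 * m * C ^ 6) * S
    = (2 + 2 * \<mu> * C ^ 6 + 4 * m * (C ^ 4 + \<mu> * C ^ 8 + 2 * \<mu> * C ^ 12)) * \<eta>\<^sub>y\<^sup>2
      + 2 * \<rho> * \<eta>\<^sub>p\<^sup>2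
      + (2 + \<mu> * C\<^sup>2 + 2 * \<mu> * m * (C ^ 4 + 2 * C ^ 8)) * \<eta>\<^sub>w\<^sup>2
      + 2 * \<rho> * \<eta>\<^sub>q\<^sup>2
      + (2 + 2 * \<mu> * C ^ 8 + 4 * m * (C\<^sup>2 + 2 * C ^ 6 + \<mu> * C ^ 10 + 2 * \<mu> * C ^ 14)) * \<eta>\<^sub>u\<^sup>2"
    unfolding R_def S_def by algebra
  finally show ?thesis by (simp add: m_def)
qed


theorem theorem5p1:
  fixes \<Omega> :: "(real ^ 'd) set"
    and \<TT> :: "(real ^ 'd) set set set" and \<T> :: "(real ^ 'd) set set"
    and \<epsilon> \<kappa> \<theta> \<rho> \<beta> :: real
    and l a b :: "real ^ 'd"
    and c f y\<^sub>\<Omega> :: "real ^ 'd \<Rightarrow> real ^ 'd"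
    and VT UT :: "(real ^ 'd \<Rightarrow> real ^ 'd) set" and QT :: "(real ^ 'd \<Rightarrow> real) set"
    and \<S> \<Q> :: "(real ^ 'd \<Rightarrow> real ^ 'd) \<Rightarrow> (real ^ 'd \<Rightarrow> real) \<Rightarrow> (real ^ 'd \<Rightarrow> real ^ 'd)
                 \<Rightarrow> (real ^ 'd \<Rightarrow> real ^ 'd) \<Rightarrow> real"
    and \<H> \<K> :: "(real ^ 'd \<Rightarrow> real ^ 'd) \<Rightarrow> (real ^ 'd \<Rightarrow> real) \<Rightarrow> (real ^ 'd \<Rightarrow> real ^ 'd)
                 \<Rightarrow> (real ^ 'd \<Rightarrow> real) \<Rightarrow> real"
    and y w u yT wT uT yhat what :: "real ^ 'd \<Rightarrow> real ^ 'd"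
    and p q pT qT phat qhat :: "real ^ 'd \<Rightarrow> real"
    and \<eta>\<^sub>y \<eta>\<^sub>p \<eta>\<^sub>w \<eta>\<^sub>q \<eta>\<^sub>u :: real
    and C\<^sub>P C\<^sub>\<Omega> C\<^sub>c\<^sub>t C\<^sub>i\<^sub>s \<mu> \<omega> K\<^sub>y K\<^sub>w K\<^sub>u :: real
  assumes dim: "CARD('d) \<in> {2, 3}"
    and domain: "lipschitz_polytopal_domain \<Omega>"
    and mesh: "shape_regular_family \<Omega> \<TT>" "\<T> \<in> \<TT>"
    and params: "\<epsilon> > 0" "\<kappa> \<ge> 0" "\<theta> > 0" "\<rho> \<ge> 0"
    and data: "f \<in> L2_space \<Omega>" "y\<^sub>\<Omega> \<in> L2_space \<Omega>"
    and advection: "c \<in> W1inf \<Omega>" "AE x in lebesgue_on \<Omega>. wdiv \<Omega> c x = 0"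
    and bounds: "\<And>i. a $ i < b $ i"
    and box: "in_box_with_sides \<Omega> l"
    and inf_sup: "\<beta> > 0" "inf_sup_condition \<Omega> \<beta>"
    and CP_eq: "C\<^sub>P = poincare_const l"
    and COmega_eq: "C\<^sub>\<Omega> = energy_const \<epsilon> \<kappa> C\<^sub>P"
    and Cct_eq: "C\<^sub>c\<^sub>t = continuity_const \<Omega> \<epsilon> c C\<^sub>\<Omega>"
    and Cis_eq: "C\<^sub>i\<^sub>s = inf_sup_const \<epsilon> \<kappa> C\<^sub>P \<beta>"
    and optimal: "optimality_system \<Omega> \<epsilon> \<kappa> \<theta> c a b f y\<^sub>\<Omega> y p w q u"
    and discrete_spaces:
      "VT \<subseteq> H10 \<Omega>" "function_subspace VT"
      "QT \<subseteq> L2_zero_mean \<Omega>" "function_subspace QT"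
      "UT \<subseteq> admissible_controls \<Omega> a b"
    and discrete_optimal:
      "discrete_optimality_system \<Omega> \<epsilon> \<kappa> \<theta> c VT QT UT \<S> \<H> \<Q> \<K> f y\<^sub>\<Omega> yT pT wT qT uT"
    and hat_state: "state_solution \<Omega> \<epsilon> \<kappa> c (\<lambda>x. f x + uT x) yhat phat"
    and hat_adjoint: "adjoint_solution \<Omega> \<epsilon> \<kappa> c (\<lambda>x. yT x - y\<^sub>\<Omega> x) what qhat"
    and reliability:
      "normV \<Omega> \<epsilon> \<kappa> \<T> (\<lambda>x. yhat x - yT x) \<le> \<eta>\<^sub>y"
      "normQ \<T> (\<lambda>x. phat x - pT x) \<le> \<eta>\<^sub>p"
      "normV \<Omega> \<epsilon> \<kappa> \<T> (\<lambda>x. what x - wT x) \<le> \<eta>\<^sub>w"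
      "normQ \<T> (\<lambda>x. qhat x - qT x) \<le> \<eta>\<^sub>q"
    and etau_eq: "\<eta>\<^sub>u = control_indicator \<theta> a b wT uT \<T>"
    and mu_eq: "\<mu> = 4 / \<theta>\<^sup>2"
    and omega_eq: "\<omega> = C\<^sub>i\<^sub>s\<^sup>2 * (1 + C\<^sub>c\<^sub>t)\<^sup>2"
    and Ky_eq: "K\<^sub>y = 2 + 2 * \<mu> * C\<^sub>\<Omega> ^ 6
        + 4 * (1 + \<rho> * \<omega>) * (C\<^sub>\<Omega> ^ 4 + \<mu> * C\<^sub>\<Omega> ^ 8 + 2 * \<mu> * C\<^sub>\<Omega> ^ 12)"
    and Kw_eq: "K\<^sub>w = 2 + \<mu> * C\<^sub>\<Omega> ^ 2
        + 2 * \<mu> * (1 + \<rho> * \<omega>) * (C\<^sub>\<Omega> ^ 4 + 2 * C\<^sub>\<Omega> ^ 8)"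
    and Ku_eq: "K\<^sub>u = 2 + 2 * \<mu> * C\<^sub>\<Omega> ^ 8
        + 4 * (1 + \<rho> * \<omega>) * (C\<^sub>\<Omega> ^ 2 + 2 * C\<^sub>\<Omega> ^ 6 + \<mu> * C\<^sub>\<Omega> ^ 10 + 2 * \<mu> * C\<^sub>\<Omega> ^ 14)"
  shows "(total_error \<Omega> \<epsilon> \<kappa> \<rho> \<T>
            (\<lambda>x. y x - yT x) (\<lambda>x. p x - pT x) (\<lambda>x. w x - wT x) (\<lambda>x. q x - qT x)
            (\<lambda>x. u x - uT x))\<^sup>2
         \<le> K\<^sub>y * \<eta>\<^sub>y\<^sup>2 + 2 * \<rho> * \<eta>\<^sub>p\<^sup>2 + K\<^sub>w * \<eta>\<^sub>w\<^sup>2 + 2 * \<rho> * \<eta>\<^sub>q\<^sup>2 + K\<^sub>u * \<eta>\<^sub>u\<^sup>2"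
proof -
  have \<Omega>: "open \<Omega>" "bounded \<Omega>" "\<Omega> \<noteq> {}" and lip: "lipschitz_boundary \<Omega>"
    using domain by (auto simp: lipschitz_polytopal_domain_def)
  have mesh': "conforming_mesh \<Omega> \<T>"
    using mesh by (simp add: shape_regular_family_def)
  have CP: "C\<^sub>P > 0"
    unfolding CP_eq by (rule poincare_const_power2(2)) (use box in \<open>simp add: in_box_with_sides_def\<close>)
  interpret oseen \<Omega> \<epsilon> \<kappa> C\<^sub>P c
    by unfold_locales (use \<Omega> params CP advection Friedrichs_H10[OF \<Omega>(1,2) box] CP_eq in auto)
  note mesh_sum = sum_L2_norm_mesh[OF \<Omega>(1) lip mesh']
  define ut where "ut = box_projection a b (\<lambda>x. (- 1 / \<theta>) *\<^sub>R wT x)"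

  have state: "state_solution \<Omega> \<epsilon> \<kappa> c (\<lambda>x. f x + u x) y p"
    and adjoint: "adjoint_solution \<Omega> \<epsilon> \<kappa> c (\<lambda>x. y x - y\<^sub>\<Omega> x) w q"
    and u: "u \<in> admissible_controls \<Omega> a b"
    and vi: "\<And>v. v \<in> admissible_controls \<Omega> a b \<Longrightarrow> 0 \<le> ip (\<lambda>x. w x + \<theta> *\<^sub>R u x) (\<lambda>x. v x - u x)"
    using optimal by (auto simp: optimality_system_def)
  have disc: "yT \<in> VT" "pT \<in> QT" "wT \<in> VT" "qT \<in> QT" "uT \<in> UT"
    using discrete_optimal by (auto simp: discrete_optimality_system_def)
  have V: "y \<in> H10 \<Omega>" "w \<in> H10 \<Omega>" "yhat \<in> H10 \<Omega>" "what \<in> H10 \<Omega>" "yT \<in> H10 \<Omega>" "wT \<in> H10 \<Omega>"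
    and Q: "p \<in> L2_zero_mean \<Omega>" "q \<in> L2_zero_mean \<Omega>" "phat \<in> L2_zero_mean \<Omega>" "qhat \<in> L2_zero_mean \<Omega>"
      "pT \<in> L2_zero_mean \<Omega>" "qT \<in> L2_zero_mean \<Omega>"
    using state adjoint hat_state hat_adjoint disc discrete_spaces
    by (auto simp: state_solution_def adjoint_solution_def)
  have ut: "ut \<in> admissible_controls \<Omega> a b"
    unfolding ut_def
    by (intro box_projection_admissible \<Omega>_lebesgue bounded_\<Omega> bounds L2_scaleR V_L2 V)
  have L2: "u \<in> L2_space \<Omega>" "uT \<in> L2_space \<Omega>" "ut \<in> L2_space \<Omega>"
    using u ut disc discrete_spaces by (auto simp: admissible_controls_def)
  note L2V = V[THEN V_L2] and L2Q = Q[THEN L2_zero_mean_L2]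

  \<comment> \<open>The mesh is eliminated: all elementwise norms, the indicator and the total error
    become norms on \<Omega>.\<close>
  have normV: "normV \<Omega> \<epsilon> \<kappa> \<T> v = energy_norm \<Omega> \<epsilon> \<kappa> v" if "v \<in> H10 \<Omega>" for v
    using params mesh_sum[OF V_L2[OF that]] mesh_sum[OF V_grad_L2[OF that]]
    by (simp add: normV_def normV_elem_def energy_norm_def sum.distrib flip: sum_distrib_left)
  have normQ: "normQ \<T> \<phi> = N2 \<phi>" if "\<phi> \<in> L2_space \<Omega>" for \<phi>
    using mesh_sum[OF that] by (simp add: normQ_def L2_norm_nonneg)
  have \<eta>\<^sub>u: "\<eta>\<^sub>u = N2 (\<lambda>x. ut x - uT x)"
    using mesh_sum[OF L2_diff[OF L2(3,2)]]
    by (simp add: etau_eq control_indicator_def control_indicator_elem_def ut_def L2_norm_nonneg)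
  have E: "(total_error \<Omega> \<epsilon> \<kappa> \<rho> \<T> e1 e2 e3 e4 e5)\<^sup>2
      = (NV e1)\<^sup>2 + \<rho> * (N2 e2)\<^sup>2 + (NV e3)\<^sup>2 + \<rho> * (N2 e4)\<^sup>2 + (N2 e5)\<^sup>2"
    if "e1 \<in> H10 \<Omega>" "e2 \<in> L2_space \<Omega>" "e3 \<in> H10 \<Omega>" "e4 \<in> L2_space \<Omega>" "e5 \<in> L2_space \<Omega>" for e1 e2 e3 e4 e5
  proof -
    have nonneg: "0 \<le> (normV_elem \<Omega> \<epsilon> \<kappa> K e1)\<^sup>2 + \<rho> * (L2_norm K e2)\<^sup>2 +
        (normV_elem \<Omega> \<epsilon> \<kappa> K e3)\<^sup>2 + \<rho> * (L2_norm K e4)\<^sup>2 + (L2_norm K e5)\<^sup>2" for K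
      using params by simp
    have "(\<Sum>K\<in>\<T>. (normV_elem \<Omega> \<epsilon> \<kappa> K v)\<^sup>2) = (NV v)\<^sup>2" if "v \<in> H10 \<Omega>" for v
    proof -
      have "(\<Sum>K\<in>\<T>. (normV_elem \<Omega> \<epsilon> \<kappa> K v)\<^sup>2) = (normV \<Omega> \<epsilon> \<kappa> \<T> v)\<^sup>2"
        by (simp add: normV_def sum_nonneg)
      then show ?thesis by (simp add: normV[OF that])
    qed
    moreover have "0 \<le> (NV e1)\<^sup>2 + \<rho> * (N2 e2)\<^sup>2 + (NV e3)\<^sup>2 + \<rho> * (N2 e4)\<^sup>2 + (N2 e5)\<^sup>2"
      using params by simp
    ultimately show ?thesis
      using that nonneg
      by (simp add: total_error_def local_error_def sum_nonneg sum.distrib mesh_sum flip: sum_distrib_left)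
  qed

  \<comment> \<open>Each error passes through an auxiliary solution. \<open>?\<delta>\<close>,
    \<open>?r\<close> and \<open>?s\<close> are controlled by the indicators; \<open>?Y\<close> and
    \<open>?W\<close> solve the continuous equations with the control error and the full state error
    \<open>?e\<close> as data.\<close>
  let ?Y = "\<lambda>x. y x - yhat x" and ?W = "\<lambda>x. w x - what x" and ?D = "\<lambda>x. u x - ut x"
    and ?\<delta> = "\<lambda>x. ut x - uT x" and ?r = "\<lambda>x. yhat x - yT x" and ?e = "\<lambda>x. y x - yT x"
    and ?s = "\<lambda>x. what x - wT x"
  have VY: "?Y \<in> H10 \<Omega>" "?W \<in> H10 \<Omega>" "?r \<in> H10 \<Omega>" "?e \<in> H10 \<Omega>" "?s \<in> H10 \<Omega>"
    by (intro V_diff V)+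
  have LD: "?D \<in> L2_space \<Omega>" "?\<delta> \<in> L2_space \<Omega>" "(\<lambda>x. u x - uT x) \<in> L2_space \<Omega>"
    by (intro L2_diff L2)+
  have Y: "state_solution \<Omega> \<epsilon> \<kappa> c (\<lambda>x. u x - uT x) ?Y (\<lambda>x. p x - phat x)"
    using state_solution_diff[OF state hat_state] L2 data by (simp add: L2_add)
  have W: "adjoint_solution \<Omega> \<epsilon> \<kappa> c ?e ?W (\<lambda>x. q x - qhat x)"
    using adjoint_solution_diff[OF adjoint hat_adjoint] L2V data by (simp add: L2_diff)
  note Y_bound = state_solution_bound[OF inf_sup LD(3) Y]
    and W_bound = adjoint_solution_bound[OF inf_sup V_L2[OF VY(4)] W]
  have rel: "NV ?r \<le> \<eta>\<^sub>y" "N2 (\<lambda>x. phat x - pT x) \<le> \<eta>\<^sub>p" "NV ?s \<le> \<eta>\<^sub>w" "N2 (\<lambda>x. qhat x - qT x) \<le> \<eta>\<^sub>q"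
    using reliability normV[OF VY(3)] normV[OF VY(5)] normQ[OF L2_diff[OF L2Q(3,5)]] normQ[OF L2_diff[OF L2Q(4,6)]]
    by simp_all
  have C: "C\<^sub>\<Omega> > 0" unfolding COmega_eq by (rule energy_const_pos)

  have "- ip ?D ?W \<le> (C\<^sub>\<Omega>\<^sup>2 * N2 ?\<delta> + N2 ?r) * (C\<^sub>\<Omega>\<^sup>2 * N2 ?D)"
    unfolding COmega_eq
  proof (rule adjoint_inner_lower_bound[OF VY(1,2) LD(1,2) V_L2[OF VY(3)]])
    fix \<xi> assume \<xi>: "\<xi> \<in> {?Y, ?W}"
    \<comment> \<open>Both test fields are weakly divergence free, so the pressures drop out of the
      two equations.\<close>
    have "formB \<Omega> \<xi> (\<lambda>x. p x - phat x) = 0" "formB \<Omega> \<xi> (\<lambda>x. q x - qhat x) = 0" and V\<xi>: "\<xi> \<in> H10 \<Omega>"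
      using \<xi> Y W VY L2_zero_mean_diff[OF Q(1,3)] L2_zero_mean_diff[OF Q(2,4)]
      by (auto simp: state_solution_def adjoint_solution_def)
    then have "formA \<Omega> \<epsilon> \<kappa> c ?Y \<xi> = ip (\<lambda>x. u x - uT x) \<xi>" "formC \<Omega> \<epsilon> \<kappa> c ?W \<xi> = ip ?e \<xi>"
      using Y W by (force simp: state_solution_def adjoint_solution_def)+
    moreover have "ip (\<lambda>x. u x - uT x) \<xi> = ip ?D \<xi> + ip ?\<delta> \<xi>"
      using L2_inner_add_left[OF LD(1,2) V_L2[OF V\<xi>]] by simp
    moreover have "ip ?e \<xi> = ip ?Y \<xi> + ip ?r \<xi>"
      using L2_inner_add_left[OF V_L2[OF VY(1)] V_L2[OF VY(3)] V_L2[OF V\<xi>]] by simp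
    ultimately show "formA \<Omega> \<epsilon> \<kappa> c ?Y \<xi> = ip ?D \<xi> + ip ?\<delta> \<xi>" "formC \<Omega> \<epsilon> \<kappa> c ?W \<xi> = ip ?Y \<xi> + ip ?r \<xi>"
      by simp_all
  qed
  also have "\<dots> \<le> (C\<^sub>\<Omega>\<^sup>2 * \<eta>\<^sub>u + C\<^sub>\<Omega> * \<eta>\<^sub>y) * (C\<^sub>\<Omega>\<^sup>2 * N2 ?D)"
    using order.trans[OF L2_norm_le_energy_norm[OF VY(3), folded COmega_eq] mult_left_mono[OF rel(1)]] C
    by (intro mult_right_mono add_mono) (auto simp: \<eta>\<^sub>u L2_norm_nonneg)
  finally have DW: "- ip ?D ?W \<le> (C\<^sub>\<Omega>\<^sup>2 * \<eta>\<^sub>u + C\<^sub>\<Omega> * \<eta>\<^sub>y) * (C\<^sub>\<Omega>\<^sup>2 * N2 ?D)" .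
  have "\<bar>ip ?D ?s\<bar> \<le> C\<^sub>\<Omega> * N2 ?D * NV ?s"
    unfolding COmega_eq by (rule L2_inner_le_energy_norm[OF LD(1) VY(5)])
  also have "\<dots> \<le> C\<^sub>\<Omega> * N2 ?D * \<eta>\<^sub>w"
    using C by (intro mult_left_mono rel) (simp add: L2_norm_nonneg)
  finally have Ds: "- ip ?D ?s \<le> C\<^sub>\<Omega> * N2 ?D * \<eta>\<^sub>w" by linarith
  \<comment> \<open>The optimal control is tested with the projected one here, and the projected one
    with the optimal one in \<open>vi2\<close>, where the inequality holds pointwise.\<close>
  have vi1: "ip (\<lambda>x. w x + \<theta> *\<^sub>R u x) (\<lambda>x. ut x - u x) \<ge> 0"
    by (rule vi[OF ut])
  have vi2: "ip (\<lambda>x. wT x + \<theta> *\<^sub>R ut x) ?D \<ge> 0"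
    unfolding L2_inner_def
  proof (rule integral_nonneg_AE)
    have "AE x in lebesgue_on \<Omega>. \<forall>i. a $ i \<le> u x $ i \<and> u x $ i \<le> b $ i"
      using u by (simp add: admissible_controls_def)
    then show "AE x in lebesgue_on \<Omega>. 0 \<le> (wT x + \<theta> *\<^sub>R ut x) \<bullet> (u x - ut x)"
    proof eventually_elim
      case (elim x)
      then show ?case
        using box_projection_variational_inequality[OF params(3) bounds, of "u x" "wT x"]
        by (simp add: ut_def box_projection_def)
    qed
  qed
  \<comment> \<open>The sum of the two inequalities; the multipliers \<open>w\<close> and
    \<open>wT\<close> differ by \<open>?W\<close> plus \<open>?s\<close>.\<close>
  have "\<theta> * (N2 ?D)\<^sup>2 \<le> - ip ?D ?W - ip ?D ?s"
  proof -
    have ws: "ip ?D ?W + ip ?D ?s = ip w ?D - ip wT ?D"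
      using L2_inner_add_right[OF V_L2[OF VY(2)] V_L2[OF VY(5)] LD(1)]
        L2_inner_diff_right[OF L2V(2,6) LD(1)]
      by (simp add: L2_inner_commute[of \<Omega> ?D])
    have "ip (\<lambda>x. w x + \<theta> *\<^sub>R u x) (\<lambda>x. ut x - u x) = - (ip w ?D + \<theta> * ip u ?D)"
      using L2_inner_scaleR_right[of \<Omega> "\<lambda>x. w x + \<theta> *\<^sub>R u x" "-1" ?D]
      by (simp add: L2_inner_add_left L2_scaleR L2V L2 LD L2_inner_scaleR_left)
    moreover have "ip (\<lambda>x. wT x + \<theta> *\<^sub>R ut x) ?D = ip wT ?D + \<theta> * ip ut ?D"
      by (simp add: L2_inner_add_left L2_scaleR L2V L2 LD L2_inner_scaleR_left)
    moreover have "(N2 ?D)\<^sup>2 = ip u ?D - ip ut ?D"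
      using L2_inner_diff_left[OF L2(1,3) LD(1)] by (simp add: L2_inner_self)
    ultimately show ?thesis
      using vi1 vi2 ws by (simp add: right_diff_distrib)
  qed
  with DW Ds have "\<theta> * (N2 ?D)\<^sup>2 \<le> (C\<^sub>\<Omega>\<^sup>2 * \<eta>\<^sub>u + C\<^sub>\<Omega> * \<eta>\<^sub>y) * (C\<^sub>\<Omega>\<^sup>2 * N2 ?D) + C\<^sub>\<Omega> * N2 ?D * \<eta>\<^sub>w"
    by linarith
  then have *: "(\<theta> * N2 ?D) * N2 ?D \<le> (C\<^sub>\<Omega> * \<eta>\<^sub>w + C\<^sub>\<Omega> ^ 3 * \<eta>\<^sub>y + C\<^sub>\<Omega> ^ 4 * \<eta>\<^sub>u) * N2 ?D"
    by (simp add: power2_eq_square power3_eq_cube power4_eq_xxxx algebra_simps)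
  \<comment> \<open>\<open>\<eta>\<^sub>y\<close> and \<open>\<eta>\<^sub>w\<close> are given as
    arbitrary reals, but they dominate norms. The signs settle the case in which the factor to be
    cancelled is zero.\<close>
  have eta_nonneg: "0 \<le> \<eta>\<^sub>y" "0 \<le> \<eta>\<^sub>w" "0 \<le> \<eta>\<^sub>u"
    using rel(1,3) energy_norm_nonneg[of ?r] energy_norm_nonneg[of ?s] L2_norm_nonneg[of \<Omega> ?\<delta>]
    by (auto simp: \<eta>\<^sub>u intro: order.trans)
  have D: "\<theta> * N2 ?D \<le> C\<^sub>\<Omega> * \<eta>\<^sub>w + C\<^sub>\<Omega> ^ 3 * \<eta>\<^sub>y + C\<^sub>\<Omega> ^ 4 * \<eta>\<^sub>u"
  proof (cases "N2 ?D = 0")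
    case True
    then show ?thesis using eta_nonneg C by simp
  next
    case False
    then have "N2 ?D > 0" using L2_norm_nonneg[of \<Omega> ?D] by simp
    with * show ?thesis by (simp only: mult_le_cancel_right_pos)
  qed

  have U: "N2 (\<lambda>x. u x - uT x) \<le> N2 ?D + \<eta>\<^sub>u"
    using L2_norm_triangle[OF LD(1,2)] by (simp add: \<eta>\<^sub>u)
  have ey: "NV ?e \<le> \<eta>\<^sub>y + C\<^sub>\<Omega> * N2 (\<lambda>x. u x - uT x)"
    using energy_norm_triangle[OF VY(1,3)] Y_bound(1) rel(1) by (simp add: COmega_eq)
  \<comment> \<open>The adjoint equation receives the state error in L2; its return to the energy
    norm supplies the second power of the constant in the bounds for \<open>w\<close> and
    \<open>q\<close>.\<close>
  have e_L2: "C\<^sub>\<Omega> * N2 ?e \<le> C\<^sub>\<Omega>\<^sup>2 * NV ?e"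
    using mult_left_mono[OF L2_norm_le_energy_norm[OF VY(4)], of C\<^sub>\<Omega>] C
    by (simp add: power2_eq_square mult.assoc flip: COmega_eq)
  have ew: "NV (\<lambda>x. w x - wT x) \<le> \<eta>\<^sub>w + C\<^sub>\<Omega>\<^sup>2 * NV ?e"
    using energy_norm_triangle[OF VY(2,5)] W_bound(1) rel(3) e_L2 by (simp flip: COmega_eq)
  define k where "k = C\<^sub>i\<^sub>s * (1 + C\<^sub>c\<^sub>t)"
  have k: "k = inf_sup_const \<epsilon> \<kappa> C\<^sub>P \<beta> * (1 + continuity_const \<Omega> \<epsilon> c (energy_const \<epsilon> \<kappa> C\<^sub>P))"
    by (simp add: k_def Cis_eq Cct_eq COmega_eq)
  have "0 \<le> k"
    unfolding k using continuity_const_ge_1 inf_sup(1) params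
    by (intro mult_nonneg_nonneg) (auto simp: inf_sup_const_def)
  have ep: "N2 (\<lambda>x. p x - pT x) \<le> \<eta>\<^sub>p + k * C\<^sub>\<Omega> * N2 (\<lambda>x. u x - uT x)"
    using L2_norm_triangle[OF L2_diff[OF L2Q(1,3)] L2_diff[OF L2Q(3,5)]] Y_bound(2) rel(2)
    by (simp add: mult.assoc COmega_eq flip: k)
  have eq: "N2 (\<lambda>x. q x - qT x) \<le> \<eta>\<^sub>q + k * C\<^sub>\<Omega>\<^sup>2 * NV ?e"
    using L2_norm_triangle[OF L2_diff[OF L2Q(2,4)] L2_diff[OF L2Q(4,6)]] W_bound(2)[folded k, folded COmega_eq] rel(4)
      mult_left_mono[OF e_L2 \<open>0 \<le> k\<close>]
    by (simp add: mult.assoc)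
  have \<omega>: "\<omega> = k\<^sup>2"
    by (simp add: omega_eq k_def power_mult_distrib)
  show ?thesis
    unfolding E[OF VY(4) L2_diff[OF L2Q(1,5)] V_diff[OF V(2,6)] L2_diff[OF L2Q(2,6)] LD(3)] Ky_eq Kw_eq Ku_eq
    by (rule total_error_arithmetic[OF params(3,4) C L2_norm_nonneg L2_norm_nonneg energy_norm_nonneg L2_norm_nonneg
          energy_norm_nonneg L2_norm_nonneg U D ey ew ep eq mu_eq \<omega>])
qed

end
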